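(* Let $C$ be a computable subgroup of $PL_+(I)$. The soluble subgroup recognition problem is solvable for $C$; that is, there is an algorithm which, upon input of a finite subset $X$ of $C$, can determine whether or not the subgroup $\langle X\rangle$ generated by $X$ is a soluble group. Moreover, in the case that the group $\langle X\rangle$ is soluble, the algorithm also determines its derived length.
   Context: $PL_+(I)$ is the group of orientation-preserving piecewise-linear homeomorphisms of $I=[0,1]$ with finitely many breaks in slope, acting on the right ($x\cdot g$ is the image of $x$ under $g$). The support of $g$ is $\mathrm{Supp}(g)=\{x\in[0,1] : xg\ne x\}$; an orbital of $g$ is a connected component (open interval) of $\mathrm{Supp}(g)$. A breakpoint of $g$ is a point of $(0,1)$ where the derivative of $g$ does not exist; $\mathscr{B}_g$ is the set of breakpoints of $g$. A signed orbital is a pair $(A,g)$ with $g\in PL_+(I)$ and $A$ an orbital of $g$; it is associated with a group $G$ if $g\in G$. One-bump factors: if $f$ has orbitals $A_1,\dots,A_k$, the one-bump factors of $f$ are the elements $f_1,\dots,f_k$ of $PL_+(I)$ with $f_i|_{A_i}=f|_{A_i}$ and $f_i$ the identity off $A_i$; the pairs $(A_i,f_i)$ are the factor signed orbitals associated to $f$. The split group $S(G)$ of $G\le PL_+(I)$ is the subgroup of $PL_+(I)$ generated by the one-bump factors of all elements of $G$. The slope group $\Pi_G$ is the multiplicative subgroup of the positive reals $\mathbb{R}_+^*$ generated by the slopes of affine components of elements of $G$; one has $\Pi_{S(G)}=\Pi_G$. A multiplicative subgroup of $\mathbb{R}_+^*$ is discrete if there is a positive lower bound on the distance from $1$ of its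 non-identity elements. A subgroup $C\le PL_+(I)$ is computable if the elements of $C$ have representatives (some data structure) for which the following processes can be carried out by a computer: (1) Given $g,h\in S(C)$, determine $gh$ and $g^{-1}$. (2) Given $g\in C$, determine its set of breakpoints $\mathscr{B}_g$. (3) Given $g\in S(C)$ and a breakpoint or orbital endpoint $x$ of $S(C)$, compute $x\cdot g$. (4) Given two points $a,b\in[0,1]$ that occur either as breakpoints or as orbital endpoints of elements of $S(C)$, determine whether $a<b$, $a=b$, or $a>b$. (5) Given $g\in S(C)$, produce the finite tuple $[A_1,\dots,A_{k_g}]$ of all orbitals of $g$, where each $A_i$ is stored as the ordered pair $(a_i,b_i)=(\inf A_i,\sup A_i)$ and $a_1<a_2<\dots<a_{k_g}$. (6) Given a signed orbital $(A,g)$ associated with $S(C)$, output the factor signed orbital $(A,h)$ satisfying $h|_A=g|_A$ and $\mathrm{Supp}(h)=A$. (7) Given a signed orbital $((a,b),g)$ of $S(C)$, determine the slopes of the affine components of the graph of $g$ over $(a,b)$ near $a$ and near $b$ (the right derivative of $g$ at $a$ and the left derivative of $g$ at $b$). (8) Given two elements $m_1,m_2$ of $\Pi_C=\Pi_{S(C)}$, compute $m_1m_2$ and $m_1^{-1}$, and determine whether $m_1<m_2$, $m_1=m_2$, or $m_1>m_2$. (9) Given a finite set $\{m_1,\dots,m_k\}$ of positive numbers in $\Pi_C$, determine whether the multiplicative group $\langle m_1,\dots,m_k\rangle\le\mathbb{R}_+^*$ is discrete; if it is discrete, further determine integers $p_1,\dots,p_k$ such that $m_1^{p_1}\cdots m_k^{p_k}$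 is the least value in this group greater than one. The input set $X$ is given as a finite list of representatives of elements of $C$ in this data structure. The trivial group is soluble of derived length $0$. *)

theory Defs
  imports "HOL-Analysis.Analysis" "HOL-Algebra.Solvable_Groups" "HOL-Library.Nat_Bijection"
begin

subsection \<open>Partial recursive functions\<close>

text \<open>Kleene's partial recursive functions, in the unary presentation: tuples of arguments are
  single numbers, via the Cantor pairing \<^const>\<open>prod_encode\<close>. Pairing and its projections are
  primitive recursive, so this is the usual class of unary partial recursive functions.\<close>

definition mu_rec :: "(nat \<rightharpoonup> nat) \<Rightarrow> nat \<rightharpoonup> nat" where
  "mu_rec f a =
     (let found = (\<lambda>n. f (prod_encode (a, n)) = Some 0 \<and>
                       (\<forall>m<n. \<exists>k. f (prod_encode (a, m)) = Some (Suc k)))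
      in if \<exists>n. found n then Some (LEAST n. found n) else None)"

inductive partial_recursive :: "(nat \<rightharpoonup> nat) \<Rightarrow> bool" where
  zero: "partial_recursive (\<lambda>n. Some 0)"
| succ: "partial_recursive (\<lambda>n. Some (Suc n))"
| fst: "partial_recursive (\<lambda>n. Some (fst (prod_decode n)))"
| snd: "partial_recursive (\<lambda>n. Some (snd (prod_decode n)))"
| pair: "partial_recursive f \<Longrightarrow> partial_recursive g \<Longrightarrow>
    partial_recursive
      (\<lambda>n. Option.bind (f n) (\<lambda>a. Option.bind (g n) (\<lambda>b. Some (prod_encode (a, b)))))"
| comp: "partial_recursive f \<Longrightarrow> partial_recursive g \<Longrightarrow>
    partial_recursive (\<lambda>n. Option.bind (g n) f)"
| prim_rec: "partial_recursive f \<Longrightarrow> partial_recursive g \<Longrightarrow>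
    partial_recursive
      (\<lambda>n. rec_nat (f (fst (prod_decode n)))
             (\<lambda>i r. Option.bind r
                (\<lambda>v. g (prod_encode (fst (prod_decode n), prod_encode (i, v)))))
             (snd (prod_decode n)))"
| mu: "partial_recursive f \<Longrightarrow> partial_recursive (mu_rec f)"


subsection \<open>Piecewise linear homeomorphisms of the unit interval\<close>

text \<open>Elements are functions on all of \<open>\<real>\<close>, normalised to be the identity outside \<open>[0,1]\<close>, so
  that two of them are equal iff they agree on \<open>[0,1]\<close>. Breaks are allowed only at the points of
  the finite set \<open>B\<close>.\<close>

definition PL_plus :: "(real \<Rightarrow> real) set" where
  "PL_plus = {g.
     (\<forall>x. x \<notin> {0..1} \<longrightarrow> g x = x) \<and>
     (\<exists>h. homeomorphism {0..1} {0..1} g h) \<and>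
     strict_mono_on {0..1} g \<and>
     (\<exists>B. finite B \<and>
        (\<forall>a b. 0 \<le> a \<and> a < b \<and> b \<le> 1 \<and> {a<..<b} \<inter> B = {} \<longrightarrow>
           (\<exists>m c. \<forall>x\<in>{a..b}. g x = m * x + c)))}"

text \<open>The action is on the right, \<open>x \<cdot> gh = (x \<cdot> g) \<cdot> h\<close>, so the product \<open>gh\<close> applies \<open>g\<close> first.\<close>

definition PL_group :: "(real \<Rightarrow> real) monoid" where
  "PL_group = \<lparr>carrier = PL_plus, mult = (\<lambda>g h. h \<circ> g), one = id\<rparr>"

definition supp :: "(real \<Rightarrow> real) \<Rightarrow> real set" where
  "supp g = {x \<in> {0..1}. g x \<noteq> x}"

definition orbitals :: "(real \<Rightarrow> real) \<Rightarrow> real set set" where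
  "orbitals g = components (supp g)"

definition breakpoints :: "(real \<Rightarrow> real) \<Rightarrow> real set" where
  "breakpoints g = {x \<in> {0<..<1}. \<not> g differentiable (at x)}"

definition orbital_endpoints :: "(real \<Rightarrow> real) \<Rightarrow> real set" where
  "orbital_endpoints g = Inf ` orbitals g \<union> Sup ` orbitals g"

definition one_bump_factor :: "real set \<Rightarrow> (real \<Rightarrow> real) \<Rightarrow> real \<Rightarrow> real" where
  "one_bump_factor A g = (\<lambda>x. if x \<in> A then g x else x)"

definition split_group :: "(real \<Rightarrow> real) set \<Rightarrow> (real \<Rightarrow> real) set" where
  "split_group G = generate PL_group {one_bump_factor A g | A g. g \<in> G \<and> A \<in> orbitals g}"

definition special_points :: "(real \<Rightarrow> real) set \<Rightarrow> real set" where
  "special_points H = (\<Union>g\<in>H. breakpoints g \<union> orbital_endpoints g)"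

definition pos_reals :: "real monoid" where
  "pos_reals = \<lparr>carrier = {0<..}, mult = (*), one = 1\<rparr>"

definition affine_slopes :: "(real \<Rightarrow> real) \<Rightarrow> real set" where
  "affine_slopes g =
     {m. \<exists>a b c. 0 \<le> a \<and> a < b \<and> b \<le> 1 \<and> (\<forall>x\<in>{a<..<b}. g x = m * x + c)}"

definition slope_group :: "(real \<Rightarrow> real) set \<Rightarrow> real set" where
  "slope_group G = generate pos_reals (\<Union>g\<in>G. affine_slopes g)"

definition discrete_mult :: "real set \<Rightarrow> bool" where
  "discrete_mult H \<longleftrightarrow> (\<exists>\<epsilon>>0. \<forall>m\<in>H. m \<noteq> 1 \<longrightarrow> \<epsilon> \<le> \<bar>m - 1\<bar>)"


subsection \<open>Computable subgroups\<close>

definition ordering_code :: "real \<Rightarrow> real \<Rightarrow> nat" where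
  "ordering_code a b = (if a < b then 0 else if a = b then 1 else 2)"

text \<open>The data structure consists of natural numbers: \<open>\<nu> c = Some g\<close> says that \<open>c\<close> is a
  representative of the homeomorphism \<open>g\<close>, and \<open>\<delta>\<close>, \<open>\<mu>\<close> play the same role for the points
  (breakpoints and orbital endpoints of the split group) and for the slopes. An object may have
  many representatives, and no algorithm need recognise them: every process is only required to
  work on inputs of the prescribed kind.

  Every element of the split group has a representative. Representatives of further elements of
  \<^const>\<open>PL_plus\<close> are permitted, since a one-bump factor of an element of \<open>S(C)\<close> is not asked to
  lie in \<open>S(C)\<close> again; nothing can be computed from such representatives.

  In the process for discreteness the answer \<open>0\<close> means ``not discrete''. The trivial group is
  discrete but has no least element greater than one; there the exponents are unconstrained.\<close>

locale computable_subgroup =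
  fixes C :: "(real \<Rightarrow> real) set"
    and \<nu> :: "nat \<rightharpoonup> (real \<Rightarrow> real)"
    and \<delta> :: "nat \<rightharpoonup> real"
    and \<mu> :: "nat \<rightharpoonup> real"
  assumes subgroup: "subgroup C PL_group"
    and elements_represented: "split_group C \<subseteq> ran \<nu>" "ran \<nu> \<subseteq> PL_plus"
    and points_represented: "ran \<delta> = special_points (split_group C)"
    and slopes_represented: "ran \<mu> = slope_group C"
    and product:
      "\<exists>f. partial_recursive f \<and>
         (\<forall>c d g h. g \<in> split_group C \<and> h \<in> split_group C \<and> \<nu> c = Some g \<and> \<nu> d = Some h \<longrightarrow>
            (\<exists>e. f (prod_encode (c, d)) = Some e \<and> \<nu> e = Some (g \<otimes>\<^bsub>PL_group\<^esub> h)))"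
    and inverse:
      "\<exists>f. partial_recursive f \<and>
         (\<forall>c g. g \<in> split_group C \<and> \<nu> c = Some g \<longrightarrow>
            (\<exists>e. f c = Some e \<and> \<nu> e = Some (inv\<^bsub>PL_group\<^esub> g)))"
    and breakpoints:
      "\<exists>f. partial_recursive f \<and>
         (\<forall>c g. g \<in> C \<and> \<nu> c = Some g \<longrightarrow>
            (\<exists>ps xs. f c = Some (list_encode ps) \<and>
               list_all2 (\<lambda>p x. \<delta> p = Some x) ps xs \<and> set xs = breakpoints g))"
    and action:
      "\<exists>f. partial_recursive f \<and>
         (\<forall>c p g x. g \<in> split_group C \<and> \<nu> c = Some g \<and> \<delta> p = Some x \<longrightarrow>
            (\<exists>q. f (prod_encode (c, p)) = Some q \<and> \<delta> q = Some (g x)))"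
    and compare_points:
      "\<exists>f. partial_recursive f \<and>
         (\<forall>p q a b. \<delta> p = Some a \<and> \<delta> q = Some b \<longrightarrow>
            f (prod_encode (p, q)) = Some (ordering_code a b))"
    and orbitals:
      "\<exists>f. partial_recursive f \<and>
         (\<forall>c g. g \<in> split_group C \<and> \<nu> c = Some g \<longrightarrow>
            (\<exists>ps as. f c = Some (list_encode (map prod_encode ps)) \<and>
               list_all2 (\<lambda>(p, q) (a, b). \<delta> p = Some a \<and> \<delta> q = Some b) ps as \<and>
               sorted_wrt (<) (map fst as) \<and>
               (\<lambda>(a, b). {a<..<b}) ` set as = orbitals g))"
    and factor:
      "\<exists>f. partial_recursive f \<and>
         (\<forall>p q c a b g. g \<in> split_group C \<and> \<nu> c = Some g \<and> \<delta> p = Some a \<and> \<delta> q = Some b \<and>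
              {a<..<b} \<in> orbitals g \<longrightarrow>
            (\<exists>e. f (prod_encode (prod_encode (p, q), c)) = Some e \<and>
               \<nu> e = Some (one_bump_factor {a<..<b} g)))"
    and end_slopes:
      "\<exists>f. partial_recursive f \<and>
         (\<forall>p q c a b g. g \<in> split_group C \<and> \<nu> c = Some g \<and> \<delta> p = Some a \<and> \<delta> q = Some b \<and>
              {a<..<b} \<in> orbitals g \<longrightarrow>
            (\<exists>s t m n. f (prod_encode (prod_encode (p, q), c)) = Some (prod_encode (s, t)) \<and>
               \<mu> s = Some m \<and> \<mu> t = Some n \<and>
               (g has_real_derivative m) (at_right a) \<and>
               (g has_real_derivative n) (at_left b)))"
    and slope_product:
      "\<exists>f. partial_recursive f \<and>
         (\<forall>s t m n. \<mu> s = Some m \<and> \<mu> t = Some n \<longrightarrow>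
            (\<exists>u. f (prod_encode (s, t)) = Some u \<and> \<mu> u = Some (m * n)))"
    and slope_inverse:
      "\<exists>f. partial_recursive f \<and>
         (\<forall>s m. \<mu> s = Some m \<longrightarrow> (\<exists>u. f s = Some u \<and> \<mu> u = Some (inverse m)))"
    and compare_slopes:
      "\<exists>f. partial_recursive f \<and>
         (\<forall>s t m n. \<mu> s = Some m \<and> \<mu> t = Some n \<longrightarrow>
            f (prod_encode (s, t)) = Some (ordering_code m n))"
    and discreteness:
      "\<exists>f. partial_recursive f \<and>
         (\<forall>ss ms. list_all2 (\<lambda>s m. \<mu> s = Some m) ss ms \<longrightarrow>
            (let H = generate pos_reals (set ms) in
             if discrete_mult H
             then \<exists>ps. f (list_encode ss) = Some (Suc (list_encode (map int_encode ps))) \<and>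
                    length ps = length ms \<and>
                    (H \<noteq> {1} \<longrightarrow>
                       (let v = (\<Prod>i<length ms. (ms ! i) powi (ps ! i)) in
                        v \<in> H \<and> 1 < v \<and> (\<forall>w\<in>H. 1 < w \<longrightarrow> v \<le> w)))
             else f (list_encode ss) = Some 0))"


subsection \<open>The soluble subgroup recognition problem\<close>

text \<open>Only meaningful for soluble groups.\<close>

definition derived_length :: "('a, 'b) monoid_scheme \<Rightarrow> nat" where
  "derived_length G = (LEAST n. (derived G ^^ n) (carrier G) = {\<one>\<^bsub>G\<^esub>})"

definition generated_group :: "(real \<Rightarrow> real) set \<Rightarrow> (real \<Rightarrow> real) monoid" where
  "generated_group X = PL_group\<lparr>carrier := generate PL_group X\<rparr>"

end

theory Submission
  imports Defs
begin

text \<open>Call two overlapping orbitals, neither contained in the other, a transition chain. A soluble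
  group has none, since a chain yields towers of orbitals of every height. Without chains the
  orbitals of a finitely generated group are nested or disjoint, and each orbital that has a larger
  one above it contributes a break lying in the orbit of a break of a generator, distinct for
  distinct levels, so the height of towers is bounded.

  The slopes of such a group at an end of a maximal orbital are powers of the slope of a single
  element \<open>t\<close>, and the elements with slope one there have a common fixed point \<open>q\<close> inside. So
  everything but \<open>t\<close> happens in the fundamental domain between \<open>q\<close> and \<open>t q\<close>, and induction on the
  height writes the generators as words in finitely many one-bump functions, nested in such a way
  that passing to the derived group removes exactly the top level. Hence the group is soluble and
  its derived length is the height.

  Both a transition chain and such a system of bumps, together with the words, are finite objects
  that can be checked by the given processes, so an unbounded search finds one of them.\<close>


section \<open>Realizable functions\<close>

text \<open>The two bounds on the derived length come from different groups. The bumps generate a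
  group that may be larger than the one generated by \<open>X\<close>, and its derived series gives
  the upper bound. The nested orbitals belong to elements of the group of \<open>X\<close> itself
  and give the lower bound. Labels count nesting levels without gaps, so the bounds agree, and every
  certificate that passes the check is right, whichever the search meets first.

  Discreteness of the slopes at an end of a maximal orbital has two sources. If a further orbital
  lies strictly inside, a slope too close to 1 would move some translate of it partly off itself, a
  chain. If none does, the group acts commutatively on the orbital, and a slope too close to 1
  contradicts the affine germs at the two ends, compared through one element that carries a point
  near one end to a point near the other.

  Cutting is the delicate process: a factor of an element of \<open>S(C)\<close> is not known to lie
  in \<open>S(C)\<close>. Hence each bump is cut from a word in the input, which is an element of
  \<open>C\<close>, and never from an earlier bump.\<close>

definition realizable :: "(nat \<Rightarrow> 'a \<Rightarrow> bool) \<Rightarrow> (nat \<Rightarrow> 'b \<Rightarrow> bool) \<Rightarrow> ('a \<Rightarrow> 'b) \<Rightarrow> bool" where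
  "realizable R S \<phi> \<longleftrightarrow>
     (\<exists>f. partial_recursive f \<and> (\<forall>c x. R c x \<longrightarrow> (\<exists>e. f c = Some e \<and> S e (\<phi> x))))"

definition rep_nat :: "nat \<Rightarrow> nat \<Rightarrow> bool" where "rep_nat c n \<longleftrightarrow> c = n"

definition rep_bool :: "nat \<Rightarrow> bool \<Rightarrow> bool" where "rep_bool c b \<longleftrightarrow> c = of_bool b"

definition rep_prod :: "(nat \<Rightarrow> 'a \<Rightarrow> bool) \<Rightarrow> (nat \<Rightarrow> 'b \<Rightarrow> bool) \<Rightarrow> nat \<Rightarrow> 'a \<times> 'b \<Rightarrow> bool" where
  "rep_prod R S c z \<longleftrightarrow> (\<exists>a b. c = prod_encode (a, b) \<and> R a (fst z) \<and> S b (snd z))"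

definition rep_list :: "(nat \<Rightarrow> 'a \<Rightarrow> bool) \<Rightarrow> nat \<Rightarrow> 'a list \<Rightarrow> bool" where
  "rep_list R c xs \<longleftrightarrow> (\<exists>cs. c = list_encode cs \<and> list_all2 R cs xs)"

text \<open>Smaller domains make partial operations realizable: where \<open>P\<close> fails, a
  realizer may diverge or return nonsense. The branches of a conditional are treated in this
  way.\<close>

definition rep_sub :: "(nat \<Rightarrow> 'a \<Rightarrow> bool) \<Rightarrow> ('a \<Rightarrow> bool) \<Rightarrow> nat \<Rightarrow> 'a \<Rightarrow> bool" where
  "rep_sub R P c x \<longleftrightarrow> R c x \<and> P x"

section \<open>Composition, constants, pairing and primitive recursion\<close>

lemma realizableI:
  assumes "partial_recursive f" "\<And>c x. R c x \<Longrightarrow> \<exists>e. f c = Some e \<and> S e (\<phi> x)"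
  shows "realizable R S \<phi>"
  using assms unfolding realizable_def by blast

lemma realizable_cong:
  assumes "realizable R S \<phi>" "\<And>c x. R c x \<Longrightarrow> \<phi> x = \<psi> x"
  shows "realizable R S \<psi>"
  using assms unfolding realizable_def by (metis (no_types, lifting))

lemma realizable_mono:
  assumes "realizable R S \<phi>" "\<And>c x. R' c x \<Longrightarrow> R c x" "\<And>c x. S c x \<Longrightarrow> S' c x"
  shows "realizable R' S' \<phi>"
  using assms unfolding realizable_def by (metis (no_types, lifting))

lemma partial_recursive_Some: "partial_recursive Some"
  using partial_recursive.pair[OF partial_recursive.fst partial_recursive.snd] by simp

lemma partial_recursive_const: "partial_recursive (\<lambda>_. Some k)"
proof (induction k)
  case (Suc k)
  show ?case using partial_recursive.comp[OF partial_recursive.succ Suc] by simp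
qed (rule partial_recursive.zero)

lemma realizable_id: "realizable R R (\<lambda>x. x)"
  by (rule realizableI[OF partial_recursive_Some]) auto

lemma realizable_comp:
  assumes "realizable S T \<psi>" "realizable R S \<phi>"
  shows "realizable R T (\<lambda>x. \<psi> (\<phi> x))"
proof -
  obtain f where f: "partial_recursive f" "\<And>c x. R c x \<Longrightarrow> \<exists>e. f c = Some e \<and> S e (\<phi> x)"
    using assms(2) unfolding realizable_def by blast
  obtain g where g: "partial_recursive g" "\<And>c x. S c x \<Longrightarrow> \<exists>e. g c = Some e \<and> T e (\<psi> x)"
    using assms(1) unfolding realizable_def by blast
  show ?thesis
  proof (rule realizableI[OF partial_recursive.comp[OF g(1) f(1)]])
    fix c x assume "R c x"
    then obtain e where "f c = Some e" "S e (\<phi> x)" using f(2) by blast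
    with g(2)[of e "\<phi> x"] show "\<exists>e. Option.bind (f c) g = Some e \<and> T e (\<psi> (\<phi> x))" by auto
  qed
qed

text \<open>One representative of \<open>y\<close> is hard-wired; no way of computing it is
  required.\<close>

lemma realizable_const: "S c y \<Longrightarrow> realizable R S (\<lambda>_. y)"
  by (rule realizableI[OF partial_recursive_const[of c]]) auto

lemma realizable_Pair:
  assumes "realizable R S \<phi>" "realizable R T \<psi>"
  shows "realizable R (rep_prod S T) (\<lambda>x. (\<phi> x, \<psi> x))"
proof -
  obtain f where f: "partial_recursive f" "\<And>c x. R c x \<Longrightarrow> \<exists>e. f c = Some e \<and> S e (\<phi> x)"
    using assms(1) unfolding realizable_def by blast
  obtain g where g: "partial_recursive g" "\<And>c x. R c x \<Longrightarrow> \<exists>e. g c = Some e \<and> T e (\<psi> x)"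
    using assms(2) unfolding realizable_def by blast
  show ?thesis
  proof (rule realizableI[OF partial_recursive.pair[OF f(1) g(1)]])
    fix c x assume "R c x"
    then show "\<exists>e. Option.bind (f c) (\<lambda>a. Option.bind (g c) (\<lambda>b. Some (prod_encode (a, b)))) = Some e \<and>
        rep_prod S T e (\<phi> x, \<psi> x)"
      using f(2)[of c x] g(2)[of c x] unfolding rep_prod_def by auto
  qed
qed

lemma realizable_fst:
  assumes "realizable R (rep_prod S T) \<phi>"
  shows "realizable R S (\<lambda>x. fst (\<phi> x))"
proof (rule realizable_comp[OF _ assms])
  show "realizable (rep_prod S T) S fst"
    by (rule realizableI[OF partial_recursive.fst]) (auto simp: rep_prod_def)
qed

lemma realizable_snd:
  assumes "realizable R (rep_prod S T) \<phi>"
  shows "realizable R T (\<lambda>x. snd (\<phi> x))"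
proof (rule realizable_comp[OF _ assms])
  show "realizable (rep_prod S T) T snd"
    by (rule realizableI[OF partial_recursive.snd]) (auto simp: rep_prod_def)
qed

lemmas realizable_proj = realizable_fst realizable_snd realizable_id

lemma realizable_comp2:
  assumes "realizable (rep_prod S T) U (\<lambda>z. h (fst z) (snd z))" "realizable R S \<phi>" "realizable R T \<psi>"
  shows "realizable R U (\<lambda>x. h (\<phi> x) (\<psi> x))"
  using realizable_comp[OF assms(1) realizable_Pair[OF assms(2,3)]] by simp

lemma realizable_Suc:
  "realizable R rep_nat \<phi> \<Longrightarrow> realizable R rep_nat (\<lambda>x. Suc (\<phi> x))"
  by (erule realizable_comp[rotated], rule realizableI[OF partial_recursive.succ]) (auto simp: rep_nat_def)

lemma realizable_nat: "realizable R rep_nat (\<lambda>_. k)"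
  by (rule realizable_const[of _ k]) (simp add: rep_nat_def)

text \<open>The parameter keeps its code throughout the recursion, whereas the accumulated value may
  appear under any of its codes. The induction on the counter therefore carries an existential
  statement about that code.\<close>

lemma realizable_rec_nat:
  assumes base: "realizable R S b"
    and step: "realizable (rep_prod R (rep_prod rep_nat S)) S (\<lambda>z. s (fst z) (fst (snd z)) (snd (snd z)))"
    and n: "realizable R rep_nat n"
  shows "realizable R S (\<lambda>x. rec_nat (b x) (s x) (n x))"
proof -
  obtain f where f: "partial_recursive f" "\<And>c x. R c x \<Longrightarrow> \<exists>e. f c = Some e \<and> S e (b x)"
    using base unfolding realizable_def by blast
  obtain g where g: "partial_recursive g"
     "\<And>c z. rep_prod R (rep_prod rep_nat S) c z \<Longrightarrow> \<exists>e. g c = Some e \<and> S e (s (fst z) (fst (snd z)) (snd (snd z)))"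
    using step unfolding realizable_def by blast
  define h where "h = (\<lambda>n. rec_nat (f (fst (prod_decode n)))
             (\<lambda>i r. Option.bind r (\<lambda>v. g (prod_encode (fst (prod_decode n), prod_encode (i, v)))))
             (snd (prod_decode n)))"
  have h: "partial_recursive h" unfolding h_def by (rule partial_recursive.prim_rec[OF f(1) g(1)])
  have *: "\<exists>e. h (prod_encode (c, m)) = Some e \<and> S e (rec_nat (b x) (s x) m)" if "R c x" for c x m
  proof (induction m)
    case 0 then show ?case using f(2)[OF that] by (simp add: h_def)
  next
    case (Suc m)
    then obtain e where e: "h (prod_encode (c, m)) = Some e" "S e (rec_nat (b x) (s x) m)" by blast
    have "rep_prod R (rep_prod rep_nat S) (prod_encode (c, prod_encode (m, e))) (x, m, rec_nat (b x) (s x) m)"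
      using that e by (auto simp: rep_prod_def rep_nat_def)
    from g(2)[OF this] show ?case using e(1) by (simp add: h_def)
  qed
  have "realizable (rep_prod R rep_nat) S (\<lambda>z. rec_nat (b (fst z)) (s (fst z)) (snd z))"
    by (rule realizableI[OF h]) (auto simp: rep_prod_def rep_nat_def intro!: *)
  from realizable_comp[OF this realizable_Pair[OF realizable_id n]] show ?thesis by simp
qed

section \<open>Arithmetic and Boolean tests\<close>

lemma realizable_pred:
  "realizable R rep_nat \<phi> \<Longrightarrow> realizable R rep_nat (\<lambda>x. \<phi> x - 1)"
proof (erule realizable_comp[rotated])
  \<comment> \<open>The step returns its own counter, which in the last round is the
    predecessor.\<close>
  have "realizable rep_nat rep_nat (\<lambda>n. rec_nat 0 (\<lambda>i r. i) n)"
    by (rule realizable_rec_nat, rule realizable_nat) (rule realizable_proj)+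
  moreover have "rec_nat 0 (\<lambda>i r. i) n = n - 1" for n :: nat by (cases n) auto
  ultimately show "realizable rep_nat rep_nat (\<lambda>n. n - 1)" by simp
qed

lemma realizable_add:
  assumes "realizable R rep_nat \<phi>" "realizable R rep_nat \<psi>"
  shows "realizable R rep_nat (\<lambda>x. \<phi> x + \<psi> x)"
proof -
  have "realizable R rep_nat (\<lambda>x. rec_nat (\<phi> x) (\<lambda>i r. Suc r) (\<psi> x))"
    by (rule realizable_rec_nat[OF assms(1) realizable_Suc assms(2)]) (rule realizable_proj)+
  moreover have "rec_nat m (\<lambda>i r. Suc r) n = m + n" for m n :: nat by (induction n) auto
  ultimately show ?thesis by simp
qed

lemma realizable_diff:
  assumes "realizable R rep_nat \<phi>" "realizable R rep_nat \<psi>"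
  shows "realizable R rep_nat (\<lambda>x. \<phi> x - \<psi> x)"
proof -
  have "realizable R rep_nat (\<lambda>x. rec_nat (\<phi> x) (\<lambda>i r. r - 1) (\<psi> x))"
    by (rule realizable_rec_nat[OF assms(1) realizable_pred assms(2)]) (rule realizable_proj)+
  moreover have "rec_nat m (\<lambda>i r. r - 1) n = m - n" for m n :: nat by (induction n) auto
  ultimately show ?thesis by simp
qed

lemma realizable_of_bool:
  "realizable R rep_bool P \<longleftrightarrow> realizable R rep_nat (\<lambda>x. of_bool (P x))"
  unfolding realizable_def rep_bool_def rep_nat_def by (rule refl)

lemma realizable_less:
  assumes "realizable R rep_nat \<phi>" "realizable R rep_nat \<psi>"
  shows "realizable R rep_bool (\<lambda>x. \<phi> x < \<psi> x)"
proof -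
  \<comment> \<open>Subtraction is truncated, so \<open>1 - (1 - k)\<close> is the sign of
    \<open>k\<close>.\<close>
  have "realizable R rep_nat (\<lambda>x. 1 - (1 - (\<psi> x - \<phi> x)))"
    by (intro realizable_diff assms realizable_nat)
  moreover have "1 - (1 - (n - m)) = of_bool (m < n)" for m n :: nat by (cases "m < n") simp_all
  ultimately show ?thesis by (simp add: realizable_of_bool)
qed

lemma realizable_not:
  assumes "realizable R rep_bool P"
  shows "realizable R rep_bool (\<lambda>x. \<not> P x)"
proof -
  have "realizable R rep_nat (\<lambda>x. 1 - of_bool (P x))"
    using assms by (intro realizable_diff realizable_nat) (simp add: realizable_of_bool)
  moreover have "1 - of_bool p = (of_bool (\<not> p) :: nat)" for p by (cases p) auto
  ultimately show ?thesis by (simp add: realizable_of_bool)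
qed

lemma realizable_or:
  assumes "realizable R rep_bool P" "realizable R rep_bool Q"
  shows "realizable R rep_bool (\<lambda>x. P x \<or> Q x)"
proof -
  have "realizable R rep_nat (\<lambda>x. 1 - (1 - (of_bool (P x) + of_bool (Q x))))"
    using assms by (intro realizable_diff realizable_add realizable_nat) (simp_all add: realizable_of_bool)
  moreover have "1 - (1 - (of_bool p + of_bool q)) = (of_bool (p \<or> q) :: nat)" for p q by (cases p; cases q) simp_all
  ultimately show ?thesis by (simp add: realizable_of_bool)
qed

lemma realizable_and:
  assumes "realizable R rep_bool P" "realizable R rep_bool Q"
  shows "realizable R rep_bool (\<lambda>x. P x \<and> Q x)"
  using realizable_not[OF realizable_or[OF realizable_not[OF assms(1)] realizable_not[OF assms(2)]]] by simp

lemma realizable_imp: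
  assumes "realizable R rep_bool P" "realizable R rep_bool Q"
  shows "realizable R rep_bool (\<lambda>x. P x \<longrightarrow> Q x)"
  using realizable_or[OF realizable_not[OF assms(1)] assms(2)] unfolding imp_conv_disj .

lemma realizable_eq:
  assumes "realizable R rep_nat \<phi>" "realizable R rep_nat \<psi>"
  shows "realizable R rep_bool (\<lambda>x. \<phi> x = \<psi> x)"
proof -
  have "realizable R rep_bool (\<lambda>x. \<not> \<phi> x < \<psi> x \<and> \<not> \<psi> x < \<phi> x)"
    by (intro realizable_and realizable_not realizable_less assms)
  moreover have "(\<not> m < n \<and> \<not> n < m) = (m = n)" for m n :: nat by auto
  ultimately show ?thesis by simp
qed

text \<open>The unselected branch may diverge. Primitive recursion of length at most one evaluates a
  branch only on demand, and the results are added.\<close>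

lemma partial_recursive_guard:
  assumes "partial_recursive f" "partial_recursive p"
  shows "partial_recursive (\<lambda>c. Option.bind (p c) (\<lambda>n. if n = 0 then Some 0 else f c))"
proof -
  define h where "h = (\<lambda>n. rec_nat (Some 0)
             (\<lambda>i r. Option.bind r (\<lambda>v. f (fst (prod_decode (prod_encode (fst (prod_decode n), prod_encode (i, v)))))))
             (snd (prod_decode n)))"
  have h: "partial_recursive h" unfolding h_def
    by (rule partial_recursive.prim_rec[OF partial_recursive.zero])
       (use partial_recursive.comp[OF assms(1) partial_recursive.fst] in simp)
  have sg: "realizable rep_nat rep_nat (\<lambda>n. 1 - (1 - n))"
    by (intro realizable_diff realizable_nat realizable_id)
  then obtain s where s: "partial_recursive s" "\<And>n. s n = Some (1 - (1 - n))"
    unfolding realizable_def rep_nat_def by metis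
  have "partial_recursive (\<lambda>n. Option.bind (Some n) (\<lambda>a. Option.bind (Option.bind (p n) s) (\<lambda>b. Some (prod_encode (a, b)))))"
    by (intro partial_recursive.pair partial_recursive_Some partial_recursive.comp s assms(2))
  from partial_recursive.comp[OF h this]
  show ?thesis
  proof (rule back_subst[where P = partial_recursive], intro ext)
    fix c
    show "Option.bind (Option.bind (Some c) (\<lambda>a. Option.bind (Option.bind (p c) s) (\<lambda>b. Some (prod_encode (a, b))))) h
        = Option.bind (p c) (\<lambda>n. if n = 0 then Some 0 else f c)"
    proof (cases "p c")
      case (Some n)
      then show ?thesis by (cases n) (simp_all add: h_def s(2))
    qed simp
  qed
qed

lemma realizable_if:
  assumes "realizable R rep_bool P"
    and "realizable (rep_sub R P) S \<phi>"
    and "realizable (rep_sub R (\<lambda>x. \<not> P x)) S \<psi>"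
  shows "realizable R S (\<lambda>x. if P x then \<phi> x else \<psi> x)"
proof -
  obtain p where p: "partial_recursive p" "\<And>c x. R c x \<Longrightarrow> p c = Some (of_bool (P x))"
    using assms(1) unfolding realizable_def rep_bool_def by metis
  obtain q where q: "partial_recursive q" "\<And>c x. R c x \<Longrightarrow> q c = Some (of_bool (\<not> P x))"
    using realizable_not[OF assms(1)] unfolding realizable_def rep_bool_def by metis
  obtain f where f: "partial_recursive f" "\<And>c x. rep_sub R P c x \<Longrightarrow> \<exists>e. f c = Some e \<and> S e (\<phi> x)"
    using assms(2) unfolding realizable_def by blast
  obtain g where g: "partial_recursive g" "\<And>c x. rep_sub R (\<lambda>x. \<not> P x) c x \<Longrightarrow> \<exists>e. g c = Some e \<and> S e (\<psi> x)"
    using assms(3) unfolding realizable_def by blast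
  have "realizable (rep_prod rep_nat rep_nat) rep_nat (\<lambda>z. fst z + snd z)"
    by (rule realizable_add) (rule realizable_proj)+
  then obtain a where a: "partial_recursive a" "\<And>c z. rep_prod rep_nat rep_nat c z \<Longrightarrow> a c = Some (fst z + snd z)"
    unfolding realizable_def rep_nat_def[of _ "_ + _"] by metis
  have a: "partial_recursive a" "\<And>m n. a (prod_encode (m, n)) = Some (m + n)"
    using a(1) a(2)[of "prod_encode (_, _)" "(_, _)"] by (simp_all add: rep_prod_def rep_nat_def)
  show ?thesis
  proof (rule realizableI[OF partial_recursive.comp[OF a(1)
          partial_recursive.pair[OF partial_recursive_guard[OF f(1) p(1)] partial_recursive_guard[OF g(1) q(1)]]]])
    fix c x assume R: "R c x"
    show "\<exists>e. Option.bind
             (Option.bind (Option.bind (p c) (\<lambda>n. if n = 0 then Some 0 else f c))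
               (\<lambda>a. Option.bind (Option.bind (q c) (\<lambda>n. if n = 0 then Some 0 else g c))
                      (\<lambda>b. Some (prod_encode (a, b)))))
             a = Some e \<and> S e (if P x then \<phi> x else \<psi> x)"
      using f(2)[of c x] g(2)[of c x] R by (cases "P x") (auto simp: p(2)[OF R] q(2)[OF R] a(2) rep_sub_def)
  qed
qed

section \<open>Lists, folds and bounded quantifiers\<close>

lemma rep_list_Nil: "rep_list A c [] \<longleftrightarrow> c = 0"
  by (auto simp: rep_list_def)

lemma rep_list_Cons:
  "rep_list A c (x # xs) \<longleftrightarrow> (\<exists>a b. c = Suc (prod_encode (a, b)) \<and> A a x \<and> rep_list A b xs)"
proof
  assume "rep_list A c (x # xs)"
  then obtain a cs where "c = list_encode (a # cs)" "A a x" "list_all2 A cs xs"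
    unfolding rep_list_def list_all2_Cons2 by blast
  then show "\<exists>a b. c = Suc (prod_encode (a, b)) \<and> A a x \<and> rep_list A b xs"
    unfolding rep_list_def by auto
next
  assume "\<exists>a b. c = Suc (prod_encode (a, b)) \<and> A a x \<and> rep_list A b xs"
  then obtain a cs where "c = list_encode (a # cs)" "A a x" "list_all2 A cs xs"
    unfolding rep_list_def by auto
  then show "rep_list A c (x # xs)"
    unfolding rep_list_def by (intro exI[of _ "a # cs"]) simp
qed

lemma realizable_Nil: "realizable R (rep_list A) (\<lambda>_. [])"
  by (rule realizable_const[of _ 0]) (simp add: rep_list_Nil)

lemma realizable_Cons:
  assumes "realizable R A \<phi>" "realizable R (rep_list A) \<psi>"
  shows "realizable R (rep_list A) (\<lambda>x. \<phi> x # \<psi> x)"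
proof -
  have "realizable (rep_prod A (rep_list A)) (rep_list A) (\<lambda>z. fst z # snd z)"
    by (rule realizableI[OF partial_recursive.succ]) (auto simp: rep_prod_def rep_list_Cons)
  from realizable_comp[OF this realizable_Pair[OF assms]] show ?thesis by simp
qed

lemma realizable_null:
  assumes "realizable R (rep_list A) \<phi>"
  shows "realizable R rep_bool (\<lambda>x. \<phi> x = [])"
proof (rule realizable_comp[OF _ assms])
  have "realizable rep_nat rep_bool (\<lambda>n. n = 0)"
    by (intro realizable_eq realizable_nat realizable_id)
  then obtain f where f: "partial_recursive f" "\<And>n. f n = Some (of_bool (n = 0))"
    unfolding realizable_def rep_nat_def rep_bool_def by metis
  show "realizable (rep_list A) rep_bool (\<lambda>x. x = [])"
  proof (rule realizableI[OF f(1)])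
    fix c and x :: "'b list" assume "rep_list A c x"
    then show "\<exists>e. f c = Some e \<and> rep_bool e (x = [])"
      by (cases x) (auto simp: f(2) rep_bool_def rep_list_Nil rep_list_Cons)
  qed
qed

text \<open>The code of a nonempty list is the successor of the code of the pair of head and tail,
  so the predecessor function does both at once.\<close>

lemma realizable_uncons:
  "realizable (rep_sub (rep_list A) (\<lambda>x. x \<noteq> [])) (rep_prod A (rep_list A)) (\<lambda>x. (hd x, tl x))"
proof -
  have "realizable rep_nat rep_nat (\<lambda>n. n - 1)"
    by (intro realizable_pred realizable_id)
  then obtain f where f: "partial_recursive f" "\<And>n. f n = Some (n - 1)"
    unfolding realizable_def rep_nat_def by metis
  show ?thesis
  proof (rule realizableI[OF f(1)])
    fix c and x :: "'a list" assume "rep_sub (rep_list A) (\<lambda>x. x \<noteq> []) c x"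
    then show "\<exists>e. f c = Some e \<and> rep_prod A (rep_list A) e (hd x, tl x)"
      by (cases x) (auto simp: f(2) rep_sub_def rep_prod_def rep_list_Cons)
  qed
qed

lemma realizable_sub:
  "realizable R S \<phi> \<Longrightarrow> (\<And>c x. R c x \<Longrightarrow> P (\<phi> x)) \<Longrightarrow> realizable R (rep_sub S P) \<phi>"
  unfolding realizable_def rep_sub_def by (metis (no_types, lifting))

lemma realizable_from_sub: "realizable R S \<phi> \<Longrightarrow> realizable (rep_sub R P) S \<phi>"
  by (erule realizable_mono) (auto simp: rep_sub_def)

lemma realizable_list_case:
  assumes L: "realizable R (rep_list A) L"
    and "realizable R S \<phi>"
    and "realizable (rep_prod R (rep_prod A (rep_list A))) S (\<lambda>z. \<psi> (fst z) (fst (snd z)) (snd (snd z)))"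
  shows "realizable R S (\<lambda>x. case L x of [] \<Rightarrow> \<phi> x | a # l \<Rightarrow> \<psi> x a l)"
proof -
  have "realizable (rep_sub R (\<lambda>x. L x \<noteq> [])) (rep_sub (rep_list A) (\<lambda>x. x \<noteq> [])) L"
  proof (rule realizable_sub[OF realizable_from_sub[OF L]])
    fix c x assume "rep_sub R (\<lambda>x. L x \<noteq> []) c x" then show "L x \<noteq> []" by (simp add: rep_sub_def)
  qed
  from realizable_comp[OF realizable_uncons this]
  have u: "realizable (rep_sub R (\<lambda>x. L x \<noteq> [])) (rep_prod A (rep_list A)) (\<lambda>x. (hd (L x), tl (L x)))" .
  have "realizable (rep_sub R (\<lambda>x. L x \<noteq> [])) S (\<lambda>x. \<psi> x (hd (L x)) (tl (L x)))"
    using realizable_comp[OF assms(3) realizable_Pair[OF realizable_from_sub[OF realizable_id] u]] by simp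
  then have "realizable R S (\<lambda>x. if L x = [] then \<phi> x else \<psi> x (hd (L x)) (tl (L x)))"
    by (rule realizable_if[OF realizable_null[OF L] realizable_from_sub[OF assms(2)]])
  then show ?thesis
    by (rule realizable_cong) (auto split: list.split)
qed

text \<open>The number of iterations is the code of the list, which bounds its length.\<close>

lemma realizable_fold:
  assumes L: "realizable R (rep_list A) L"
    and init: "realizable R S i"
    and step: "realizable (rep_prod R (rep_prod A S)) S (\<lambda>z. s (fst z) (fst (snd z)) (snd (snd z)))"
  shows "realizable R S (\<lambda>x. fold (s x) (L x) (i x))"
proof -
  define st where "st = (\<lambda>x (l :: 'b list, a). case l of [] \<Rightarrow> (l, a) | b # l' \<Rightarrow> (l', s x b a))"
  have st: "realizable (rep_prod R (rep_prod rep_nat (rep_prod (rep_list A) S))) (rep_prod (rep_list A) S)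
       (\<lambda>z. st (fst z) (snd (snd z)))"
  proof -
    have "realizable (rep_prod R (rep_prod rep_nat (rep_prod (rep_list A) S))) (rep_prod (rep_list A) S)
      (\<lambda>z. case fst (snd (snd z)) of [] \<Rightarrow> (fst (snd (snd z)), snd (snd (snd z)))
         | b # l' \<Rightarrow> (l', s (fst z) b (snd (snd (snd z)))))"
    proof (rule realizable_list_case)
      show "realizable (rep_prod R (rep_prod rep_nat (rep_prod (rep_list A) S))) (rep_list A) (\<lambda>z. fst (snd (snd z)))"
        by (rule realizable_proj)+
      show "realizable (rep_prod R (rep_prod rep_nat (rep_prod (rep_list A) S))) (rep_prod (rep_list A) S)
         (\<lambda>z. (fst (snd (snd z)), snd (snd (snd z))))"
        by (rule realizable_Pair) (rule realizable_proj)+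
      let ?R = "rep_prod (rep_prod R (rep_prod rep_nat (rep_prod (rep_list A) S))) (rep_prod A (rep_list A))"
      have "realizable ?R (rep_prod R (rep_prod A S)) (\<lambda>z. (fst (fst z), fst (snd z), snd (snd (snd (fst z)))))"
        by (rule realizable_Pair | rule realizable_proj)+
      from realizable_comp[OF step this]
      have "realizable ?R S (\<lambda>z. s (fst (fst z)) (fst (snd z)) (snd (snd (snd (fst z)))))" by simp
      from realizable_Pair[OF realizable_snd[OF realizable_snd[OF realizable_id]] this]
      show "realizable ?R (rep_prod (rep_list A) S)
         (\<lambda>z. (snd (snd z), s (fst (fst z)) (fst (snd z)) (snd (snd (snd (fst z))))))"
        .
    qed
    then show ?thesis
      by (rule realizable_cong) (auto simp: st_def split: list.split prod.split)
  qed
  have fixpt: "((st x ^^ n) (l, a)) = (drop n l, fold (s x) (take n l) a)" for x n l a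
  proof (induction n arbitrary: l a)
    case (Suc n)
    have "(st x ^^ Suc n) (l, a) = (st x ^^ n) (st x (l, a))" by (simp only: funpow_Suc_right o_apply)
    then show ?case using Suc by (cases l) (auto simp: st_def)
  qed simp
  have len: "length cs \<le> list_encode cs" for cs
  proof (induction cs)
    case (Cons c cs)
    then show ?case using le_prod_encode_2[of "list_encode cs" c] by simp
  qed simp
  obtain f where f: "partial_recursive f" "\<And>c x. R c x \<Longrightarrow> \<exists>e. f c = Some e \<and> rep_list A e (L x)"
    using L unfolding realizable_def by blast
  \<comment> \<open>An object may have many codes, so the number of iterations is no function of
    \<open>x\<close>. The relation \<open>R'\<close> carries it as a second component of which only
    a bound on the length is known.\<close>
  define R' where "R' = (\<lambda>c (z :: 'a \<times> nat). \<exists>b. c = prod_encode (b, snd z) \<and> R b (fst z) \<and> length (L (fst z)) \<le> snd z)"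
  have "realizable R' (rep_prod (rep_list A) S)
      (\<lambda>z. rec_nat (L (fst z), i (fst z)) (\<lambda>_. st (fst z)) (snd z))"
  proof (rule realizable_rec_nat)
    have p1: "realizable R' R fst" by (rule realizableI[OF partial_recursive.fst]) (auto simp: R'_def)
    show "realizable R' rep_nat snd" by (rule realizableI[OF partial_recursive.snd]) (auto simp: R'_def rep_nat_def)
    show "realizable R' (rep_prod (rep_list A) S) (\<lambda>z. (L (fst z), i (fst z)))"
      by (intro realizable_Pair realizable_comp[OF L p1] realizable_comp[OF init p1])
    have "realizable (rep_prod R' (rep_prod rep_nat (rep_prod (rep_list A) S)))
        (rep_prod R (rep_prod rep_nat (rep_prod (rep_list A) S))) (\<lambda>z. (fst (fst z), snd z))"
      by (rule realizable_Pair realizable_comp[OF p1] | rule realizable_proj)+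
    from realizable_comp[OF st this]
    show "realizable (rep_prod R' (rep_prod rep_nat (rep_prod (rep_list A) S))) (rep_prod (rep_list A) S)
         (\<lambda>z. st (fst (fst z)) (snd (snd z)))" by simp
  qed
  from realizable_snd[OF this]
  obtain g where g: "partial_recursive g"
    "\<And>c z. R' c z \<Longrightarrow> \<exists>e. g c = Some e \<and> S e (snd (rec_nat (L (fst z), i (fst z)) (\<lambda>_. st (fst z)) (snd z)))"
    unfolding realizable_def by blast
  show ?thesis
  proof (rule realizableI[OF partial_recursive.comp[OF g(1) partial_recursive.pair[OF partial_recursive_Some f(1)]]])
    fix c x assume R: "R c x"
    then obtain e where e: "f c = Some e" "rep_list A e (L x)" using f(2) by blast
    then obtain cs where cs: "e = list_encode cs" "list_all2 A cs (L x)" by (auto simp: rep_list_def)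
    then have "length (L x) \<le> e" using len[of cs] by (simp add: list_all2_lengthD)
    moreover from this have "R' (prod_encode (c, e)) (x, e)" using R by (auto simp: R'_def)
    moreover have rec_funpow: "rec_nat y (\<lambda>_. h) n = (h ^^ n) y" for y n and h :: "'b list \<times> 'c \<Rightarrow> _"
      by (induction n) auto
    have "snd (rec_nat (L x, i x) (\<lambda>_. st x) e) = fold (s x) (L x) (i x)"
      using \<open>length (L x) \<le> e\<close> by (simp add: rec_funpow fixpt)
    ultimately show "\<exists>e. Option.bind (Option.bind (Some c) (\<lambda>a. Option.bind (f c) (\<lambda>b. Some (prod_encode (a, b))))) g =
              Some e \<and> S e (fold (s x) (L x) (i x))"
      using g(2)[of "prod_encode (c, e)" "(x, e)"] by (simp add: e(1))
  qed
qed

lemma realizable_Bex_set: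
  assumes "realizable R (rep_list A) L" "realizable (rep_prod R A) rep_bool (\<lambda>z. P (fst z) (snd z))"
  shows "realizable R rep_bool (\<lambda>x. \<exists>a\<in>set (L x). P x a)"
proof -
  have "realizable R rep_bool (\<lambda>x. fold (\<lambda>a b. P x a \<or> b) (L x) False)"
  proof (rule realizable_fold[OF assms(1)])
    show "realizable R rep_bool (\<lambda>_. False)" by (rule realizable_const[of _ 0]) (simp add: rep_bool_def)
    have "realizable (rep_prod R (rep_prod A rep_bool)) (rep_prod R A) (\<lambda>z. (fst z, fst (snd z)))"
      by (rule realizable_Pair | rule realizable_proj)+
    from realizable_comp[OF assms(2) this]
    have "realizable (rep_prod R (rep_prod A rep_bool)) rep_bool (\<lambda>z. P (fst z) (fst (snd z)))" by simp
    from realizable_or[OF this realizable_snd[OF realizable_snd[OF realizable_id]]]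
    show "realizable (rep_prod R (rep_prod A rep_bool)) rep_bool (\<lambda>z. P (fst z) (fst (snd z)) \<or> snd (snd z))" .
  qed
  moreover have "fold (\<lambda>a b. P x a \<or> b) l c \<longleftrightarrow> c \<or> (\<exists>a\<in>set l. P x a)" for x l c
    by (induction l arbitrary: c) auto
  ultimately show ?thesis by simp
qed

lemma realizable_Ball_set:
  assumes "realizable R (rep_list A) L" "realizable (rep_prod R A) rep_bool (\<lambda>z. P (fst z) (snd z))"
  shows "realizable R rep_bool (\<lambda>x. \<forall>a\<in>set (L x). P x a)"
  using realizable_not[OF realizable_Bex_set[OF assms(1) realizable_not[OF assms(2)]]] by simp

lemma realizable_drop:
  assumes L: "realizable R (rep_list A) L" and n: "realizable R rep_nat n"
  shows "realizable R (rep_list A) (\<lambda>x. drop (n x) (L x))"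
proof -
  have tl: "realizable (rep_list A) (rep_list A) (\<lambda>l. case l of [] \<Rightarrow> [] | a # l' \<Rightarrow> l')"
    by (rule realizable_list_case[where L = "\<lambda>x. x"])
       (rule realizable_Nil realizable_proj)+
  have "realizable R (rep_list A) (\<lambda>x. rec_nat (L x) (\<lambda>_ l. case l of [] \<Rightarrow> [] | a # l' \<Rightarrow> l') (n x))"
    by (rule realizable_rec_nat[OF L realizable_comp[OF tl] n]) (rule realizable_proj)+
  moreover have "rec_nat l (\<lambda>_ l. case l of [] \<Rightarrow> [] | a # l' \<Rightarrow> l') k = drop k l" for l :: "'b list" and k
    by (induction k) (auto simp: drop_Suc tl_drop[symmetric] split: list.split)
  ultimately show ?thesis by simp
qed

lemma realizable_nth_default:
  assumes L: "realizable R (rep_list A) L" and n: "realizable R rep_nat n" and d: "realizable R A d"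
  shows "realizable R A (\<lambda>x. case drop (n x) (L x) of [] \<Rightarrow> d x | a # _ \<Rightarrow> a)"
  by (rule realizable_list_case[OF realizable_drop[OF L n] d]) (rule realizable_proj)+

lemma realizable_prod_decode:
  assumes "realizable R rep_nat \<phi>"
  shows "realizable R (rep_prod rep_nat rep_nat) (\<lambda>x. prod_decode (\<phi> x))"
proof (rule realizable_comp[OF _ assms], rule realizableI[OF partial_recursive_Some])
  fix c x :: nat assume "rep_nat c x"
  then have "c = prod_encode (fst (prod_decode x), snd (prod_decode x))" by (simp add: rep_nat_def)
  then show "\<exists>e. Some c = Some e \<and> rep_prod rep_nat rep_nat e (prod_decode x)"
    unfolding rep_prod_def rep_nat_def by blast
qed

lemma realizable_list_decode:
  assumes "realizable R rep_nat \<phi>"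
  shows "realizable R (rep_list rep_nat) (\<lambda>x. list_decode (\<phi> x))"
proof (rule realizable_comp[OF _ assms], rule realizableI[OF partial_recursive_Some])
  fix c x :: nat assume "rep_nat c x"
  then have "c = list_encode (list_decode x)" by (simp add: rep_nat_def)
  moreover have "list_all2 rep_nat (list_decode x) (list_decode x)"
    by (rule list_all2_refl) (simp add: rep_nat_def)
  ultimately show "\<exists>e. Some c = Some e \<and> rep_list rep_nat e (list_decode x)"
    unfolding rep_list_def by blast
qed

text \<open>The test depends on the represented \<open>x\<close> and not on its code, so all
  representatives of \<open>x\<close> lead to the same least witness. The hypothesis on existence
  makes the unbounded search terminate.\<close>

lemma realizable_search:
  assumes "realizable (rep_prod R rep_nat) rep_bool (\<lambda>z. P (fst z) (snd z))"
    and "\<And>c x. R c x \<Longrightarrow> \<exists>k. P x k"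
  shows "realizable R rep_nat (\<lambda>x. LEAST k. P x k)"
proof -
  obtain f where f: "partial_recursive f"
    "\<And>c z. rep_prod R rep_nat c z \<Longrightarrow> f c = Some (of_bool (\<not> P (fst z) (snd z)))"
    using realizable_not[OF assms(1)] unfolding realizable_def rep_bool_def by metis
  have f': "f (prod_encode (c, k)) = Some (of_bool (\<not> P x k))" if "R c x" for c x k
    using f(2)[of "prod_encode (c, k)" "(x, k)"] that by (simp add: rep_prod_def rep_nat_def)
  show ?thesis
  proof (rule realizableI[OF partial_recursive.mu[OF f(1)]])
    fix c x assume R: "R c x"
    obtain k where k: "P x k" using assms(2)[OF R] by blast
    define F where "F = (\<lambda>n. f (prod_encode (c, n)) = Some 0 \<and>
        (\<forall>m<n. \<exists>k. f (prod_encode (c, m)) = Some (Suc k)))"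
    have F: "F n \<longleftrightarrow> P x n \<and> (\<forall>m<n. \<not> P x m)" for n
    proof -
      have "(\<exists>k. f (prod_encode (c, m)) = Some (Suc k)) \<longleftrightarrow> \<not> P x m" for m
        by (cases "P x m") (simp_all add: f'[OF R])
      moreover have "f (prod_encode (c, n)) = Some 0 \<longleftrightarrow> P x n"
        by (simp add: f'[OF R])
      ultimately show ?thesis by (simp only: F_def)
    qed
    let ?n = "LEAST k. P x k"
    have n: "F ?n" using LeastI[of "P x", OF k] not_less_Least[of _ "P x"] unfolding F by blast
    have u: "m = ?n" if "F m" for m
    proof -
      have "P x m \<and> (\<forall>j<m. \<not> P x j)" using that unfolding F .
      then have "P x m" "\<not> ?n < m" using LeastI[of "P x", OF k] by blast+
      moreover have "?n \<le> m" by (rule Least_le[of "P x"]) fact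
      ultimately show ?thesis by linarith
    qed
    have "(LEAST m. F m) = ?n" using n u by (intro Least_equality) blast+
    moreover have "mu_rec f c = (if \<exists>m. F m then Some (LEAST m. F m) else None)"
      by (simp only: mu_rec_def Let_def F_def)
    ultimately show "\<exists>e. mu_rec f c = Some e \<and> rep_nat e ?n"
      using n unfolding rep_nat_def by (metis (no_types))
  qed
qed


section \<open>Piecewise linear homeomorphisms of the line\<close>

abbreviation finv :: "(real \<Rightarrow> real) \<Rightarrow> real \<Rightarrow> real" where
  "finv \<equiv> inv_into UNIV"

text \<open>The sign \<open>\<sigma>\<close> selects the side: the right one for \<open>1\<close>, the left one for \<open>-1\<close>.\<close>

definition germ :: "real \<Rightarrow> (real \<Rightarrow> real) \<Rightarrow> real \<Rightarrow> real \<Rightarrow> bool" where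
  "germ \<sigma> g x m \<longleftrightarrow> (\<exists>e>0. \<forall>t. 0 \<le> t \<and> t \<le> e \<longrightarrow> g (x + \<sigma> * t) = g x + \<sigma> * (m * t))"

definition slope :: "real \<Rightarrow> (real \<Rightarrow> real) \<Rightarrow> real \<Rightarrow> real" where
  "slope \<sigma> g x = (THE m. germ \<sigma> g x m)"

text \<open>Finiteness of the set of breaks is replaced by local conditions that survive the
  reflection \<open>mirror\<close>, which does not preserve \<open>PL_plus\<close>. Fixed points on
  both sides of every \<open>x\<close> make the orbital of a moved point bounded.\<close>

definition plf :: "(real \<Rightarrow> real) \<Rightarrow> bool" where
  "plf g \<longleftrightarrow> strict_mono g \<and> surj g \<and> (\<forall>x. \<exists>m. germ 1 g x m) \<and> (\<forall>x. \<exists>m. germ (-1) g x m)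
     \<and> (\<forall>x. \<exists>p\<le>x. g p = p) \<and> (\<forall>x. \<exists>q\<ge>x. g q = q)"

definition orb :: "(real \<Rightarrow> real) \<Rightarrow> real \<Rightarrow> real \<Rightarrow> bool" where
  "orb g a b \<longleftrightarrow> a < b \<and> g a = a \<and> g b = b \<and> (\<forall>x. a < x \<and> x < b \<longrightarrow> g x \<noteq> x)"

definition plgroup :: "(real \<Rightarrow> real) set \<Rightarrow> bool" where
  "plgroup H \<longleftrightarrow> (\<forall>g\<in>H. plf g) \<and> id \<in> H \<and> (\<forall>f\<in>H. \<forall>g\<in>H. f \<circ> g \<in> H) \<and> (\<forall>g\<in>H. finv g \<in> H)"

definition has_chain :: "(real \<Rightarrow> real) set \<Rightarrow> bool" where
  "has_chain H \<longleftrightarrow>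
     (\<exists>g\<in>H. \<exists>h\<in>H. \<exists>p q r s. orb g p q \<and> orb h r s \<and> p < r \<and> r < q \<and> q < s)"

lemma orbD:
  assumes "orb g a b"
  shows "a < b" "g a = a" "g b = b" "a < x \<Longrightarrow> x < b \<Longrightarrow> g x \<noteq> x"
  using assms unfolding orb_def by blast+

lemma plgroupD:
  assumes "plgroup H"
  shows "g \<in> H \<Longrightarrow> plf g" "id \<in> H" "f \<in> H \<Longrightarrow> g \<in> H \<Longrightarrow> f \<circ> g \<in> H" "g \<in> H \<Longrightarrow> finv g \<in> H"
  using assms unfolding plgroup_def by blast+

lemma plgroup_funpow: "plgroup H \<Longrightarrow> g \<in> H \<Longrightarrow> g ^^ n \<in> H"
  by (induction n) (auto intro: plgroupD)

lemma has_chainI: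
  "orb g p q \<Longrightarrow> orb h r s \<Longrightarrow> g \<in> H \<Longrightarrow> h \<in> H \<Longrightarrow> p < r \<Longrightarrow> r < q \<Longrightarrow> q < s \<Longrightarrow> has_chain H"
  unfolding has_chain_def by blast

section \<open>Fixed points and orbitals of increasing bijections\<close>

context
  fixes g :: "real \<Rightarrow> real"
  assumes g: "strict_mono g" "surj g"
begin

lemma incr_bij: "bij g"
  using g by (simp add: bij_def strict_mono_imp_inj_on)

lemma incr_inv [simp]: "g (finv g x) = x" "finv g (g x) = x"
  using incr_bij by (simp_all add: bij_is_surj surj_f_inv_f bij_is_inj inv_f_f)

lemma incr_less [simp]: "g x < g y \<longleftrightarrow> x < y" and incr_le [simp]: "g x \<le> g y \<longleftrightarrow> x \<le> y"
  using g by (simp_all add: strict_mono_less strict_mono_less_eq)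

lemma incr_eq [simp]: "g x = g y \<longleftrightarrow> x = y"
  using g by (simp add: strict_mono_eq)

lemma incr_inv_less: "finv g x < finv g y \<longleftrightarrow> x < y"
  by (metis incr_inv(1) incr_less)

lemma incr_strict_mono_inv: "strict_mono (finv g)"
  by (simp add: strict_mono_def incr_inv_less)

lemma incr_surj_inv: "surj (finv g)"
  using incr_bij bij_imp_bij_inv bij_is_surj by blast

lemma incr_inv_inv: "finv (finv g) = g"
  using incr_bij by (rule inv_inv_eq)

lemma incr_inv_fix: "finv g x = x \<longleftrightarrow> g x = x"
  by (metis incr_inv)

lemma incr_continuous: "continuous_on UNIV g"
  using g by (intro continuous_onI_mono) (auto simp: strict_mono_less_eq)

lemma incr_cont_on: "continuous_on S g"
  using incr_continuous continuous_on_subset by blast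

lemma incr_ivt_fix:
  assumes "x \<le> y" "(x < g x \<and> g y < y) \<or> (g x < x \<and> y < g y)"
  obtains z where "x < z" "z < y" "g z = z"
proof -
  have "continuous_on {x..y} (\<lambda>t. g t - t)" "continuous_on {x..y} (\<lambda>t. t - g t)"
    by (intro continuous_intros incr_cont_on)+
  then obtain z where z: "x \<le> z" "z \<le> y" "g z = z"
    using assms IVT'[of "\<lambda>t. g t - t" x 0 y] IVT'[of "\<lambda>t. t - g t" x 0 y] by (smt (verit))
  moreover have "z \<noteq> x" "z \<noteq> y" using assms z(3) by auto
  ultimately show thesis using that[of z] by simp
qed

lemma incr_fix_closed: "closed {x. g x = x}"
  by (intro closed_Collect_eq incr_continuous continuous_intros)

lemma incr_orbital_at:
  assumes "g x \<noteq> x" "p \<le> x" "g p = p" "x \<le> q" "g q = q"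
  obtains a b where "orb g a b" "p \<le> a" "a < x" "x < b" "b \<le> q"
proof -
  let ?F = "{y. g y = y}"
  define a where "a = Sup (?F \<inter> {p..x})"
  define b where "b = Inf (?F \<inter> {x..q})"
  have cl: "closed (?F \<inter> {p..x})" "closed (?F \<inter> {x..q})"
    by (intro closed_Int incr_fix_closed closed_atLeastAtMost)+
  have a: "a \<in> ?F \<inter> {p..x}" unfolding a_def
    by (rule closed_contains_Sup[OF _ _ cl(1)]) (use assms in auto)
  have b: "b \<in> ?F \<inter> {x..q}" unfolding b_def
    by (rule closed_contains_Inf[OF _ _ cl(2)]) (use assms in auto)
  have ax: "a < x" and xb: "x < b" using a b assms(1) by (auto simp: order.order_iff_strict)
  have "g z \<noteq> z" if "a < z" "z < b" for z
  proof
    assume z: "g z = z"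
    show False
    proof (cases "z \<le> x")
      case True
      then have "z \<le> a" unfolding a_def by (intro cSup_upper) (use z that a in auto)
      with that show False by simp
    next
      case False
      then have "b \<le> z" unfolding b_def by (intro cInf_lower) (use z that b in auto)
      with that show False by simp
    qed
  qed
  then have "orb g a b" using a b ax xb unfolding orb_def by auto
  then show thesis using that a b ax xb by auto
qed

lemma incr_orb_cases:
  assumes "orb g a b"
  shows "(\<forall>x. a < x \<and> x < b \<longrightarrow> x < g x) \<or> (\<forall>x. a < x \<and> x < b \<longrightarrow> g x < x)"
proof (rule ccontr)
  assume "\<not> ?thesis"
  then obtain x y where xy: "a < x" "x < b" "a < y" "y < b" "g x < x" "y < g y"
    using assms unfolding orb_def by (meson linorder_neqE)
  from xy have "\<exists>z. a < z \<and> z < b \<and> g z = z"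
  proof (cases "x \<le> y")
    case True
    from incr_ivt_fix[OF this] xy show ?thesis by (metis less_trans)
  next
    case False
    then have "y \<le> x" by simp
    from incr_ivt_fix[OF this] xy show ?thesis by (metis less_trans)
  qed
  with assms show False unfolding orb_def by blast
qed

lemma incr_orb_maps:
  assumes "orb g a b" "a < x" "x < b"
  shows "a < g x" "g x < b"
  using assms unfolding orb_def by (metis incr_less)+

lemma incr_orb_inv: "orb g a b \<Longrightarrow> orb (finv g) a b"
  unfolding orb_def by (simp add: incr_inv_fix)

lemma incr_funpow: "strict_mono (g ^^ n)" "surj (g ^^ n)"
proof -
  show "strict_mono (g ^^ n)" by (induction n) (auto simp: strict_mono_def)
  show "surj (g ^^ n)" using incr_bij bij_fn bij_is_surj by blast
qed

lemma incr_orb_funpow_maps: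
  assumes "orb g a b" "a < x" "x < b"
  shows "a < (g ^^ n) x" "(g ^^ n) x < b"
  using assms incr_orb_maps[OF assms(1)] by (induction n) auto

text \<open>If the forward orbit were bounded by \<open>y\<close>, its supremum would be pushed past itself.\<close>

lemma incr_orb_push:
  assumes "orb g a b" "\<forall>x. a < x \<and> x < b \<longrightarrow> x < g x" "a < x" "x < b" "y < b"
  obtains n where "y < (g ^^ n) x"
proof -
  have "\<exists>n. y < (g ^^ n) x"
  proof (rule ccontr)
    assume "\<not> ?thesis"
    then have le: "(g ^^ n) x \<le> y" for n by (simp add: not_less)
    define L where "L = (SUP n. (g ^^ n) x)"
    have bdd: "bdd_above (range (\<lambda>n. (g ^^ n) x))" by (rule bdd_aboveI[of _ y]) (use le in auto)
    have up: "(g ^^ n) x \<le> L" for n unfolding L_def by (rule cSUP_upper[OF UNIV_I bdd])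
    have "L \<le> y" unfolding L_def by (rule cSUP_least) (use le in auto)
    moreover have "x \<le> L" using up[of 0] by simp
    ultimately have "L < g L" using assms by auto
    then have "finv g L < L" by (metis incr_inv(2) incr_inv_less)
    then obtain n where "finv g L < (g ^^ n) x"
      unfolding L_def using less_cSUP_iff[OF _ bdd] by auto
    then have "L < (g ^^ Suc n) x" by (metis incr_inv(1) incr_less funpow.simps(2) o_apply)
    with up[of "Suc n"] show False by simp
  qed
  then show thesis using that by blast
qed

end

lemma incr_orb_conj:
  assumes "strict_mono g" "surj g" "strict_mono h" "surj h" "orb g a b"
  shows "orb (h \<circ> g \<circ> finv h) (h a) (h b)"
  unfolding orb_def
proof (intro conjI allI impI)
  show "h a < h b" "(h \<circ> g \<circ> finv h) (h a) = h a" "(h \<circ> g \<circ> finv h) (h b) = h b"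
    using assms by (auto simp: orb_def incr_inv incr_less)
  fix x assume x: "h a < x \<and> x < h b"
  then have "a < finv h x" "finv h x < b" using assms(3,4) by (metis incr_inv(2) incr_inv_less)+
  then have "g (finv h x) \<noteq> finv h x" using assms(5) by (auto simp: orb_def)
  then show "(h \<circ> g \<circ> finv h) x \<noteq> x" using assms(3,4) by (metis comp_apply incr_inv(2))
qed

lemma incr_comp:
  "strict_mono f \<Longrightarrow> strict_mono g \<Longrightarrow> strict_mono (f \<circ> g)" "surj f \<Longrightarrow> surj g \<Longrightarrow> surj (f \<circ> g)"
  for f g :: "real \<Rightarrow> real"
  by (simp add: strict_mono_def) (rule comp_surj)

lemma incr_inv_comp:
  "strict_mono f \<Longrightarrow> surj f \<Longrightarrow> strict_mono g \<Longrightarrow> surj g \<Longrightarrow> finv (f \<circ> g) = finv g \<circ> finv f" for f g :: "real \<Rightarrow> real"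
  by (intro o_inv_distrib incr_bij)

section \<open>One-sided slopes\<close>

lemma germ_unique:
  assumes "germ \<sigma> g x m" "germ \<sigma> g x n" "\<sigma> \<noteq> 0" shows "m = n"
proof -
  obtain e where e: "e > 0" "\<forall>t. 0 \<le> t \<and> t \<le> e \<longrightarrow> g (x + \<sigma> * t) = g x + \<sigma> * (m * t)"
    using assms(1) unfolding germ_def by blast
  obtain e' where e': "e' > 0" "\<forall>t. 0 \<le> t \<and> t \<le> e' \<longrightarrow> g (x + \<sigma> * t) = g x + \<sigma> * (n * t)"
    using assms(2) unfolding germ_def by blast
  define t where "t = min e e'"
  have "0 < t" "t \<le> e" "t \<le> e'" using e(1) e'(1) by (auto simp: t_def)
  then have "g x + \<sigma> * (m * t) = g x + \<sigma> * (n * t)" using e(2) e'(2) by (metis less_imp_le)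
  then show ?thesis using \<open>0 < t\<close> assms(3) by simp
qed

lemma slope_eqI: "germ \<sigma> g x m \<Longrightarrow> \<sigma> \<noteq> 0 \<Longrightarrow> slope \<sigma> g x = m"
  unfolding slope_def using germ_unique by blast

lemma germ_pos:
  assumes "germ \<sigma> g x m" "strict_mono g" "\<sigma> = 1 \<or> \<sigma> = -1" shows "m > 0"
proof -
  obtain e where e: "e > 0" "\<forall>t. 0 \<le> t \<and> t \<le> e \<longrightarrow> g (x + \<sigma> * t) = g x + \<sigma> * (m * t)"
    using assms(1) unfolding germ_def by blast
  then have "g (x + \<sigma> * e) = g x + \<sigma> * (m * e)" by simp
  moreover have "g (x + \<sigma> * e) > g x \<longleftrightarrow> \<sigma> = 1" "g (x + \<sigma> * e) < g x \<longleftrightarrow> \<sigma> = -1"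
    using assms(2,3) e(1) by (auto simp: strict_mono_less)
  ultimately have "m * e > 0" using assms(3) by auto
  then show ?thesis using e(1) by (simp add: zero_less_mult_iff)
qed

lemma germ_id: "germ \<sigma> id x 1"
  unfolding germ_def by (auto intro!: exI[of _ 1])

lemma germ_comp:
  assumes "germ \<sigma> g x m" "germ \<sigma> f (g x) n" "m > 0"
  shows "germ \<sigma> (f \<circ> g) x (n * m)"
proof -
  obtain e where e: "e > 0" "\<forall>t. 0 \<le> t \<and> t \<le> e \<longrightarrow> g (x + \<sigma> * t) = g x + \<sigma> * (m * t)"
    using assms(1) unfolding germ_def by blast
  obtain e' where e': "e' > 0" "\<forall>t. 0 \<le> t \<and> t \<le> e' \<longrightarrow> f (g x + \<sigma> * t) = f (g x) + \<sigma> * (n * t)"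
    using assms(2) unfolding germ_def by blast
  show ?thesis unfolding germ_def
  proof (intro exI[of _ "min e (e' / m)"] conjI allI impI)
    show "min e (e' / m) > 0" using e e' assms(3) by simp
    fix t assume t: "0 \<le> t \<and> t \<le> min e (e' / m)"
    then have "m * t \<le> e'" "0 \<le> m * t" using assms(3) by (simp_all add: field_simps)
    then show "(f \<circ> g) (x + \<sigma> * t) = (f \<circ> g) x + \<sigma> * (n * m * t)" using e(2) e'(2) t by simp
  qed
qed

lemma germ_inv:
  assumes "germ \<sigma> g x m" "strict_mono g" "surj g" "m > 0"
  shows "germ \<sigma> (finv g) (g x) (1 / m)"
proof -
  obtain e where e: "e > 0" "\<forall>t. 0 \<le> t \<and> t \<le> e \<longrightarrow> g (x + \<sigma> * t) = g x + \<sigma> * (m * t)"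
    using assms(1) unfolding germ_def by blast
  show ?thesis unfolding germ_def
  proof (intro exI[of _ "e * m"] conjI allI impI)
    show "e * m > 0" using e assms by simp
    fix t assume "0 \<le> t \<and> t \<le> e * m"
    then have "0 \<le> t / m" "t / m \<le> e" using assms(4) by (simp_all add: field_simps)
    then have "g (x + \<sigma> * (t / m)) = g x + \<sigma> * t" using e(2)[rule_format, of "t / m"] assms(4) by simp
    then show "finv g (g x + \<sigma> * t) = finv g (g x) + \<sigma> * (1 / m * t)"
      using incr_inv(2)[OF assms(2,3)] by (metis mult.commute mult_1 times_divide_eq_right)
  qed
qed

lemma plfD:
  assumes "plf g"
  shows "strict_mono g" "surj g" "\<exists>p\<le>x. g p = p" "\<exists>q\<ge>x. g q = q"
    "\<sigma> = 1 \<or> \<sigma> = -1 \<Longrightarrow> \<exists>m. germ \<sigma> g x m"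
proof -
  show "\<exists>m. germ \<sigma> g x m" if "\<sigma> = 1 \<or> \<sigma> = -1"
    using that assms unfolding plf_def by (elim disjE) simp_all
qed (use assms in \<open>simp_all add: plf_def\<close>)

lemma germ_slope:
  assumes "plf g" "\<sigma> = 1 \<or> \<sigma> = -1"
  shows "germ \<sigma> g x (slope \<sigma> g x)" "slope \<sigma> g x > 0"
proof -
  obtain m where "germ \<sigma> g x m" using plfD(5)[OF assms] by blast
  moreover from this have "slope \<sigma> g x = m" using assms(2) by (intro slope_eqI) auto
  ultimately show *: "germ \<sigma> g x (slope \<sigma> g x)" by simp
  show "slope \<sigma> g x > 0" by (rule germ_pos[OF * plfD(1)[OF assms(1)] assms(2)])
qed

lemma slope_comp:
  assumes "plf f" "plf g" "\<sigma> = 1 \<or> \<sigma> = -1"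
  shows "slope \<sigma> (f \<circ> g) x = slope \<sigma> f (g x) * slope \<sigma> g x"
  by (rule slope_eqI[OF germ_comp[OF germ_slope(1)[OF assms(2,3)] germ_slope(1)[OF assms(1,3)] germ_slope(2)[OF assms(2,3)]]])
     (use assms(3) in auto)

lemma slope_inv:
  assumes "plf g" "\<sigma> = 1 \<or> \<sigma> = -1"
  shows "slope \<sigma> (finv g) (g x) = 1 / slope \<sigma> g x"
  by (rule slope_eqI[OF germ_inv[OF germ_slope(1)[OF assms] plfD(1,2)[OF assms(1)] germ_slope(2)[OF assms]]])
     (use assms(2) in auto)

lemma slope_id: "\<sigma> = 1 \<or> \<sigma> = -1 \<Longrightarrow> slope \<sigma> id x = 1"
  by (rule slope_eqI[OF germ_id]) auto

lemma slope_funpow: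
  assumes "plgroup H" "g \<in> H" "g x = x" "\<sigma> = 1 \<or> \<sigma> = -1"
  shows "slope \<sigma> (g ^^ n) x = slope \<sigma> g x ^ n" "(g ^^ n) x = x"
proof -
  show fx: "(g ^^ n) x = x" for n using assms(3) by (induction n) auto
  show "slope \<sigma> (g ^^ n) x = slope \<sigma> g x ^ n"
  proof (induction n)
    case 0 then show ?case using slope_id[OF assms(4)] by (simp add: id_def)
  next
    case (Suc n)
    then show ?case using slope_comp[of g "g ^^ n" \<sigma> x] assms plgroupD(1) plgroup_funpow fx
      by (metis funpow.simps(2) power_Suc)
  qed
qed

lemma germ_local:
  assumes "germ \<sigma> g x m"
  obtains e where "e > 0" "\<And>t. 0 \<le> t \<Longrightarrow> t \<le> e \<Longrightarrow> g (x + \<sigma> * t) = g x + \<sigma> * (m * t)"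
  using assms unfolding germ_def by blast

lemma germ_right:
  assumes "germ 1 g x m"
  obtains e where "e > 0" "\<And>y. x \<le> y \<Longrightarrow> y \<le> x + e \<Longrightarrow> g y = g x + m * (y - x)"
proof -
  obtain e where e: "e > 0" "\<And>t. 0 \<le> t \<Longrightarrow> t \<le> e \<Longrightarrow> g (x + 1 * t) = g x + 1 * (m * t)"
    by (rule germ_local[OF assms]) blast
  show thesis
  proof (rule that[OF e(1)])
    fix y assume "x \<le> y" "y \<le> x + e"
    then show "g y = g x + m * (y - x)" using e(2)[of "y - x"] by simp
  qed
qed

lemma germ_left:
  assumes "germ (-1) g x m"
  obtains e where "e > 0" "\<And>y. x - e \<le> y \<Longrightarrow> y \<le> x \<Longrightarrow> g y = g x + m * (y - x)"
proof -
  obtain e where e: "e > 0" "\<And>t. 0 \<le> t \<Longrightarrow> t \<le> e \<Longrightarrow> g (x + -1 * t) = g x + -1 * (m * t)"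
    by (rule germ_local[OF assms]) blast
  show thesis
  proof (rule that[OF e(1)])
    fix y assume "x - e \<le> y" "y \<le> x"
    then have "g y = g x - m * (x - y)" using e(2)[of "x - y"] by simp
    then show "g y = g x + m * (y - x)" by (simp add: algebra_simps)
  qed
qed

lemma plf_affine_right:
  assumes "plf g"
  obtains e where "e > 0" "\<And>y. x \<le> y \<Longrightarrow> y \<le> x + e \<Longrightarrow> g y = g x + slope 1 g x * (y - x)"
proof -
  have "germ 1 g x (slope 1 g x)" by (rule germ_slope(1)[OF assms]) simp
  then show thesis by (rule germ_right) (rule that)
qed

lemma plf_affine_left:
  assumes "plf g"
  obtains e where "e > 0" "\<And>y. x - e \<le> y \<Longrightarrow> y \<le> x \<Longrightarrow> g y = g x + slope (-1) g x * (y - x)"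
proof -
  have "germ (-1) g x (slope (-1) g x)" by (rule germ_slope(1)[OF assms]) simp
  then show thesis by (rule germ_left) (rule that)
qed

text \<open>Germs are exactly affine, so slope one at a fixed point means the identity on a
  one-sided neighbourhood, and no orbital can begin there.\<close>

lemma orb_slope_left:
  assumes "plf g" "orb g a b" shows "slope 1 g a \<noteq> 1"
proof
  assume "slope 1 g a = 1"
  then have "germ 1 g a 1" using germ_slope(1)[OF assms(1), of 1 a] by simp
  then obtain e where e: "e > 0" "\<And>y. a \<le> y \<Longrightarrow> y \<le> a + e \<Longrightarrow> g y = g a + 1 * (y - a)"
    by (rule germ_right) blast
  define y where "y = min (a + e) ((a + b) / 2)"
  have "a < y" "y < b" "y \<le> a + e" using assms(2) e(1) by (auto simp: y_def orb_def min_def)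
  then show False using e(2)[of y] assms(2) unfolding orb_def by auto
qed

lemma orb_slope_right:
  assumes "plf g" "orb g a b" shows "slope (-1) g b \<noteq> 1"
proof
  assume "slope (-1) g b = 1"
  then have "germ (-1) g b 1" using germ_slope(1)[OF assms(1), of "-1" b] by simp
  then obtain e where e: "e > 0" "\<And>y. b - e \<le> y \<Longrightarrow> y \<le> b \<Longrightarrow> g y = g b + 1 * (y - b)"
    by (rule germ_left) blast
  define y where "y = max (b - e) ((a + b) / 2)"
  have "a < y" "y < b" "b - e \<le> y" using assms(2) e(1) by (auto simp: y_def orb_def max_def)
  then show False using e(2)[of y] assms(2) unfolding orb_def by auto
qed

lemma slope_gt_1_if_moves_right:
  assumes "plf g" "orb g a b" "\<forall>x. a < x \<and> x < b \<longrightarrow> x < g x" shows "slope 1 g a > 1"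
proof -
  obtain e where e: "e > 0" "\<And>y. a \<le> y \<Longrightarrow> y \<le> a + e \<Longrightarrow> g y = g a + slope 1 g a * (y - a)"
    by (rule plf_affine_right[OF assms(1)]) blast
  define y where "y = min (a + e) ((a + b) / 2)"
  have "a < y" "y < b" "y \<le> a + e" using assms(2) e(1) by (auto simp: y_def orb_def min_def)
  then have "y < g y" "g y = a + slope 1 g a * (y - a)"
    using e(2)[of y] assms(3)[rule_format, of y] assms(2) unfolding orb_def by (blast, simp)
  then have "0 < (slope 1 g a - 1) * (y - a)" by (simp add: algebra_simps)
  then show ?thesis using \<open>a < y\<close> by (simp add: zero_less_mult_iff)
qed

lemma slope_lt_1_if_moves_left:
  assumes "plf g" "orb g a b" "\<forall>x. a < x \<and> x < b \<longrightarrow> g x < x" shows "slope 1 g a < 1"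
proof -
  obtain e where e: "e > 0" "\<And>y. a \<le> y \<Longrightarrow> y \<le> a + e \<Longrightarrow> g y = g a + slope 1 g a * (y - a)"
    by (rule plf_affine_right[OF assms(1)]) blast
  define y where "y = min (a + e) ((a + b) / 2)"
  have "a < y" "y < b" "y \<le> a + e" using assms(2) e(1) by (auto simp: y_def orb_def min_def)
  then have "g y < y" "g y = a + slope 1 g a * (y - a)"
    using e(2)[of y] assms(3)[rule_format, of y] assms(2) unfolding orb_def by (blast, simp)
  then have "0 < (1 - slope 1 g a) * (y - a)" by (simp add: algebra_simps)
  then show ?thesis using \<open>a < y\<close> by (simp add: zero_less_mult_iff)
qed

lemma orb_at:
  assumes "plf g" "g x \<noteq> x"
  obtains a b where "orb g a b" "a < x" "x < b"
proof -
  obtain p q where "p \<le> x" "g p = p" "x \<le> q" "g q = q" using plfD(3,4)[OF assms(1)] by blast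
  then show thesis using incr_orbital_at[OF plfD(1,2)[OF assms(1)] assms(2)] that by metis
qed

text \<open>An affine germ with slope different from one has no further fixed point nearby, so the
  orbital around a point just right of \<open>a\<close> must begin at \<open>a\<close>.\<close>

lemma orb_starting_at:
  assumes "plf g" "g a = a" "slope 1 g a \<noteq> 1"
  obtains b where "orb g a b"
proof -
  obtain e where e: "e > 0" "\<And>y. a \<le> y \<Longrightarrow> y \<le> a + e \<Longrightarrow> g y = g a + slope 1 g a * (y - a)"
    by (rule plf_affine_right[OF assms(1)]) blast
  have nf: "g y \<noteq> y" if "a < y" "y \<le> a + e" for y
  proof
    assume "g y = y"
    then have "(slope 1 g a - 1) * (y - a) = 0" using e(2)[of y] that assms(2) by (simp add: algebra_simps)
    then show False using assms(3) that by simp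
  qed
  obtain c b where cb: "orb g c b" "c < a + e" "a + e < b" using orb_at[OF assms(1) nf[of "a + e"]] e(1) by auto
  have "c = a"
  proof (rule ccontr)
    assume "c \<noteq> a"
    then consider "c < a" | "a < c" by linarith
    then show False using nf[of c] cb assms(2) e(1) by cases (auto simp: orb_def)
  qed
  then show thesis using cb(1) that by blast
qed

lemma orb_ending_at:
  assumes "plf g" "g b = b" "slope (-1) g b \<noteq> 1"
  obtains a where "orb g a b"
proof -
  obtain e where e: "e > 0" "\<And>y. b - e \<le> y \<Longrightarrow> y \<le> b \<Longrightarrow> g y = g b + slope (-1) g b * (y - b)"
    by (rule plf_affine_left[OF assms(1)]) blast
  have nf: "g y \<noteq> y" if "b - e \<le> y" "y < b" for y
  proof
    assume "g y = y"
    then have "(slope (-1) g b - 1) * (y - b) = 0" using e(2)[of y] that assms(2) by (simp add: algebra_simps)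
    then show False using assms(3) that by simp
  qed
  obtain a c where cb: "orb g a c" "a < b - e" "b - e < c" using orb_at[OF assms(1) nf[of "b - e"]] e(1) by auto
  have "c = b"
  proof (rule ccontr)
    assume "c \<noteq> b"
    then consider "b < c" | "c < b" by linarith
    then show False using nf[of c] cb assms(2) e(1) by cases (auto simp: orb_def)
  qed
  then show thesis using cb(1) that by blast
qed


section \<open>Groups without transition chains\<close>

context
  fixes H assumes H: "plgroup H"
begin

lemma H_mem [intro]: "id \<in> H" "f \<in> H \<Longrightarrow> g \<in> H \<Longrightarrow> f \<circ> g \<in> H" "g \<in> H \<Longrightarrow> finv g \<in> H" "g \<in> H \<Longrightarrow> g ^^ n \<in> H"
  using plgroupD[OF H] plgroup_funpow[OF H] by blast+

lemma H_incr: "g \<in> H \<Longrightarrow> strict_mono g" "g \<in> H \<Longrightarrow> surj g" "g \<in> H \<Longrightarrow> plf g"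
  using plgroupD(1)[OF H] plfD by blast+

lemma orb_conj:
  assumes "g \<in> H" "h \<in> H" "orb g a b"
  shows "orb (h \<circ> g \<circ> finv h) (h a) (h b)" "h \<circ> g \<circ> finv h \<in> H"
  using incr_orb_conj H_incr assms by (blast, blast)

lemma orb_oriented:
  assumes "g \<in> H" "orb g a b"
  obtains g' where "g' \<in> H" "orb g' a b" "\<forall>x. a < x \<and> x < b \<longrightarrow> x < g' x"
proof -
  note g = H_incr(1,2)[OF assms(1)]
  consider "\<forall>x. a < x \<and> x < b \<longrightarrow> x < g x" | "\<forall>x. a < x \<and> x < b \<longrightarrow> g x < x"
    using incr_orb_cases[OF g assms(2)] by blast
  then show thesis
  proof cases
    case 1 then show ?thesis using that assms by blast
  next
    case 2
    have "x < finv g x" if "a < x \<and> x < b" for x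
      using 2 that by (metis g incr_inv(1) incr_inv_less incr_inv(2))
    then show ?thesis using that[of "finv g"] incr_orb_inv[OF g assms(2)] assms(1) by blast
  qed
qed

text \<open>Suppose \<open>b < c\<close>. Let \<open>g\<close> move points to the right and
  \<open>h\<close> to the left. At \<open>a\<close> a high power of \<open>g\<close> outweighs
  \<open>h\<close>, so \<open>w = g^m h\<close> pushes points near \<open>a\<close> to the right,
  while it moves \<open>b\<close> to the left. Hence \<open>w\<close> fixes a point of
  \<open>(a, b)\<close>, and its orbital around \<open>b\<close> begins at or after that point;
  together with \<open>(a, b)\<close> it is a chain.\<close>

lemma orb_share_left:
  assumes nc: "\<not> has_chain H" and g: "g \<in> H" "orb g a b" and h: "h \<in> H" "orb h a c"
  shows "c \<le> b"
proof (rule ccontr)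
  assume "\<not> c \<le> b" then have bc: "b < c" by simp
  obtain g where g: "g \<in> H" "orb g a b" "\<forall>x. a < x \<and> x < b \<longrightarrow> x < g x" using orb_oriented[OF g] by blast
  obtain h' where h': "h' \<in> H" "orb h' a c" "\<forall>x. a < x \<and> x < c \<longrightarrow> x < h' x" using orb_oriented[OF h] by blast
  define h where "h = finv h'"
  have h: "h \<in> H" "orb h a c" using h' incr_orb_inv H_incr by (auto simp: h_def)
  have hl: "h x < x" if "a < x \<and> x < c" for x
    unfolding h_def using h'(3) that by (metis H_incr(1,2) h'(1) incr_inv(2) incr_inv_less)
  have ab: "a < b" "g a = a" "g b = b" "h a = a" using g h by (auto simp: orb_def)
  define \<mu> where "\<mu> = slope 1 g a"
  have mu: "\<mu> > 1" unfolding \<mu>_def by (rule slope_gt_1_if_moves_right[OF H_incr(3)[OF g(1)] g(2,3)])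
  define \<kappa> where "\<kappa> = slope 1 h a"
  have lam: "\<kappa> > 0" unfolding \<kappa>_def by (rule germ_slope(2)) (use H_incr h in auto)
  obtain m where m: "1 / \<kappa> < \<mu> ^ m" using real_arch_pow[OF mu] by blast
  define w where "w = (g ^^ m) \<circ> h"
  have w: "w \<in> H" unfolding w_def using g h by blast
  have wi: "strict_mono w" "surj w" using H_incr[OF w] by auto
  have "slope 1 w a = \<mu> ^ m * \<kappa>"
    unfolding w_def \<mu>_def \<kappa>_def using slope_comp[of "g ^^ m" h 1 a] slope_funpow(1)[OF H g(1) ab(2), of 1 m] ab(4)
      H_incr(3)[OF h(1)] H_incr(3)[OF H_mem(4)[OF g(1)]] by simp
  then have sw: "slope 1 w a > 1" using m lam by (simp add: field_simps)
  obtain e where e: "e > 0" "\<And>y. a \<le> y \<Longrightarrow> y \<le> a + e \<Longrightarrow> w y = w a + slope 1 w a * (y - a)"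
    by (rule plf_affine_right[OF H_incr(3)[OF w]]) blast
  have wa: "w a = a" unfolding w_def using ab slope_funpow(2)[OF H g(1) ab(2), of 1] by simp
  define y where "y = min (a + e) ((a + b) / 2)"
  have y: "a < y" "y < b" "y \<le> a + e" using ab(1) e(1) by (auto simp: y_def min_def)
  have "y < w y" 
  proof -
    have "y - a < slope 1 w a * (y - a)" using mult_strict_right_mono[OF sw, of "y - a"] y by simp
    moreover have "w y = w a + slope 1 w a * (y - a)" using e(2)[of y] y by simp
    ultimately show ?thesis using wa by linarith
  qed
  moreover have "w b < b"
  proof -
    have "a < h b" using ab h(2) bc incr_orb_maps[OF H_incr(1,2)[OF h(1)] h(2)] by simp
    moreover have "h b < b" using hl ab bc by simp
    ultimately show ?thesis unfolding w_def using incr_orb_funpow_maps(2)[OF H_incr(1,2)[OF g(1)] g(2)] by simp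
  qed
  ultimately obtain z where z: "y < z" "z < b" "w z = z" using incr_ivt_fix[OF wi, of y b] y by auto
  obtain u v where uv: "orb w u v" "u < b" "b < v" using orb_at[OF H_incr(3)[OF w], of b] \<open>w b < b\<close> by auto
  have "z \<le> u" using uv z by (metis orb_def not_le less_trans)
  then have "a < u" using y z by simp
  then show False using has_chainI[OF g(2) uv(1) g(1) w] uv nc by blast
qed

end

text \<open>Conjugation by the reflection at 0. It turns facts about left ends of orbitals into
  facts about right ends.\<close>

definition mirror :: "(real \<Rightarrow> real) \<Rightarrow> real \<Rightarrow> real" where
  "mirror g = (\<lambda>x. - g (- x))"

lemma mirror_orb: "orb (mirror g) a b \<longleftrightarrow> orb g (- b) (- a)"
proof -
  have "(\<forall>x. a < x \<and> x < b \<longrightarrow> g (- x) \<noteq> - x) \<longleftrightarrow> (\<forall>x. - b < x \<and> x < - a \<longrightarrow> g x \<noteq> x)"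
    by (metis minus_less_iff minus_minus)
  then show ?thesis unfolding orb_def mirror_def by (auto simp: minus_equation_iff[of "g _"] eq_commute)
qed

lemma mirror_comp: "mirror (f \<circ> g) = mirror f \<circ> mirror g"
  by (auto simp: mirror_def)

lemma mirror_incr: "strict_mono g \<Longrightarrow> strict_mono (mirror g)" "surj g \<Longrightarrow> surj (mirror g)"
  unfolding mirror_def strict_mono_def surj_def by (auto, metis minus_minus)

lemma mirror_inv:
  assumes "strict_mono g" "surj g" shows "finv (mirror g) = mirror (finv g)"
  by (rule inv_equality) (use assms in \<open>simp_all add: mirror_def incr_inv\<close>)

lemma mirror_germ: "germ \<sigma> (mirror g) x m \<longleftrightarrow> germ (- \<sigma>) g (- x) m"
  unfolding germ_def mirror_def by (auto simp: algebra_simps minus_equation_iff[of "g _"])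

lemma mirror_plf: assumes "plf g" shows "plf (mirror g)"
proof -
  have "\<exists>p\<le>x. mirror g p = p" for x
    using plfD(4)[OF assms, of "- x"] by (metis minus_le_iff minus_minus mirror_def)
  moreover have "\<exists>q\<ge>x. mirror g q = q" for x
    using plfD(3)[OF assms, of "- x"] by (metis le_minus_iff minus_minus mirror_def)
  ultimately show ?thesis
    using assms unfolding plf_def mirror_germ by (simp add: mirror_incr)
qed

lemma mirror_plgroup: assumes "plgroup H" shows "plgroup (mirror ` H)"
  unfolding plgroup_def
proof (intro conjI ballI)
  show "id \<in> mirror ` H"
    using plgroupD(2)[OF assms] by (intro image_eqI[of _ _ id]) (auto simp: mirror_def)
  fix f assume "f \<in> mirror ` H"
  then obtain f' where f': "f = mirror f'" "f' \<in> H" by blast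
  then show "plf f" "finv f \<in> mirror ` H"
    using plgroupD[OF assms] mirror_plf plfD mirror_inv by auto
  fix g assume "g \<in> mirror ` H"
  then obtain g' where "g = mirror g'" "g' \<in> H" by blast
  then show "f \<circ> g \<in> mirror ` H"
    using f' plgroupD(3)[OF assms f'(2), of g'] mirror_comp[of f' g'] image_eqI[of "f \<circ> g" mirror "f' \<circ> g'" H] by auto
qed

lemma mirror_has_chain: assumes "has_chain (mirror ` H)" shows "has_chain H"
proof -
  obtain g h p q r s where "g \<in> H" "h \<in> H" "orb (mirror g) p q" "orb (mirror h) r s" "p < r" "r < q" "q < s"
    using assms unfolding has_chain_def by blast
  then show ?thesis
    by (intro has_chainI[of h "- s" "- r" g "- q" "- p"]) (auto simp: mirror_orb)
qed

section \<open>Nesting of orbitals without chains\<close>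

context
  fixes H assumes H: "plgroup H" and nc: "\<not> has_chain H"
begin

lemma orb_eq_left:
  assumes "g \<in> H" "orb g a b" "h \<in> H" "orb h a c" shows "b = c"
  using orb_share_left[OF H nc assms] orb_share_left[OF H nc assms(3,4,1,2)] by simp

lemma orb_eq_right:
  assumes "g \<in> H" "orb g a c" "h \<in> H" "orb h b c" shows "a = b"
proof -
  have *: "\<not> has_chain (mirror ` H)" using nc mirror_has_chain by blast
  have "orb (mirror g) (- c) (- a)" "orb (mirror h) (- c) (- b)" using assms by (simp_all add: mirror_orb)
  then show ?thesis
    using orb_share_left[OF mirror_plgroup[OF H] *, of "mirror g" "- c" "- a" "mirror h" "- b"]
          orb_share_left[OF mirror_plgroup[OF H] *, of "mirror h" "- c" "- b" "mirror g" "- a"] assms(1,3) by auto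
qed

lemma orb_laminar:
  assumes g: "g \<in> H" "orb g a b" and h: "h \<in> H" "orb h c d"
  shows "b \<le> c \<or> d \<le> a \<or> (a = c \<and> b = d) \<or> (a < c \<and> d < b) \<or> (c < a \<and> b < d)"
proof -
  have "\<not> (a < c \<and> c < b \<and> b < d)" "\<not> (c < a \<and> a < d \<and> d < b)"
    using has_chainI[OF g(2) h(2) g(1) h(1)] has_chainI[OF h(2) g(2) h(1) g(1)] nc by blast+
  moreover have "a = c \<Longrightarrow> b = d" using orb_eq_left g h by blast
  moreover have "b = d \<Longrightarrow> a = c" using orb_eq_right g h by blast
  ultimately show ?thesis by linarith
qed

text \<open>Compactness and nesting: consecutive members of a cover by orbitals overlap, so one
  contains the other. Carried out with the supremum \<open>z\<close> of the points reachable from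
  \<open>s\<close> by one orbital.\<close>

lemma orb_cover:
  assumes "s \<le> t" "\<And>x. s \<le> x \<Longrightarrow> x \<le> t \<Longrightarrow> \<exists>g\<in>H. \<exists>a b. orb g a b \<and> a < x \<and> x < b"
  obtains g a b where "g \<in> H" "orb g a b" "a < s" "t < b"
proof -
  define T where "T = {y. s \<le> y \<and> y \<le> t \<and> (\<exists>g\<in>H. \<exists>a b. orb g a b \<and> a < s \<and> y < b)}"
  have "s \<in> T" unfolding T_def using assms by auto
  have bdd: "bdd_above T" unfolding T_def by (auto intro: bdd_aboveI[of _ t])
  define z where "z = Sup T"
  have "s \<le> z" unfolding z_def by (rule cSup_upper[OF \<open>s \<in> T\<close> bdd])
  moreover have "z \<le> t" unfolding z_def by (rule cSup_least) (use \<open>s \<in> T\<close> in \<open>auto simp: T_def\<close>)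
  ultimately have z: "s \<le> z" "z \<le> t" by auto
  obtain h c d where h: "h \<in> H" "orb h c d" "c < z" "z < d" using assms(2)[OF z] by blast
  obtain y where y: "y \<in> T" "c < y" "y \<le> z"
    using h(3) less_cSup_iff[of T c] \<open>s \<in> T\<close> bdd cSup_upper[OF _ bdd] unfolding z_def by auto
  then obtain g a b where g: "g \<in> H" "orb g a b" "a < s" "y < b" unfolding T_def by blast
  have "\<exists>g\<in>H. \<exists>a b. orb g a b \<and> a < s \<and> z < b"
  proof (cases "z < b")
    case True then show ?thesis using g by blast
  next
    case False
    then have "c < a \<or> c = a"
      using orb_laminar[OF g(1,2) h(1,2)] g(3,4) h(3,4) y(2,3) z by linarith
    then show ?thesis using h g(3) by fastforce
  qed
  then obtain g a b where g: "g \<in> H" "orb g a b" "a < s" "z < b" by blast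
  have "z = t"
  proof (rule ccontr)
    assume "z \<noteq> t" then have "z < t" using z by simp
    define u where "u = min t ((z + b) / 2)"
    have "z < u" "u \<le> t" "u < b" using \<open>z < t\<close> g(4) by (auto simp: u_def min_def)
    then have "u \<in> T" unfolding T_def using g z by auto
    then show False using cSup_upper[OF _ bdd, of u] \<open>z < u\<close> unfolding z_def by simp
  qed
  then show thesis using g that by blast
qed

text \<open>An element cannot expand an orbital: it would have a fixed point inside and an orbital
  crossing the right end.\<close>

lemma orb_not_expanded:
  assumes g: "g \<in> H" "orb g a b" and h: "h \<in> H" "h a < a" "b < h b"
  shows False
proof -
  have "a \<le> b" using g by (simp add: orb_def)
  then obtain z where z: "a < z" "z < b" "h z = z" using incr_ivt_fix[OF H_incr(1,2)[OF H h(1)], of a b] h by auto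
  obtain u v where uv: "orb h u v" "u < b" "b < v" using orb_at[OF H_incr(3)[OF H h(1)], of b] h by auto
  have "z \<le> u" using uv z by (metis orb_def not_le less_trans)
  then show False using has_chainI[OF g(2) uv(1) g(1) h(1)] uv z nc by auto
qed

end


section \<open>The group of piecewise linear homeomorphisms\<close>

definition affine_off :: "real set \<Rightarrow> (real \<Rightarrow> real) \<Rightarrow> bool" where
  "affine_off B g \<longleftrightarrow> (\<forall>a b. 0 \<le> a \<and> a < b \<and> b \<le> 1 \<and> {a<..<b} \<inter> B = {} \<longrightarrow>
           (\<exists>m c. \<forall>x\<in>{a..b}. g x = m * x + c))"

text \<open>The identity outside \<open>[0,1]\<close> extends a homeomorphism of the interval to an
  increasing bijection of the line, so order arguments need no restriction to a domain.\<close>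

lemma PL_plus_iff:
  "g \<in> PL_plus \<longleftrightarrow> (\<forall>x. x \<notin> {0..1} \<longrightarrow> g x = x) \<and> strict_mono g \<and> surj g \<and>
     (\<exists>B. finite B \<and> affine_off B g)" (is "?L \<longleftrightarrow> ?R")
proof
  assume ?L
  then have id: "\<And>x. x \<notin> {0..1} \<Longrightarrow> g x = x" and sm: "strict_mono_on {0..1} g"
    and B: "\<exists>B. finite B \<and> affine_off B g" and "\<exists>h. homeomorphism {0..1} {0..1} g h"
    unfolding PL_plus_def affine_off_def by auto
  then have im: "g ` {0..1} = {0..1}" unfolding homeomorphism_def by blast
  have in01: "g x \<in> {0..1} \<longleftrightarrow> x \<in> {0..1}" for x
    using im id[of x] by (cases "x \<in> {0..1}") auto
  have mono: "g x < g y" if "x < y" for x y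
  proof (cases "x \<in> {0..1}")
    case x: True
    show ?thesis
    proof (cases "y \<in> {0..1}")
      case True then show ?thesis using sm x that by (auto simp: strict_mono_on_def)
    next
      case False then show ?thesis using x that in01[of x] id[of y] by auto
    qed
  next
    case x: False
    show ?thesis
    proof (cases "y \<in> {0..1}")
      case True then show ?thesis using x that in01[of y] id[of x] by auto
    next
      case False then show ?thesis using x that id by auto
    qed
  qed
  have "y \<in> range g" for y
  proof (cases "y \<in> {0..1}")
    case True
    then have "y \<in> g ` {0..1}" using im by simp
    then show ?thesis by blast
  next
    case False then show ?thesis using id[of y] by (metis rangeI)
  qed
  then have "surj g" by blast
  then show ?R using id mono B by (auto simp: strict_mono_def)
next
  assume R: ?R
  then have g: "strict_mono g" "surj g" and id: "\<And>x. x \<notin> {0..1} \<Longrightarrow> g x = x" by auto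
  have im: "g ` {0..1} = {0..1}"
  proof -
    have in01: "g x \<in> {0..1} \<longleftrightarrow> x \<in> {0..1}" for x
    proof (cases "x \<in> {0..1}")
      case False then show ?thesis using id by metis
    next
      case True
      have "g x \<in> {0..1}"
      proof (rule ccontr)
        assume "g x \<notin> {0..1}"
        then have "g (g x) = g x" using id by blast
        then have "g x = x" using incr_eq[OF g] by blast
        with True \<open>g x \<notin> {0..1}\<close> show False by simp
      qed
      with True show ?thesis by simp
    qed
    show ?thesis
    proof (intro subset_antisym subsetI)
      fix y :: real assume "y \<in> g ` {0..1}" then show "y \<in> {0..1}" using in01 by blast
    next
      fix y :: real assume "y \<in> {0..1}"
      then show "y \<in> g ` {0..1}" using in01[of "finv g y"] incr_inv(1)[OF g, of y] by (metis imageI)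
    qed
  qed
  have "homeomorphism {0..1} {0..1} g (finv g)"
    unfolding homeomorphism_def
  proof (intro conjI ballI)
    show "continuous_on {0..1} g" by (rule incr_cont_on[OF g])
    show "continuous_on {0..1} (finv g)"
      by (rule incr_cont_on[OF incr_strict_mono_inv[OF g] incr_surj_inv[OF g]])
    show "g ` {0..1} = {0..1}" by (rule im)
    show "finv g ` {0..1} = {0..1}" using im image_inv_f_f[OF bij_is_inj[OF incr_bij[OF g]], of "{0..1}"] by simp
  qed (simp_all add: incr_inv[OF g])
  then have "\<exists>h. homeomorphism {0..1} {0..1} g h" by blast
  moreover have "strict_mono_on {0..1} g" using g by (auto simp: strict_mono_on_def strict_mono_def)
  ultimately show ?L using R unfolding PL_plus_def affine_off_def by blast
qed

lemma PL_plusD: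
  assumes "g \<in> PL_plus"
  shows "strict_mono g" "surj g" "x \<notin> {0..1} \<Longrightarrow> g x = x" "\<exists>B. finite B \<and> affine_off B g"
  using assms unfolding PL_plus_iff by blast+

lemma PL_plus_0_1:
  assumes "g \<in> PL_plus" shows "g 0 = 0" "g 1 = 1"
proof -
  note g = PL_plusD[OF assms]
  have "g x = x" if x: "x = 0 \<or> x = 1" for x
  proof (rule ccontr)
    assume "g x \<noteq> x"
    have fx: "g (-1) = -1" "g 2 = 2" using g(3)[of "-1"] g(3)[of 2] by auto
    obtain a b where o: "orb g a b" "a < x" "x < b"
      by (rule incr_orbital_at[OF g(1,2) \<open>g x \<noteq> x\<close> _ fx(1) _ fx(2)]) (use x in auto)
    \<comment> \<open>Of the two midpoints, one on each side of \<open>x\<close>, one lies outside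
      \<open>[0,1]\<close>, where nothing moves.\<close>
    then have "g ((a + x) / 2) \<noteq> (a + x) / 2" "g ((b + x) / 2) \<noteq> (b + x) / 2"
      using orbD(4)[OF o(1), of "(a + x) / 2"] orbD(4)[OF o(1), of "(b + x) / 2"] by simp_all
    then have "(a + x) / 2 \<in> {0..1}" "(b + x) / 2 \<in> {0..1}" using g(3) by blast+
    then show False using that \<open>a < x\<close> \<open>x < b\<close> by auto
  qed
  then show "g 0 = 0" "g 1 = 1" by auto
qed

lemma affine_offD:
  assumes "affine_off B g" "0 \<le> a" "a < b" "b \<le> 1" "{a<..<b} \<inter> B = {}"
  obtains m c where "\<And>x. a \<le> x \<Longrightarrow> x \<le> b \<Longrightarrow> g x = m * x + c"
  using assms unfolding affine_off_def by (metis atLeastAtMost_iff)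

lemma PL_plus_id: "id \<in> PL_plus"
proof -
  have "affine_off {} id" unfolding affine_off_def by (intro allI impI exI[of _ 1] exI[of _ 0]) simp
  then show ?thesis unfolding PL_plus_iff by (auto simp: strict_mono_def intro!: exI[of _ "{}"])
qed

lemma PL_plus_maps_unit:
  assumes "g \<in> PL_plus" "0 \<le> x" "x \<le> 1" shows "0 \<le> g x" "g x \<le> 1"
  using PL_plus_0_1[OF assms(1)] incr_le[OF PL_plusD(1,2)[OF assms(1)]] assms(2,3) by metis+

lemma PL_plus_comp:
  assumes "f \<in> PL_plus" "g \<in> PL_plus" shows "f \<circ> g \<in> PL_plus"
proof -
  note f = PL_plusD[OF assms(1)] and g = PL_plusD[OF assms(2)]
  obtain A B where A: "finite A" "affine_off A f" and B: "finite B" "affine_off B g" using f(4) g(4) by blast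
  have "affine_off (B \<union> finv g ` A) (f \<circ> g)"
    unfolding affine_off_def
  proof (intro allI impI)
    fix a b :: real assume ab: "0 \<le> a \<and> a < b \<and> b \<le> 1 \<and> {a<..<b} \<inter> (B \<union> finv g ` A) = {}"
    obtain m c where mc: "\<And>x. a \<le> x \<Longrightarrow> x \<le> b \<Longrightarrow> g x = m * x + c"
      by (rule affine_offD[OF B(2), of a b]) (use ab in auto)
    have "{g a<..<g b} \<inter> A = {}"
    proof (rule ccontr)
      assume "{g a<..<g b} \<inter> A \<noteq> {}"
      then obtain y where y: "y \<in> A" "g a < y" "y < g b" by auto
      then have "a < finv g y" "finv g y < b" using incr_less[OF g(1,2)] incr_inv(1)[OF g(1,2)] by metis+
      then show False using ab y(1) by auto
    qed
    then obtain n d where nd: "\<And>x. g a \<le> x \<Longrightarrow> x \<le> g b \<Longrightarrow> f x = n * x + d"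
      using affine_offD[OF A(2), of "g a" "g b"] ab PL_plus_maps_unit[OF assms(2)] incr_less[OF g(1,2)] by (metis less_imp_le order.trans)
    have "(f \<circ> g) x = n * m * x + (n * c + d)" if "x \<in> {a..b}" for x
      using mc[of x] nd[of "g x"] that incr_le[OF g(1,2)] by (simp add: algebra_simps)
    then show "\<exists>m c. \<forall>x\<in>{a..b}. (f \<circ> g) x = m * x + c" by blast
  qed
  moreover have "finite (B \<union> finv g ` A)" using A B by simp
  ultimately show ?thesis
    unfolding PL_plus_iff using incr_comp f g by auto
qed

lemma PL_plus_inv:
  assumes "g \<in> PL_plus" shows "finv g \<in> PL_plus"
proof -
  note g = PL_plusD[OF assms]
  obtain B where B: "finite B" "affine_off B g" using g(4) by blast
  have "affine_off (g ` B) (finv g)"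
    unfolding affine_off_def
  proof (intro allI impI)
    fix a b :: real assume ab: "0 \<le> a \<and> a < b \<and> b \<le> 1 \<and> {a<..<b} \<inter> g ` B = {}"
    define a' where "a' = finv g a"
    define b' where "b' = finv g b"
    have gab: "g a' = a" "g b' = b" unfolding a'_def b'_def by (simp_all add: incr_inv[OF g(1,2)])
    have ab': "0 \<le> a'" "a' < b'" "b' \<le> 1"
      using ab gab PL_plus_0_1[OF assms] incr_le[OF g(1,2)] incr_less[OF g(1,2)] by metis+
    have "{a'<..<b'} \<inter> B = {}"
    proof (rule ccontr)
      assume "{a'<..<b'} \<inter> B \<noteq> {}"
      then obtain y where y: "y \<in> B" "a' < y" "y < b'" by auto
      then have "a < g y" "g y < b" using incr_less[OF g(1,2)] gab by metis+
      then show False using ab y(1) by auto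
    qed
    then obtain m c where mc: "\<And>x. a' \<le> x \<Longrightarrow> x \<le> b' \<Longrightarrow> g x = m * x + c"
      using affine_offD[OF B(2) ab'(1,2,3)] by metis
    have "m \<noteq> 0" using mc[of a'] mc[of b'] gab ab ab' by auto
    have "finv g y = 1 / m * y + (- c / m)" if "y \<in> {a..b}" for y
    proof -
      have "a' \<le> finv g y" "finv g y \<le> b'" using that gab incr_le[OF g(1,2)] incr_inv(1)[OF g(1,2)]
        by (metis atLeastAtMost_iff)+
      from mc[OF this] have "y = m * finv g y + c" by (simp add: incr_inv[OF g(1,2)])
      then show ?thesis using \<open>m \<noteq> 0\<close> by (simp add: field_simps)
    qed
    then show "\<exists>m c. \<forall>x\<in>{a..b}. finv g x = m * x + c" by blast
  qed
  moreover have "finv g x = x" if "x \<notin> {0..1}" for x using g(3)[OF that] incr_inv_fix[OF g(1,2)] by simp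
  ultimately show ?thesis
    unfolding PL_plus_iff using B(1) incr_strict_mono_inv[OF g(1,2)] incr_surj_inv[OF g(1,2)] by blast
qed

lemma PL_plus_germ:
  assumes "g \<in> PL_plus" shows "\<exists>m. germ 1 g x m" "\<exists>m. germ (-1) g x m"
proof -
  note g = PL_plusD[OF assms]
  obtain B where B: "finite B" "affine_off B g" using g(4) by blast
  have const: "germ \<sigma> g x 1" if "\<And>t. 0 \<le> t \<Longrightarrow> t \<le> e \<Longrightarrow> g (x + \<sigma> * t) = x + \<sigma> * t" "e > 0" for \<sigma> e
    unfolding germ_def using that(2) that(1)[of 0] by (intro exI[of _ e]) (auto simp: that(1))
  show "\<exists>m. germ 1 g x m"
  proof (cases "0 \<le> x \<and> x < 1")
    case False
    then consider "x < 0" | "x \<ge> 1" by linarith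
    then show ?thesis
    proof cases
      case 1
      have "germ 1 g x 1" by (rule const[of "- x / 2"]) (use 1 g(3) in auto)
      then show ?thesis ..
    next
      case 2
      have "g (x + 1 * t) = x + 1 * t" if "0 \<le> t" for t
        using g(3)[of "x + t"] PL_plus_0_1(2)[OF assms] that 2 by (cases "x + t = 1") auto
      then have "germ 1 g x 1" by (intro const[of 1]) auto
      then show ?thesis ..
    qed
  next
    case True
    define b where "b = Min (insert 1 {y\<in>B. x < y})"
    have fin: "finite (insert 1 {y\<in>B. x < y})" using B by simp
    have b: "x < b" "b \<le> 1" unfolding b_def using True fin by auto
    have "{x<..<b} \<inter> B = {}"
    proof (rule ccontr)
      assume "{x<..<b} \<inter> B \<noteq> {}"
      then obtain y where "y \<in> B" "x < y" "y < b" by auto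
      moreover from this have "b \<le> y" unfolding b_def using fin by (intro Min_le) auto
      ultimately show False by simp
    qed
    then obtain m c where mc: "\<And>y. x \<le> y \<Longrightarrow> y \<le> b \<Longrightarrow> g y = m * y + c"
      using affine_offD[OF B(2), of x b] True b by metis
    have "germ 1 g x m" unfolding germ_def
      by (intro exI[of _ "b - x"]) (use b mc in \<open>auto simp: algebra_simps\<close>)
    then show ?thesis ..
  qed
  show "\<exists>m. germ (-1) g x m"
  proof (cases "0 < x \<and> x \<le> 1")
    case False
    then consider "x \<le> 0" | "x > 1" by linarith
    then show ?thesis
    proof cases
      case 2
      have "germ (-1) g x 1" by (rule const[of "(x - 1) / 2"]) (use 2 g(3) in \<open>auto simp: field_simps\<close>)
      then show ?thesis ..
    next
      case 1
      have "g (x + -1 * t) = x + -1 * t" if "0 \<le> t" for t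
        using g(3)[of "x - t"] PL_plus_0_1(1)[OF assms] that 1 by (cases "x - t = 0") auto
      then have "germ (-1) g x 1" by (intro const[of 1]) auto
      then show ?thesis ..
    qed
  next
    case True
    define b where "b = Max (insert 0 {y\<in>B. y < x})"
    have fin: "finite (insert 0 {y\<in>B. y < x})" using B by simp
    have b: "b < x" "0 \<le> b" unfolding b_def using True fin by auto
    have "{b<..<x} \<inter> B = {}"
    proof (rule ccontr)
      assume "{b<..<x} \<inter> B \<noteq> {}"
      then obtain y where "y \<in> B" "y < x" "b < y" by auto
      moreover from this have "y \<le> b" unfolding b_def using fin by (intro Max_ge) auto
      ultimately show False by simp
    qed
    then obtain m c where mc: "\<And>y. b \<le> y \<Longrightarrow> y \<le> x \<Longrightarrow> g y = m * y + c"
      using affine_offD[OF B(2), of b x] True b by metis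
    have "germ (-1) g x m" unfolding germ_def
      by (intro exI[of _ "x - b"]) (use b mc in \<open>auto simp: algebra_simps\<close>)
    then show ?thesis ..
  qed
qed

lemma PL_plus_plf: assumes "g \<in> PL_plus" shows "plf g"
proof -
  have "(\<exists>p\<le>x. g p = p) \<and> (\<exists>q\<ge>x. g q = q)" for x
    using PL_plusD(3)[OF assms, of "min x (-1)"] PL_plusD(3)[OF assms, of "max x 2"]
    by (intro conjI exI[of _ "min x (-1)"] exI[of _ "max x 2"]) auto
  then show ?thesis
    unfolding plf_def using PL_plusD[OF assms] PL_plus_germ[OF assms] by blast
qed

lemma PL_orb_unit:
  assumes "g \<in> PL_plus" "orb g a b" shows "0 \<le> a" "b \<le> 1"
proof -
  have *: "x \<in> {0..1}" if "a < x" "x < b" for x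
    using PL_plusD(3)[OF assms(1), of x] assms(2) that unfolding orb_def by blast
  show "0 \<le> a"
  proof (rule ccontr)
    assume "\<not> 0 \<le> a"
    moreover define x where "x = min ((a + b) / 2) (a / 2)"
    ultimately have "a < x" "x < b" "x < 0" using orbD(1)[OF assms(2)] by (auto simp: min_def)
    then show False using *[of x] by simp
  qed
  show "b \<le> 1"
  proof (rule ccontr)
    assume "\<not> b \<le> 1"
    moreover define x where "x = max ((a + b) / 2) ((b + 1) / 2)"
    ultimately have "a < x" "x < b" "x > 1" using orbD(1)[OF assms(2)] by (auto simp: max_def)
    then show False using *[of x] by simp
  qed
qed

text \<open>Every orbital contains a break, because an affine map fixing two points is the identity.\<close>

lemma finite_orbs:
  assumes "g \<in> PL_plus" shows "finite {(a, b). orb g a b}"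
proof -
  obtain B where B: "finite B" "affine_off B g" using PL_plusD(4)[OF assms] by blast
  have ex: "\<exists>y\<in>B. a < y \<and> y < b" if o: "orb g a b" for a b
  proof (rule ccontr)
    assume "\<not> ?thesis"
    then have "{a<..<b} \<inter> B = {}" by auto
    moreover have ab: "a < b" "g a = a" "g b = b" using o by (auto simp: orb_def)
    ultimately obtain m c where mc: "\<And>x. a \<le> x \<Longrightarrow> x \<le> b \<Longrightarrow> g x = m * x + c"
      using affine_offD[OF B(2), of a b] PL_orb_unit[OF assms o] by metis
    from mc[of a] mc[of b] ab have "(m - 1) * (b - a) = 0" "c = a - m * a" by (auto simp: algebra_simps)
    then have "g ((a + b) / 2) = (a + b) / 2" using mc[of "(a + b) / 2"] ab by (auto simp: field_simps)
    then show False using orbD(4)[OF o, of "(a + b) / 2"] ab by simp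
  qed
  then obtain f where f: "\<And>a b. orb g a b \<Longrightarrow> f (a, b) \<in> B \<and> a < f (a, b) \<and> f (a, b) < b"
    using bchoice[of "{(a, b). orb g a b}" "\<lambda>(a, b) y. y \<in> B \<and> a < y \<and> y < b"] by auto metis
  have "inj_on f {(a, b). orb g a b}"
  proof (rule inj_onI, clarify)
    fix a b c d assume o: "orb g a b" "orb g c d" "f (a, b) = f (c, d)"
    define y where "y = f (a, b)"
    have y: "a < y" "y < b" "c < y" "y < d" using f[OF o(1)] f[OF o(2)] o(3) by (auto simp: y_def)
    have "\<not> a < c" "\<not> c < a" "\<not> b < d" "\<not> d < b" using o(1,2) y unfolding orb_def by (metis less_trans)+
    then show "a = c \<and> b = d" by simp
  qed
  moreover have "f ` {(a, b). orb g a b} \<subseteq> B" using f by auto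
  ultimately show ?thesis using B(1) finite_imageD finite_subset by metis
qed

text \<open>A one-bump factor given by the ends of its interval. The interval need not be an
  orbital: cutting is also applied between arbitrary fixed points, with several orbitals or none in
  between.\<close>

definition clip :: "real \<Rightarrow> real \<Rightarrow> (real \<Rightarrow> real) \<Rightarrow> real \<Rightarrow> real" where
  "clip a b g = (\<lambda>x. if a < x \<and> x < b then g x else x)"

lemma clip_one_bump: "one_bump_factor {a<..<b} g = clip a b g"
  by (auto simp: one_bump_factor_def clip_def)

lemma PL_plus_clip:
  assumes "g \<in> PL_plus" "g a = a" "g b = b" "0 \<le> a" "b \<le> 1"
  shows "clip a b g \<in> PL_plus"
proof -
  note g = PL_plusD[OF assms(1)]
  have between: "a < g x \<and> g x < b \<longleftrightarrow> a < x \<and> x < b" for x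
    using incr_less[OF g(1,2)] assms(2,3) by metis
  have mono: "strict_mono (clip a b g)"
    unfolding strict_mono_def
  proof (intro allI impI)
    fix x y :: real assume "x < y"
    then show "clip a b g x < clip a b g y"
      using between[of x] between[of y] incr_less[OF g(1,2), of x y] by (auto simp: clip_def)
  qed
  have surj: "surj (clip a b g)"
  proof -
    have "\<exists>x. clip a b g x = y" for y
    proof (cases "a < y \<and> y < b")
      case True
      then have "clip a b g (finv g y) = y"
        using between[of "finv g y"] by (simp add: clip_def incr_inv[OF g(1,2)])
      then show ?thesis by blast
    next
      case False
      then have "clip a b g y = y" unfolding clip_def by (simp only: if_False)
      then show ?thesis by blast
    qed
    then show ?thesis by (metis surjI)
  qed
  obtain B where B: "finite B" "affine_off B g" using g(4) by blast
  have "affine_off (insert a (insert b B)) (clip a b g)"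
    unfolding affine_off_def
  proof (intro allI impI)
    fix u v :: real assume uv: "0 \<le> u \<and> u < v \<and> v \<le> 1 \<and> {u<..<v} \<inter> insert a (insert b B) = {}"
    then have dis: "\<not> (u < a \<and> a < v)" "\<not> (u < b \<and> b < v)" by auto
    obtain m c where mc: "\<And>x. u \<le> x \<Longrightarrow> x \<le> v \<Longrightarrow> g x = m * x + c"
      by (rule affine_offD[OF B(2), of u v]) (use uv in auto)
    show "\<exists>m c. \<forall>x\<in>{u..v}. clip a b g x = m * x + c"
    proof (cases "a \<le> u \<and> v \<le> b")
      case True
      have "clip a b g x = m * x + c" if "x \<in> {u..v}" for x
      proof (cases "x = a \<or> x = b")
        case True
        then show ?thesis using that mc[of x] assms(2,3) by (auto simp: clip_def)
      next
        case False
        then have "a < x \<and> x < b" using \<open>a \<le> u \<and> v \<le> b\<close> that by auto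
        then show ?thesis using that mc[of x] by (simp add: clip_def)
      qed
      then show ?thesis by blast
    next
      case False
      have "clip a b g x = 1 * x + 0" if "x \<in> {u..v}" for x
        using that False dis uv by (auto simp: clip_def)
      then show ?thesis by blast
    qed
  qed
  moreover have "clip a b g x = x" if "x \<notin> {0..1}" for x using g(3)[OF that] by (simp add: clip_def)
  ultimately show ?thesis
    unfolding PL_plus_iff using mono surj B(1) by (meson finite_insert)
qed

section \<open>The group structure\<close>

lemma group_PL: "group PL_group"
proof (rule groupI)
  fix x assume x: "x \<in> carrier PL_group"
  then have "finv x \<in> PL_plus" "finv x \<otimes>\<^bsub>PL_group\<^esub> x = \<one>\<^bsub>PL_group\<^esub>"
    using PL_plus_inv PL_plusD(1,2) by (auto simp: PL_group_def incr_inv)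
  then show "\<exists>y\<in>carrier PL_group. y \<otimes>\<^bsub>PL_group\<^esub> x = \<one>\<^bsub>PL_group\<^esub>"
    by (auto simp: PL_group_def)
qed (auto simp: PL_group_def PL_plus_comp PL_plus_id)

lemma PL_group_simps:
  "carrier PL_group = PL_plus" "g \<otimes>\<^bsub>PL_group\<^esub> h = h \<circ> g" "\<one>\<^bsub>PL_group\<^esub> = id"
  by (simp_all add: PL_group_def)

lemma PL_group_inv:
  assumes "g \<in> PL_plus" shows "inv\<^bsub>PL_group\<^esub> g = finv g"
proof (rule group.inv_equality[OF group_PL])
  show "finv g \<otimes>\<^bsub>PL_group\<^esub> g = \<one>\<^bsub>PL_group\<^esub>"
    using PL_plusD(1,2)[OF assms] by (auto simp: PL_group_simps incr_inv)
qed (use assms PL_plus_inv in \<open>auto simp: PL_group_simps\<close>)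

lemma subgroup_iff_plgroup:
  "subgroup H PL_group \<longleftrightarrow> H \<subseteq> PL_plus \<and> plgroup H"
proof
  assume "subgroup H PL_group"
  then have H: "H \<subseteq> PL_plus" and id: "id \<in> H" and comp: "\<And>f g. f \<in> H \<Longrightarrow> g \<in> H \<Longrightarrow> g \<circ> f \<in> H"
    and inv: "\<And>f. f \<in> H \<Longrightarrow> inv\<^bsub>PL_group\<^esub> f \<in> H"
    by (auto simp: subgroup_def PL_group_simps)
  have "finv f \<in> H" if "f \<in> H" for f using inv[OF that] PL_group_inv[of f] H that by auto
  then show "H \<subseteq> PL_plus \<and> plgroup H"
    using H id comp PL_plus_plf unfolding plgroup_def by blast
next
  assume H: "H \<subseteq> PL_plus \<and> plgroup H"
  show "subgroup H PL_group"
  proof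
    show "inv\<^bsub>PL_group\<^esub> x \<in> H" if "x \<in> H" for x
      using H that PL_group_inv[of x] plgroupD(4)[of H x] by auto
  qed (use H plgroupD in \<open>auto simp: PL_group_simps\<close>)
qed


section \<open>Towers and solubility\<close>

lemma PL_subgroupD:
  assumes "subgroup H PL_group"
  shows "plgroup H" "g \<in> H \<Longrightarrow> g \<in> PL_plus"
  using assms unfolding subgroup_iff_plgroup by blast+

lemma PL_generate_subgroup: "X \<subseteq> PL_plus \<Longrightarrow> subgroup (generate PL_group X) PL_group"
  by (rule group.generate_is_subgroup[OF group_PL]) (simp add: PL_group_simps)

lemma PL_generate_least: "subgroup H PL_group \<Longrightarrow> X \<subseteq> H \<Longrightarrow> generate PL_group X \<subseteq> H"
  using group.generate_subgroup_incl[OF group_PL] by blast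

lemma PL_derived_subgroup: "subgroup H PL_group \<Longrightarrow> subgroup (derived PL_group H) PL_group"
  by (rule group.derived_is_subgroup[OF group_PL subgroup.subset])

lemma PL_derived_sub: "subgroup H PL_group \<Longrightarrow> derived PL_group H \<subseteq> H"
  by (rule group.derived_incl[OF group_PL order_refl])

text \<open>In a product the left factor acts first, so the word reappears reversed as a
  composition.\<close>

lemma PL_commutator:
  assumes "f \<in> PL_plus" "g \<in> PL_plus"
  shows "f \<otimes>\<^bsub>PL_group\<^esub> g \<otimes>\<^bsub>PL_group\<^esub> inv\<^bsub>PL_group\<^esub> f \<otimes>\<^bsub>PL_group\<^esub> inv\<^bsub>PL_group\<^esub> g =
    finv g \<circ> finv f \<circ> g \<circ> f"
  using assms by (simp add: PL_group_simps PL_group_inv comp_assoc)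

lemma commutator_in_derived:
  assumes "subgroup H PL_group" "f \<in> H" "g \<in> H"
  shows "finv g \<circ> finv f \<circ> g \<circ> f \<in> derived PL_group H"
proof -
  have "f \<in> PL_plus" "g \<in> PL_plus" using assms PL_subgroupD by blast+
  moreover have "f \<otimes>\<^bsub>PL_group\<^esub> g \<otimes>\<^bsub>PL_group\<^esub> inv\<^bsub>PL_group\<^esub> f \<otimes>\<^bsub>PL_group\<^esub> inv\<^bsub>PL_group\<^esub> g \<in> derived PL_group H"
    unfolding derived_def by (intro generate.incl) (use assms in blast)
  ultimately show ?thesis by (simp only: PL_commutator)
qed

lemma derived_least:
  assumes "subgroup H PL_group" "subgroup K PL_group"
    and "\<And>f g. f \<in> H \<Longrightarrow> g \<in> H \<Longrightarrow> finv g \<circ> finv f \<circ> g \<circ> f \<in> K"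
  shows "derived PL_group H \<subseteq> K"
  unfolding derived_def
proof (rule PL_generate_least[OF assms(2)], clarify)
  fix f g assume "f \<in> H" "g \<in> H"
  then show "f \<otimes>\<^bsub>PL_group\<^esub> g \<otimes>\<^bsub>PL_group\<^esub> inv\<^bsub>PL_group\<^esub> f \<otimes>\<^bsub>PL_group\<^esub> inv\<^bsub>PL_group\<^esub> g \<in> K"
    using PL_commutator assms(3) PL_subgroupD(2)[OF assms(1)] by simp
qed

text \<open>A conjugate of \<open>k\<close> is \<open>k\<close> times a commutator.\<close>

lemma derived_conj:
  assumes "subgroup H PL_group" "k \<in> derived PL_group H" "u \<in> H"
  shows "finv u \<circ> k \<circ> u \<in> derived PL_group H"
proof -
  have k: "k \<in> H" using PL_derived_sub assms by blast
  note ki = PL_plusD(1,2)[OF PL_subgroupD(2)[OF assms(1) k]]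
  have "k \<circ> (finv k \<circ> finv u \<circ> k \<circ> u) \<in> derived PL_group H"
    by (intro plgroupD(3)[OF PL_subgroupD(1)[OF PL_derived_subgroup[OF assms(1)]] assms(2)]
        commutator_in_derived assms k)
  moreover have "k \<circ> (finv k \<circ> finv u \<circ> k \<circ> u) = finv u \<circ> k \<circ> u"
    by (simp add: fun_eq_iff incr_inv[OF ki])
  ultimately show ?thesis by simp
qed

lemma fix_subgroup: "subgroup {k \<in> PL_plus. k a = a \<and> slope \<sigma> k a = 1} PL_group" if s: "\<sigma> = 1 \<or> \<sigma> = -1"
  unfolding subgroup_iff_plgroup plgroup_def
proof (intro conjI ballI)
  fix f assume f: "f \<in> {k \<in> PL_plus. k a = a \<and> slope \<sigma> k a = 1}"
  then have fi: "strict_mono f" "surj f" using PL_plusD by blast+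
  show "plf f" using f PL_plus_plf by blast
  have "slope \<sigma> (finv f) a = 1" using slope_inv[OF PL_plus_plf s, of f a] f by simp
  then show "finv f \<in> {k \<in> PL_plus. k a = a \<and> slope \<sigma> k a = 1}"
    using f PL_plus_inv incr_inv_fix[OF fi] by simp
  fix g assume g: "g \<in> {k \<in> PL_plus. k a = a \<and> slope \<sigma> k a = 1}"
  show "f \<circ> g \<in> {k \<in> PL_plus. k a = a \<and> slope \<sigma> k a = 1}"
    using f g PL_plus_comp slope_comp[OF PL_plus_plf PL_plus_plf s, of f g a] by simp
qed (use PL_plus_id slope_id[OF s] in auto)

text \<open>At a common fixed point the slope is a homomorphism to an abelian group, so commutators
  have slope one.\<close>

lemma derived_slope:
  assumes "subgroup H PL_group" "\<And>h. h \<in> H \<Longrightarrow> h a = a" "\<sigma> = 1 \<or> \<sigma> = -1" "k \<in> derived PL_group H"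
  shows "k a = a" "slope \<sigma> k a = 1"
proof -
  have "derived PL_group H \<subseteq> {k \<in> PL_plus. k a = a \<and> slope \<sigma> k a = 1}"
  proof (rule derived_least[OF assms(1) fix_subgroup[OF assms(3)]], clarify)
    fix f g assume fg: "f \<in> H" "g \<in> H"
    then have p: "f \<in> PL_plus" "g \<in> PL_plus" using PL_subgroupD(2)[OF assms(1)] by blast+
    note i = PL_plus_inv[OF p(1)] PL_plus_inv[OF p(2)]
    have fx: "f a = a" "g a = a" using assms(2) fg by blast+
    have fx': "finv f a = a" "finv g a = a" using fx incr_inv_fix PL_plusD[OF p(1)] PL_plusD[OF p(2)] by metis+
    have m: "finv g \<circ> finv f \<in> PL_plus" "finv g \<circ> finv f \<circ> g \<in> PL_plus" "finv g \<circ> finv f \<circ> g \<circ> f \<in> PL_plus"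
      using p i PL_plus_comp by blast+
    have "slope \<sigma> (finv g \<circ> finv f \<circ> g \<circ> f) a = slope \<sigma> (finv g) a * slope \<sigma> (finv f) a * slope \<sigma> g a * slope \<sigma> f a"
      using m p i fx fx' by (simp add: slope_comp[OF PL_plus_plf PL_plus_plf assms(3)])
    also have "\<dots> = 1"
      using slope_inv[OF PL_plus_plf[OF p(1)] assms(3), of a] slope_inv[OF PL_plus_plf[OF p(2)] assms(3), of a] fx
        germ_slope(2)[OF PL_plus_plf[OF p(1)] assms(3), of a] germ_slope(2)[OF PL_plus_plf[OF p(2)] assms(3), of a]
      by simp
    finally show "finv g \<circ> finv f \<circ> g \<circ> f \<in> PL_plus \<and> (finv g \<circ> finv f \<circ> g \<circ> f) a = a \<and>
        slope \<sigma> (finv g \<circ> finv f \<circ> g \<circ> f) a = 1"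
      using m(3) fx fx' by simp
  qed
  then show "k a = a" "slope \<sigma> k a = 1" using assms(4) by blast+
qed

text \<open>\<open>n\<close> strictly nested orbitals, read from the outside. Level 0 carries no
  element; it only says that an interval has room.\<close>

primrec tower :: "(real \<Rightarrow> real) set \<Rightarrow> nat \<Rightarrow> real \<Rightarrow> real \<Rightarrow> bool" where
  "tower H 0 a b \<longleftrightarrow> a < b"
| "tower H (Suc n) a b \<longleftrightarrow> (\<exists>g\<in>H. orb g a b \<and> (\<exists>c d. a < c \<and> d < b \<and> tower H n c d))"

lemma tower_mono: "tower H n a b \<Longrightarrow> H \<subseteq> K \<Longrightarrow> tower K n a b"
proof (induction n arbitrary: a b)
  case (Suc n)
  then obtain g c d where "g \<in> H" "orb g a b" "a < c" "d < b" "tower H n c d" by (auto simp only: tower.simps)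
  then show ?case using Suc.IH[of c d] Suc.prems(2) unfolding tower.simps by blast
qed simp

lemma tower_1: "g \<in> H \<Longrightarrow> orb g a b \<Longrightarrow> tower H 1 a b"
proof -
  assume "g \<in> H" "orb g a b"
  moreover have "a < (2 * a + b) / 3" "(a + 2 * b) / 3 < b" "(2 * a + b) / 3 < (a + 2 * b) / 3"
    using orbD(1)[OF \<open>orb g a b\<close>] by auto
  ultimately show ?thesis by (simp only: One_nat_def tower.simps) blast
qed

text \<open>An orbital of \<open>k\<close> across \<open>a\<close> would by nesting contain all of
  \<open>(a, b)\<close>, and one starting at \<open>a\<close> would equal \<open>(a, b)\<close>.
  Either would contain the fixed point \<open>c\<close>.\<close>

lemma trivial_near_left:
  assumes "plgroup H" "\<not> has_chain H" "k \<in> H" "k c = c" "g \<in> H" "orb g a b" "a < c" "c < b"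
  shows "k a = a" "slope 1 k a = 1"
proof -
  note kp = H_incr[OF assms(1) assms(3)]
  show ka: "k a = a"
  proof (rule ccontr)
    assume "k a \<noteq> a"
    then obtain u v where uv: "orb k u v" "u < a" "a < v" using orb_at[OF kp(3)] by blast
    then have "b < v" using orb_laminar[OF assms(1,2,3) uv(1) assms(5,6)] orbD(1)[OF assms(6)] by linarith
    then show False using orbD(4)[OF uv(1), of c] assms uv by simp
  qed
  show "slope 1 k a = 1"
  proof (rule ccontr)
    assume "slope 1 k a \<noteq> 1"
    then obtain e where "orb k a e" using orb_starting_at[OF kp(3) ka] by blast
    then show False using orb_eq_left[OF assms(1,2,3) _ assms(5,6)] orbD(4)[of k a e c] assms by blast
  qed
qed

text \<open>Conjugating \<open>k\<close> by a high power of the outer element \<open>g\<close>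
  pushes its support off \<open>(c, d)\<close>, because \<open>k\<close> is trivial near
  \<open>a\<close>. The commutator of \<open>k\<close> with that power then acts on
  \<open>(c, d)\<close> as the inverse of \<open>k\<close>.\<close>

lemma orb_in_derived:
  assumes H: "subgroup H PL_group" and nc: "\<not> has_chain H"
    and k: "k \<in> H" "orb k c d" and g: "g \<in> H" "orb g a b" and in_ab: "a < c" "d < b"
  obtains w where "w \<in> derived PL_group H" "orb w c d"
proof -
  note pl = PL_subgroupD(1)[OF H]
  obtain g where g: "g \<in> H" "orb g a b" "\<forall>x. a < x \<and> x < b \<longrightarrow> x < g x" using orb_oriented[OF pl g] by blast
  note ki = H_incr[OF pl k(1)] and gi = H_incr[OF pl g(1)]
  have cd: "c < d" "k c = c" using orbD[OF k(2)] by auto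
  have "k a = a" "slope 1 k a = 1"
    using trivial_near_left[OF pl nc k(1) cd(2) g(1,2)] in_ab cd by auto
  then obtain e where e: "e > 0" "\<And>y. a \<le> y \<Longrightarrow> y \<le> a + e \<Longrightarrow> k y = y"
    using plf_affine_right[OF ki(3), of a] by (metis add_diff_cancel_left' add_diff_eq mult_1)
  define x where "x = min (a + e) ((a + b) / 2)"
  have x: "a < x" "x \<le> a + e" "x < b" using e(1) orbD(1)[OF g(2)] by (auto simp: x_def min_def)
  obtain n where n: "d < (g ^^ n) x" using incr_orb_push[OF gi(1,2) g(2,3) x(1,3) in_ab(2)] by blast
  define G where "G = g ^^ n"
  have G: "G \<in> H" unfolding G_def using plgroup_funpow[OF pl g(1)] .
  note Gi = H_incr[OF pl G]
  have fixG: "G a = a" unfolding G_def using slope_funpow(2)[OF pl g(1) orbD(2)[OF g(2)], of 1] by simp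
  define w where "w = finv k \<circ> finv (finv G) \<circ> k \<circ> finv G"
  \<comment> \<open>\<open>finv G\<close> takes \<open>[c, d]\<close> to the left of
    \<open>x\<close>, into the region where \<open>k\<close> is trivial, so only the outer factor
    \<open>finv k\<close> acts.\<close>
  have wk: "w y = finv k y" if "c \<le> y" "y \<le> d" for y
  proof -
    have "a < finv G y" "finv G y < x"
      using incr_less[OF Gi(1,2)] incr_inv(1)[OF Gi(1,2)] fixG n that in_ab unfolding G_def[symmetric]
      by (metis less_le_trans, metis le_less_trans)
    then have "k (finv G y) = finv G y" using e(2) x by simp
    then show ?thesis unfolding w_def by (simp add: incr_inv_inv[OF Gi(1,2)] incr_inv[OF Gi(1,2)])
  qed
  have "orb w c d" using incr_orb_inv[OF ki(1,2) k(2)] wk unfolding orb_def by auto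
  moreover have "w \<in> derived PL_group H"
    unfolding w_def by (rule commutator_in_derived[OF H plgroupD(4)[OF pl G] k(1)])
  ultimately show thesis using that by blast
qed

lemma tower_le: "tower H n a b \<Longrightarrow> a < b"
  by (cases n) (auto simp: orbD(1))

lemma tower_in_derived:
  assumes H: "subgroup H PL_group" and nc: "\<not> has_chain H"
  shows "tower H n c d \<Longrightarrow> g \<in> H \<Longrightarrow> orb g a b \<Longrightarrow> a < c \<Longrightarrow> d < b \<Longrightarrow> tower (derived PL_group H) n c d"
proof (induction n arbitrary: a b c d g)
  case (Suc n)
  then obtain k c' d' where k: "k \<in> H" "orb k c d" "c < c'" "d' < d" "tower H n c' d'" by auto
  then have "tower (derived PL_group H) n c' d'" using Suc.IH by blast
  moreover obtain w where "w \<in> derived PL_group H" "orb w c d"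
    using orb_in_derived[OF H nc k(1,2) Suc.prems(2-5)] by blast
  ultimately show ?case using k by auto
qed simp

lemma has_chain_mono: "has_chain H \<Longrightarrow> H \<subseteq> K \<Longrightarrow> has_chain K"
  unfolding has_chain_def by blast

text \<open>Passing to the derived group costs a tower only its outermost orbital.\<close>

lemma tower_derived_nontrivial:
  assumes "subgroup H PL_group" "\<not> has_chain H" "tower H (Suc n) a b"
  shows "(derived PL_group ^^ n) H \<noteq> {id}"
  using assms
proof (induction n arbitrary: H a b)
  case 0
  then obtain g where "g \<in> H" "orb g a b" by auto
  moreover from this have "g \<noteq> id" using orbD(1)[of g a b] orbD(4)[of g a b "(a + b) / 2"] by auto
  ultimately show ?case by auto
next
  case (Suc n)
  from Suc.prems(3) obtain g c d where "g \<in> H" "orb g a b" "a < c" "d < b" "tower H (Suc n) c d"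
    unfolding tower.simps(2)[of H "Suc n"] by blast
  then have "tower (derived PL_group H) (Suc n) c d" using tower_in_derived[OF Suc.prems(1,2)] by blast
  moreover have "\<not> has_chain (derived PL_group H)"
    using has_chain_mono[OF _ PL_derived_sub[OF Suc.prems(1)]] Suc.prems(2) by blast
  ultimately have "(derived PL_group ^^ n) (derived PL_group H) \<noteq> {id}"
    using Suc.IH PL_derived_subgroup[OF Suc.prems(1)] by blast
  then show ?case by (simp only: funpow_Suc_right o_apply not_False_eq_True)
qed


section \<open>Soluble groups have no transition chains\<close>

lemma generate_fixes:
  assumes "X \<subseteq> PL_plus" "\<And>g. g \<in> X \<Longrightarrow> g x = x" "k \<in> generate PL_group X"
  shows "k x = x"
  using assms(3)
proof induction
  case (inv h)
  then have "h \<in> PL_plus" using assms(1) by blast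
  then show ?case using assms(2)[OF inv] PL_group_inv incr_inv_fix PL_plusD(1,2) by metis
qed (auto simp: PL_group_simps assms(2))

text \<open>The derived group \<open>D\<close> has slope one at the nearest common fixed points
  \<open>P\<close> and \<open>S\<close> around the chain, and it turns out to have no common fixed
  point between them. Without chains in \<open>D\<close>, every compact subinterval of
  \<open>(P, S)\<close> then lies in one orbital of \<open>D\<close> that itself stays away from
  \<open>P\<close> and \<open>S\<close>, and this can be repeated forever.\<close>

lemma soluble_step:
  assumes gh: "g \<in> PL_plus" "h \<in> PL_plus" and o: "orb g p q" "orb h r s" "p < r" "r < q" "q < s"
    and D: "D = derived PL_group (generate PL_group {g, h})"
    and nc: "\<not> has_chain D"
  shows "\<exists>a b. tower D (Suc n) a b"
proof -
  let ?H = "generate PL_group {g, h}"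
  have H: "subgroup ?H PL_group" using gh by (intro PL_generate_subgroup) auto
  have DH: "subgroup D PL_group" unfolding D by (rule PL_derived_subgroup[OF H])
  note Hp = PL_subgroupD(1)[OF H] and Dp = PL_subgroupD(1)[OF DH]
  have gH: "g \<in> ?H" "h \<in> ?H" by (auto intro: generate.incl)
  have DsubH: "D \<subseteq> ?H" unfolding D by (rule PL_derived_sub[OF H])
  note gi = PL_plusD(1,2)[OF gh(1)] and hi = PL_plusD(1,2)[OF gh(2)]
  have unit: "0 \<le> p" "s \<le> 1" using PL_orb_unit gh o by blast+
  define F where "F = {x. g x = x} \<inter> {x. h x = x}"
  have Fcl: "closed F" unfolding F_def by (intro closed_Int incr_fix_closed gi hi)
  have F01: "0 \<in> F" "1 \<in> F" unfolding F_def using PL_plus_0_1 gh by auto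
  \<comment> \<open>\<open>(P, S)\<close> is the component containing the chain of the set moved by
    \<open>g\<close> or \<open>h\<close>.\<close>
  define P where "P = Sup (F \<inter> {0..r})"
  define S where "S = Inf (F \<inter> {q..1})"
  have P: "P \<in> F \<inter> {0..r}" unfolding P_def
    by (rule closed_contains_Sup) (use F01 unit o Fcl in \<open>auto intro!: closed_Int\<close>)
  have S: "S \<in> F \<inter> {q..1}" unfolding S_def
    by (rule closed_contains_Inf) (use F01 unit o Fcl in \<open>auto intro!: closed_Int\<close>)
  have "r \<notin> F" "q \<notin> F" unfolding F_def using orbD(4)[OF o(1), of r] orbD(4)[OF o(2), of q] o by auto
  with P S have PS: "P < r" "q < S" by (auto simp: order.order_iff_strict)
  have nofix: "x \<notin> F" if "P < x" "x < S" for x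
  proof
    assume x: "x \<in> F"
    consider "x \<le> r" | "r < x" "x < q" | "q \<le> x" by linarith
    then show False
    proof cases
      case 1
      then have "x \<le> P" unfolding P_def by (intro cSup_upper) (use x that P in auto)
      with that show False by simp
    next
      case 2 then show False using x orbD(4)[OF o(1), of x] o by (auto simp: F_def)
    next
      case 3
      then have "S \<le> x" unfolding S_def by (intro cInf_lower) (use x that S in auto)
      with that show False by simp
    qed
  qed
  have Hfix: "k x = x" if "k \<in> ?H" "x \<in> F" for k x
    by (rule generate_fixes[OF _ _ that(1)]) (use gh that(2) in \<open>auto simp: F_def\<close>)
  have HPS: "P < k x \<and> k x < S" if "k \<in> ?H" "P < x" "x < S" for k x
    using Hfix[OF that(1), of P] Hfix[OF that(1), of S] P S that incr_less[OF H_incr(1,2)[OF Hp that(1)]] by (metis IntD1)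
  \<comment> \<open>Orbitals of \<open>D\<close> cannot reach \<open>P\<close> or \<open>S\<close>,
    because the slopes there are one. This leaves room for a larger orbital around each.\<close>
  have Dorb: "P < a \<and> b < S" if k: "k \<in> D" "orb k a b" "a < x" "x < b" "P < x" "x < S" for k a b x
  proof -
    have kH: "k \<in> ?H" using k(1) DsubH by blast
    have kP: "k P = P" "k S = S" using Hfix[OF kH] P S by auto
    have "slope 1 k P = 1"
      by (rule derived_slope(2)[OF H]) (use Hfix P k(1) in \<open>auto simp: D\<close>)
    moreover have "slope (-1) k S = 1"
      by (rule derived_slope(2)[OF H]) (use Hfix S k(1) in \<open>auto simp: D\<close>)
    ultimately have sl: "slope 1 k P = 1" "slope (-1) k S = 1" by auto
    have "plf k" using H_incr(3)[OF Hp kH] .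
    have "\<not> (a < P \<and> P < b)" "\<not> (a < S \<and> S < b)" using orbD(4)[OF k(2)] kP by blast+
    moreover have "a \<noteq> P" "b \<noteq> S" using orb_slope_left[OF \<open>plf k\<close> k(2)] orb_slope_right[OF \<open>plf k\<close> k(2)] sl by auto
    ultimately show ?thesis using k(3-6) by linarith
  qed
  \<comment> \<open>The whole group preserves \<open>Fx\<close>, because \<open>D\<close> is normal,
    and acts commutatively on it, because \<open>D\<close> contains the commutators. The aim is
    \<open>Fx = {}\<close>.\<close>
  define Fx where "Fx = {x. P < x \<and> x < S \<and> (\<forall>k\<in>D. k x = x)}"
  have Fx_inv: "u x \<in> Fx" if u: "u \<in> ?H" and x: "x \<in> Fx" for u x
  proof -
    have "k (u x) = u x" if k: "k \<in> D" for k
    proof -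
      have "finv u \<circ> k \<circ> u \<in> D" using derived_conj[OF H _ u] k unfolding D by blast
      then have "finv u (k (u x)) = x" using x by (auto simp: Fx_def)
      then show ?thesis using incr_inv(1)[OF H_incr(1,2)[OF Hp u]] by metis
    qed
    then show ?thesis using HPS[OF u, of x] x by (auto simp: Fx_def)
  qed
  have Fx_comm: "g (w x) = w (g x)" if w: "w \<in> ?H" and x: "x \<in> Fx" for w x
  proof -
    have "finv g \<circ> finv w \<circ> g \<circ> w \<in> D" unfolding D by (rule commutator_in_derived[OF H w gH(1)])
    then have "finv g (finv w (g (w x))) = x" using x by (auto simp: Fx_def)
    then show ?thesis using incr_inv(1)[OF H_incr(1,2)[OF Hp w]] incr_inv(1)[OF gi] by metis
  qed
  obtain h' where h': "h' \<in> ?H" "orb h' r s" "\<forall>x. r < x \<and> x < s \<longrightarrow> x < h' x" using orb_oriented[OF Hp gH(2) o(2)] by blast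
  note h'i = H_incr[OF Hp h'(1)]
  define w where "w = finv h'"
  have w: "w \<in> ?H" unfolding w_def using plgroupD(4)[OF Hp h'(1)] .
  have wl: "r < w x \<and> w x < x" if "r < x" "x < s" for x
    using h'(3) that orbD(2,3)[OF h'(2)] incr_less[OF h'i(1,2)] incr_inv(1)[OF h'i(1,2)] unfolding w_def by metis
  \<comment> \<open>As \<open>g\<close> fixes \<open>q\<close> and commutes with \<open>w\<close> on
    \<open>Fx\<close>, it would also fix \<open>w q\<close>, which lies in \<open>(r, q)\<close> and
    so inside the orbital \<open>(p, q)\<close>.\<close>
  have q_notin: "q \<notin> Fx"
  proof
    assume "q \<in> Fx"
    then have "g (w q) = w q" using Fx_comm[OF w] orbD(3)[OF o(1)] by simp
    then show False using orbD(4)[OF o(1), of "w q"] wl[of q] o by auto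
  qed
  have closed_fixD: "closed {x. \<forall>k\<in>D. k x = x}"
  proof -
    have "{x. \<forall>k\<in>D. k x = x} = (\<Inter>k\<in>D. {x. k x = x})" by auto
    then show ?thesis using incr_fix_closed H_incr(1,2)[OF Dp] by (simp add: closed_INT)
  qed
  \<comment> \<open>Take the largest \<open>c\<close> in \<open>Fx\<close> up to \<open>q\<close>.
    It is fixed by \<open>g\<close>, hence lies at most at \<open>p\<close> and left of
    \<open>r\<close>, hence is fixed by \<open>h\<close> as well: a common fixed point in
    \<open>(P, S)\<close>.\<close>
  have claim1: False if x0: "x0 \<in> Fx" "x0 \<le> q" for x0
  proof -
    define T where "T = {x. \<forall>k\<in>D. k x = x} \<inter> {x0..q}"
    have "closed T" unfolding T_def by (intro closed_Int closed_fixD closed_atLeastAtMost)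
    have bT: "bdd_above T" unfolding T_def by (auto intro: bdd_aboveI[of _ q])
    have T: "x0 \<in> T" using x0 by (auto simp: T_def Fx_def)
    define c where "c = Sup T"
    have "c \<in> T" unfolding c_def by (rule closed_contains_Sup[OF _ bT \<open>closed T\<close>]) (use T in auto)
    then have c: "c \<in> Fx" "x0 \<le> c" "c \<le> q" using x0 PS unfolding T_def Fx_def by auto
    have upper: "x \<le> c" if "x \<in> Fx" "x \<le> q" for x
    proof (cases "x0 \<le> x")
      case True
      then show ?thesis unfolding c_def using that by (intro cSup_upper[OF _ bT]) (auto simp: T_def Fx_def)
    qed (use c in auto)
    \<comment> \<open>An element with a fixed point in \<open>[c, q]\<close> does not move
      \<open>c\<close> past \<open>q\<close>, and neither does its inverse, so both keep
      \<open>c\<close> at or below the maximum of \<open>Fx\<close> there.\<close>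
    have fixc: "u c = c" if u: "u \<in> ?H" "u z = z" "c \<le> z" "z \<le> q" for u z
    proof -
      note ui = H_incr(1,2)[OF Hp u(1)]
      have "u c \<le> q" "finv u c \<le> q"
        using incr_le[OF ui, of c z] incr_le[OF incr_strict_mono_inv[OF ui] incr_surj_inv[OF ui], of c z]
          incr_inv_fix[OF ui, of z] u by auto
      then have "u c \<le> c" "finv u c \<le> c"
        using upper Fx_inv[OF u(1) c(1)] Fx_inv[OF plgroupD(4)[OF Hp u(1)] c(1)] by auto
      then show ?thesis using incr_le[OF ui, of "finv u c" c] incr_inv(1)[OF ui] by simp
    qed
    have gc: "g c = c" using fixc[OF gH(1), of q] c orbD(3)[OF o(1)] by simp
    have "c \<noteq> q" using c(1) q_notin by blast
    then have "c \<le> p" using gc orbD(4)[OF o(1), of c] c(3) by (meson le_less not_le)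
    then have "h c = c" using fixc[OF gH(2), of r] o orbD(2)[OF o(2)] by simp
    then have "c \<in> F" using gc by (simp add: F_def)
    then show False using nofix[of c] c(1) by (auto simp: Fx_def)
  qed
  have FxE: False if x0: "x0 \<in> Fx" for x0
  proof (cases "x0 \<le> q")
    case True then show ?thesis using claim1 x0 by blast
  next
    case False
    define T where "T = {x. \<forall>k\<in>D. k x = x} \<inter> {q..x0}"
    have "closed T" unfolding T_def by (intro closed_Int closed_fixD closed_atLeastAtMost)
    have bT: "bdd_below T" unfolding T_def by (auto intro: bdd_belowI[of _ q])
    have T: "x0 \<in> T" using x0 False by (auto simp: T_def Fx_def)
    define c where "c = Inf T"
    have "c \<in> T" unfolding c_def by (rule closed_contains_Inf[OF _ bT \<open>closed T\<close>]) (use T in auto)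
    then have c: "c \<in> Fx" "c \<le> x0" "q \<le> c" using x0 PS P o unfolding T_def Fx_def by auto
    have lower: "c \<le> x" if "x \<in> Fx" "q \<le> x" for x
    proof (cases "x \<le> x0")
      case True
      then show ?thesis unfolding c_def using that by (intro cInf_lower[OF _ bT]) (auto simp: T_def Fx_def)
    qed (use c in auto)
    have fixc: "u c = c" if u: "u \<in> ?H" "u z = z" "z \<le> c" "q \<le> z" for u z
    proof -
      note ui = H_incr(1,2)[OF Hp u(1)]
      have "q \<le> u c" "q \<le> finv u c"
        using incr_le[OF ui, of z c] incr_le[OF incr_strict_mono_inv[OF ui] incr_surj_inv[OF ui], of z c]
          incr_inv_fix[OF ui, of z] u by auto
      then have "c \<le> u c" "c \<le> finv u c"
        using lower Fx_inv[OF u(1) c(1)] Fx_inv[OF plgroupD(4)[OF Hp u(1)] c(1)] by auto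
      then show ?thesis using incr_le[OF ui, of c "finv u c"] incr_inv(1)[OF ui] by simp
    qed
    have gc: "g c = c" using fixc[OF gH(1), of q] c orbD(3)[OF o(1)] by simp
    show False
    proof (cases "s \<le> c")
      case True
      then have "h c = c" using fixc[OF gH(2), of s] o orbD(3)[OF o(2)] by simp
      then have "c \<in> F" using gc by (simp add: F_def)
      then show False using nofix[of c] c(1) by (auto simp: Fx_def)
    next
      case False
      \<comment> \<open>The point \<open>w c\<close> of \<open>Fx\<close> is smaller than
        \<open>c\<close>: at most \<open>q\<close> it contradicts the first case, beyond
        \<open>q\<close> the minimality of \<open>c\<close>.\<close>
      then have wc: "r < w c" "w c < c" using wl[of c] c(3) o by auto
      have "w c \<in> Fx" using Fx_inv[OF w c(1)] .
      then show False using claim1[of "w c"] lower[of "w c"] wc by (meson le_cases not_le)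
    qed
  qed
  have cov: "\<exists>a b. P < a \<and> a < x \<and> y < b \<and> b < S \<and> (\<exists>k\<in>D. orb k a b)" if xy: "P < x" "x \<le> y" "y < S" for x y
  proof -
    have "\<exists>k\<in>D. \<exists>a b. orb k a b \<and> a < z \<and> z < b" if z: "x \<le> z" "z \<le> y" for z
    proof -
      have "z \<notin> Fx" using FxE by blast
      then obtain k where k: "k \<in> D" "k z \<noteq> z" using z xy by (auto simp: Fx_def)
      then show ?thesis using orb_at[OF H_incr(3)[OF Dp k(1)] k(2)] by metis
    qed
    then obtain k a b where "k \<in> D" "orb k a b" "a < x" "y < b"
      using orb_cover[OF Dp nc xy(2)] by blast
    then show ?thesis using Dorb[of k a b x] xy by force
  qed
  \<comment> \<open>Each tower lies compactly inside \<open>(P, S)\<close>, so a further orbital of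
    \<open>D\<close> goes around it.\<close>
  have "\<exists>a b. P < a \<and> b < S \<and> tower D (Suc n) a b" for n
  proof (induction n)
    case 0
    obtain a b k where "P < a" "b < S" "k \<in> D" "orb k a b" using cov[of r r] PS o by auto
    then show ?case using tower_1 by (metis One_nat_def)
  next
    case (Suc n)
    then obtain a b where ab: "P < a" "b < S" "tower D (Suc n) a b" by blast
    obtain a' b' k where "P < a'" "b' < S" "k \<in> D" "orb k a' b'" "a' < a" "b < b'"
      using cov[OF ab(1) _ ab(2)] tower_le[OF ab(3)] by auto
    then have "tower D (Suc (Suc n)) a' b'"
      unfolding tower.simps(2)[of D "Suc n"] using ab(3) by blast
    then show ?case using \<open>P < a'\<close> \<open>b' < S\<close> by blast
  qed
  then show ?thesis by blast
qed

text \<open>Induction on the length of the derived series. The derived group \<open>D\<close> of the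
  two elements of a chain dies one step earlier, so it has no chain by induction. But then it has a
  tower of height \<open>Suc n\<close>, which keeps its \<open>n\<close>-th derived group
  nontrivial.\<close>

theorem soluble_no_chain:
  assumes "subgroup H PL_group" "(derived PL_group ^^ n) H = {id}"
  shows "\<not> has_chain H"
  using assms
proof (induction n arbitrary: H)
  case 0
  have "\<not> orb id p q" for p q using orbD(1)[of id p q] orbD(4)[of id p q "(p + q) / 2"] by auto
  moreover have "H = {id}" using 0(2) by (simp only: funpow_0)
  ultimately show ?case unfolding has_chain_def by blast
next
  case (Suc n)
  show ?case
  proof
    assume "has_chain H"
    then obtain g h p q r s where gh: "g \<in> H" "h \<in> H" and o: "orb g p q" "orb h r s" "p < r" "r < q" "q < s"
      unfolding has_chain_def by blast
    define D where "D = derived PL_group (generate PL_group {g, h})"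
    have ghp: "g \<in> PL_plus" "h \<in> PL_plus" using gh PL_subgroupD(2)[OF Suc.prems(1)] by auto
    have sub: "generate PL_group {g, h} \<subseteq> H" by (rule PL_generate_least[OF Suc.prems(1)]) (use gh in blast)
    have H0: "subgroup (generate PL_group {g, h}) PL_group" by (rule PL_generate_subgroup) (use ghp in blast)
    have D: "subgroup D PL_group" unfolding D_def by (rule PL_derived_subgroup[OF H0])
    have "D \<subseteq> derived PL_group H" unfolding D_def by (rule group.mono_derived[OF group_PL sub])
    then have "(derived PL_group ^^ n) D \<subseteq> (derived PL_group ^^ n) (derived PL_group H)"
      by (rule group.mono_exp_of_derived[OF group_PL])
    also have "\<dots> = {id}" using Suc.prems(2) by (simp only: funpow_Suc_right o_apply)
    finally have "(derived PL_group ^^ n) D \<subseteq> {id}" .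
    moreover have "id \<in> (derived PL_group ^^ n) D"
      using subgroup.one_closed[OF group.exp_of_derived_is_subgroup[OF group_PL D, of n]] by (simp add: PL_group_simps)
    ultimately have Dn: "(derived PL_group ^^ n) D = {id}" by auto
    have nc: "\<not> has_chain D" by (rule Suc.IH[OF D Dn])
    obtain a b where "tower D (Suc n) a b"
      using soluble_step[OF ghp o D_def nc] by blast
    then show False using tower_derived_nontrivial[OF D nc] Dn by blast
  qed
qed


section \<open>Breakpoints bound the height of towers\<close>

text \<open>Breaks are sought on the whole line, so that 0 and 1 may count, unlike in
  \<open>breakpoints\<close>.\<close>

definition breaks :: "(real \<Rightarrow> real) \<Rightarrow> real set" where
  "breaks g = {x. slope 1 g x \<noteq> slope (-1) g x}"

lemma finite_breaks:
  assumes "g \<in> PL_plus" shows "finite (breaks g)"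
proof -
  obtain B where B: "finite B" "affine_off B g" using PL_plusD(4)[OF assms] by blast
  have "x \<in> insert 0 (insert 1 B)" if x: "x \<in> breaks g" for x
  proof (rule ccontr)
    assume nx: "x \<notin> insert 0 (insert 1 B)"
    have aff: "x \<notin> breaks g" if "e > 0" "\<And>y. x - e \<le> y \<Longrightarrow> y \<le> x + e \<Longrightarrow> g y = m * y + c" for e m c
    proof -
      have "germ 1 g x m" "germ (-1) g x m"
        unfolding germ_def using that by (auto intro!: exI[of _ e] simp: algebra_simps)
      then show ?thesis using slope_eqI[of 1 g x m] slope_eqI[of "-1" g x m] by (simp add: breaks_def)
    qed
    obtain e where e: "e > 0" "\<And>y. \<bar>y - x\<bar> \<le> e \<Longrightarrow> y \<notin> insert 0 (insert 1 B)"
    proof -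
      have "open (- insert 0 (insert 1 B))" using B(1) by (intro open_Compl finite_imp_closed) auto
      then obtain e where "e > 0" "ball x e \<subseteq> - insert 0 (insert 1 B)"
        using nx open_contains_ball by (metis ComplI)
      moreover from this have "y \<in> ball x e" if "\<bar>y - x\<bar> \<le> e / 2" for y
        using that by (simp add: dist_real_def abs_minus_commute)
      ultimately show thesis using that[of "e / 2"] by (meson ComplD half_gt_zero subsetD)
    qed
    have "x < 0 \<or> (0 < x \<and> x < 1) \<or> 1 < x" using nx by auto
    then show False
    proof (elim disjE)
      assume "x < 0"
      then have "x + e < 0" using e(2)[of 0] by (cases "x + e < 0") auto
      then have "g y = 1 * y + 0" if "x - e \<le> y" "y \<le> x + e" for y using that PL_plusD(3)[OF assms, of y] by auto
      then show False using aff[of e 1 0] e(1) x by blast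
    next
      assume "1 < x"
      then have "1 < x - e" using e(2)[of 1] by (cases "1 < x - e") auto
      then have "g y = 1 * y + 0" if "x - e \<le> y" "y \<le> x + e" for y using that PL_plusD(3)[OF assms, of y] by auto
      then show False using aff[of e 1 0] e(1) x by blast
    next
      assume "0 < x \<and> x < 1"
      then have "0 \<le> x - e" "x + e \<le> 1" using e(2)[of 0] e(2)[of 1] e(1) by (auto simp: abs_le_iff not_le intro: ccontr)
      moreover have "{x - e<..<x + e} \<inter> B = {}" using e(2) by (auto simp: abs_le_iff)
      ultimately obtain m c where "\<And>y. x - e \<le> y \<Longrightarrow> y \<le> x + e \<Longrightarrow> g y = m * y + c"
        using affine_offD[OF B(2), of "x - e" "x + e"] e(1) by auto
      then show False using aff[of e m c] e(1) x by blast
    qed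
  qed
  then show ?thesis using B(1) finite_subset[of "breaks g" "insert 0 (insert 1 B)"] by blast
qed

text \<open>By the chain rule, a break of a product is a break of the factor acting first or is
  carried by it to a break of the other factor.\<close>

lemma breaks_generate:
  assumes X: "X \<subseteq> PL_plus" and k: "k \<in> generate PL_group X" "x \<in> breaks k"
  shows "\<exists>h\<in>generate PL_group X. \<exists>e\<in>\<Union> (breaks ` X). h e = x"
  using k
proof (induction arbitrary: x)
  case one
  then have "x \<in> breaks id" by (simp only: PL_group_simps)
  moreover have "slope 1 id x = slope (-1) id x" using slope_id[of 1 x] slope_id[of "-1" x] by metis
  ultimately show ?case unfolding breaks_def by blast
next
  case (incl h)
  have "id \<in> generate PL_group X" using generate.one[of PL_group X] by (simp add: PL_group_simps)
  moreover have "x \<in> \<Union> (breaks ` X)" using incl by blast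
  ultimately show ?case by (metis id_apply)
next
  case (inv h)
  have h: "h \<in> PL_plus" using inv(1) X by blast
  note hi = PL_plusD(1,2)[OF h]
  define y where "y = finv h x"
  have x: "x = h y" unfolding y_def by (simp add: incr_inv[OF hi])
  have "y \<in> breaks h"
    using inv(2) slope_inv[OF PL_plus_plf[OF h], of 1 y] slope_inv[OF PL_plus_plf[OF h], of "-1" y]
    unfolding breaks_def PL_group_inv[OF h] x by auto
  then show ?case using generate.incl[OF inv(1)] inv(1) x by blast
next
  case (eng h1 h2)
  let ?H = "generate PL_group X"
  have H: "subgroup ?H PL_group" by (rule PL_generate_subgroup[OF X])
  have p: "h1 \<in> PL_plus" "h2 \<in> PL_plus" using eng(1,2) PL_subgroupD(2)[OF H] by auto
  have "x \<in> breaks h1 \<or> h1 x \<in> breaks h2"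
    using eng(5) slope_comp[OF PL_plus_plf[OF p(2)] PL_plus_plf[OF p(1)], of 1 x]
      slope_comp[OF PL_plus_plf[OF p(2)] PL_plus_plf[OF p(1)], of "-1" x]
    unfolding breaks_def PL_group_simps by auto
  then show ?case
  proof
    assume "x \<in> breaks h1" then show ?thesis using eng.IH by blast
  next
    assume "h1 x \<in> breaks h2"
    then obtain h e where h: "h \<in> ?H" "e \<in> \<Union> (breaks ` X)" "h e = h1 x" using eng.IH by blast
    then have "(finv h1 \<circ> h) e = x" using incr_inv(2)[OF PL_plusD(1,2)[OF p(1)]] by simp
    moreover have "finv h1 \<circ> h \<in> ?H" using plgroupD(3,4)[OF PL_subgroupD(1)[OF H]] eng(1) h(1) by blast
    ultimately show ?thesis using h(2) by blast
  qed
qed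

text \<open>The break is the last point \<open>x\<close> of \<open>(a, c]\<close> to the left of which \<open>k\<close> is trivial. A translate
  of \<open>(c, d)\<close> containing \<open>x\<close> would contain all orbitals of \<open>k\<close> between \<open>x\<close> and \<open>d\<close>, hence expand
  \<open>(c, d)\<close>.\<close>

lemma break_outside_translates:
  assumes H: "plgroup H" and nc: "\<not> has_chain H"
    and k: "k \<in> H" "orb k c d" and g: "g \<in> H" "orb g a b" and in_ab: "a < c" "d < b"
  obtains x where "a < x" "x \<le> c" "x \<in> breaks k" "\<And>h y. h \<in> H \<Longrightarrow> c < y \<Longrightarrow> y < d \<Longrightarrow> h y \<noteq> x"
proof -
  note ki = H_incr[OF H k(1)]
  have cd: "c < d" "k c = c" using orbD[OF k(2)] by auto
  have ka: "k a = a" "slope 1 k a = 1" using trivial_near_left[OF H nc k(1) cd(2) g] in_ab cd by auto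
  define T where "T = {x. a < x \<and> x \<le> c \<and> k x = x \<and> slope (-1) k x = 1}"
  \<comment> \<open>Used at \<open>x = a\<close> to see that \<open>T\<close> is not empty, and at
    its supremum to see that \<open>k\<close> moves points immediately to the right.\<close>
  have right: "\<exists>y\<in>T. x < y" if x: "a \<le> x" "x < c" "k x = x" "slope 1 k x = 1" for x
  proof -
    obtain e where e: "e > 0" "\<And>y. x \<le> y \<Longrightarrow> y \<le> x + e \<Longrightarrow> k y = k x + slope 1 k x * (y - x)"
      by (rule plf_affine_right[OF ki(3)]) blast
    define y where "y = min (x + e) c"
    have y: "x < y" "y \<le> x + e" "y \<le> c" using e(1) x(2) by (auto simp: y_def)
    have "germ (-1) k y 1" unfolding germ_def
    proof (intro exI[of _ "y - x"] conjI allI impI)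
      fix t assume "0 \<le> t \<and> t \<le> y - x"
      then show "k (y + - 1 * t) = k y + - 1 * (1 * t)" using e(2)[of "y - t"] e(2)[of y] x y by simp
    qed (use y in simp)
    then have "slope (-1) k y = 1" by (rule slope_eqI) simp
    moreover have "k y = y" using e(2)[of y] x y by simp
    moreover have "a < y" using x y by simp
    ultimately show ?thesis unfolding T_def using y by blast
  qed
  have bdd: "bdd_above T" unfolding T_def by (auto intro: bdd_aboveI[of _ c])
  obtain t where t: "t \<in> T" using right[of a] ka in_ab by auto
  define z where "z = Sup T"
  have z: "t \<le> z" "z \<le> c" unfolding z_def using t bdd
    by (auto intro!: cSup_upper cSup_least simp: T_def)
  have near: "\<exists>y\<in>T. u < y \<and> y \<le> z" if "u < z" for u
    using that less_cSup_iff[of T u] t bdd cSup_upper[OF _ bdd] unfolding z_def by (metis empty_iff)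
  have kz: "k z = z"
  proof (rule ccontr)
    assume "k z \<noteq> z"
    then obtain u v where uv: "orb k u v" "u < z" "z < v" using orb_at[OF ki(3)] by blast
    then show False using near[of u] orbD(4)[OF uv(1)] by (force simp: T_def)
  qed
  have az: "a < z" using t z by (auto simp: T_def)
  have slz: "slope (-1) k z = 1"
  proof (rule ccontr)
    assume ne: "slope (-1) k z \<noteq> 1"
    then obtain u where u: "orb k u z" using orb_ending_at[OF ki(3) kz] by blast
    then obtain y where y: "y \<in> T" "u < y" "y \<le> z" using near orbD(1) by blast
    moreover have "y \<noteq> z" using y(1) ne by (auto simp: T_def)
    ultimately show False using orbD(4)[OF u, of y] by (auto simp: T_def)
  qed
  have "slope 1 k z \<noteq> 1"
  proof
    assume "slope 1 k z = 1"
    moreover from this have "z < c" using orb_slope_left[OF ki(3) k(2)] z(2) by (cases "z = c") auto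
    ultimately obtain y where "y \<in> T" "z < y" using right[of z] az kz by auto
    then show False using cSup_upper[OF _ bdd, of y] by (simp add: z_def)
  qed
  then have br: "z \<in> breaks k" using slz by (simp add: breaks_def)
  have "h y \<noteq> z" if h: "h \<in> H" and y: "c < y" "y < d" for h y
  proof
    assume hy: "h y = z"
    note hi = H_incr[OF H h]
    define k' where "k' = h \<circ> k \<circ> finv h"
    define u where "u = h c"
    define v where "v = h d"
    have k': "orb k' u v" "k' \<in> H" unfolding k'_def u_def v_def using orb_conj[OF H k(1) h k(2)] by auto
    have uv: "u < z" "z < v" unfolding u_def v_def hy[symmetric] using y incr_less[OF hi(1,2)] by auto
    \<comment> \<open>Otherwise \<open>v\<close> lies in \<open>(z, c]\<close>. Without chains
      \<open>k\<close> fixes \<open>v\<close>, and no orbital of \<open>k\<close> can end at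
      \<open>v\<close>, as it would share that end with \<open>(u, v)\<close>. So \<open>v\<close>
      belongs to \<open>T\<close>, above its supremum.\<close>
    have "c < v"
    proof (rule ccontr)
      assume "\<not> c < v"
      then have vc: "v \<le> c" by simp
      have kv: "k v = v"
      proof (rule ccontr)
        assume "k v \<noteq> v"
        then obtain e e' where e: "orb k e e'" "e < v" "v < e'" using orb_at[OF ki(3)] by blast
        then have "z \<le> e" using orbD(4)[OF e(1), of z] kz uv by linarith
        then show False using has_chainI[OF k'(1) e(1) k'(2) k(1)] e uv nc by simp
      qed
      show False
      proof (cases "slope (-1) k v = 1")
        case True
        then have "v \<in> T" unfolding T_def using kv vc az uv by auto
        then show False using cSup_upper[OF _ bdd, of v] uv by (simp add: z_def)
      next
        case False
        then obtain e where e: "orb k e v" using orb_ending_at[OF ki(3) kv] by blast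
        then have "z \<le> e" using orbD(4)[OF e, of z] kz uv by linarith
        then show False using orb_eq_right[OF H nc k'(2,1) k(1) e] uv by simp
      qed
    qed
    then have "u < c \<and> d < v" using orb_laminar[OF H nc k'(2,1) k] uv z cd by linarith
    then show False using orb_not_expanded[OF H nc k h] unfolding u_def v_def by blast
  qed
  then show thesis using that az z br by blast
qed

text \<open>The new generator break \<open>e\<close> has an orbit that meets \<open>(a, b)\<close>
  at \<open>x\<close> but never enters \<open>(c, d)\<close>, whereas the orbits of the breaks
  already collected do. So \<open>e\<close> differs from all of them. The outermost orbital has
  nothing above it, whence only \<open>n\<close> breaks for height \<open>Suc n\<close>.\<close>

lemma tower_breaks:
  assumes X: "X \<subseteq> PL_plus" and H: "H = generate PL_group X" and nc: "\<not> has_chain H"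
  shows "tower H (Suc n) a b \<Longrightarrow>
    \<exists>S\<subseteq>\<Union> (breaks ` X). finite S \<and> card S = n \<and> (\<forall>e\<in>S. \<exists>h\<in>H. a < h e \<and> h e < b)"
proof (induction n arbitrary: a b)
  case (Suc n)
  have Hp: "plgroup H" unfolding H by (rule PL_subgroupD(1)[OF PL_generate_subgroup[OF X]])
  from Suc.prems obtain g c d where g: "g \<in> H" "orb g a b" and cd: "a < c" "d < b" "tower H (Suc n) c d"
    unfolding tower.simps(2)[of H "Suc n"] by blast
  from cd(3) obtain k where k: "k \<in> H" "orb k c d" by auto
  obtain S where S: "S \<subseteq> \<Union> (breaks ` X)" "finite S" "card S = n" "\<forall>e\<in>S. \<exists>h\<in>H. c < h e \<and> h e < d"
    using Suc.IH[OF cd(3)] by blast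
  obtain x where x: "a < x" "x \<le> c" "x \<in> breaks k" "\<And>h y. h \<in> H \<Longrightarrow> c < y \<Longrightarrow> y < d \<Longrightarrow> h y \<noteq> x"
    using break_outside_translates[OF Hp nc k g cd(1,2)] by blast
  obtain h e where h: "h \<in> H" "e \<in> \<Union> (breaks ` X)" "h e = x"
    using breaks_generate[OF X _ x(3)] k(1) unfolding H by blast
  have "e \<notin> S"
  proof
    assume "e \<in> S"
    then obtain h' where h': "h' \<in> H" "c < h' e" "h' e < d" using S(4) by blast
    have "(h \<circ> finv h') (h' e) = x" using h(3) incr_inv(2)[OF H_incr(1,2)[OF Hp h'(1)]] by simp
    moreover have "h \<circ> finv h' \<in> H" using plgroupD(3,4)[OF Hp] h(1) h'(1) by blast
    ultimately show False using x(4) h' by blast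
  qed
  then have "card (insert e S) = Suc n" "finite (insert e S)" using S by auto
  moreover have "a < h e" "h e < b" using h(3) x(1,2) cd(1,2) orbD(1)[OF k(2)] by auto
  then have "\<forall>e\<in>insert e S. \<exists>h\<in>H. a < h e \<and> h e < b" using S(4) cd(1,2) h(1) by (metis insertE less_trans)
  moreover have "insert e S \<subseteq> \<Union> (breaks ` X)" using S(1) h(2) by blast
  ultimately show ?case by blast
next
  case 0
  show ?case by (intro exI[of _ "{}"]) simp
qed

lemma tower_bounded:
  assumes "finite X" "X \<subseteq> PL_plus" "\<not> has_chain (generate PL_group X)"
  obtains N where "\<And>n a b. tower (generate PL_group X) n a b \<Longrightarrow> n \<le> N"
proof -
  let ?E = "\<Union> (breaks ` X)"
  have fin: "finite ?E" using assms(1,2) finite_breaks by blast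
  have "n \<le> Suc (card ?E)" if "tower (generate PL_group X) n a b" for n a b
  proof (cases n)
    case (Suc m)
    from tower_breaks[OF assms(2) refl assms(3) that[unfolded Suc]]
    obtain S where "S \<subseteq> ?E" "card S = m" by (elim exE conjE)
    then have "m \<le> card ?E" using card_mono[OF fin, of S] by simp
    then show ?thesis using Suc by simp
  qed simp
  then show thesis by (rule that)
qed


section \<open>Slopes at the end of a maximal orbital\<close>

lemma slope_commutator:
  assumes "plgroup H" "u \<in> H" "v \<in> H" "u a = a" "v a = a" "\<sigma> = 1 \<or> \<sigma> = -1"
  shows "slope \<sigma> (finv u \<circ> finv v \<circ> u \<circ> v) a = 1"
proof -
  note ui = H_incr[OF assms(1,2)] and vi = H_incr[OF assms(1,3)]
  have p: "plf (finv u)" "plf (finv v)" "plf (finv u \<circ> finv v)" "plf (finv u \<circ> finv v \<circ> u)"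
    by (intro plgroupD(1)[OF assms(1)] plgroupD(3,4)[OF assms(1)] assms(2,3))+
  have fx: "finv u a = a" "finv v a = a"
    using incr_inv_fix[OF ui(1,2)] incr_inv_fix[OF vi(1,2)] assms(4,5) by auto
  have "slope \<sigma> (finv u \<circ> finv v \<circ> u \<circ> v) a = slope \<sigma> (finv u) a * slope \<sigma> (finv v) a * slope \<sigma> u a * slope \<sigma> v a"
    by (simp add: slope_comp[OF p(4) vi(3) assms(6)] slope_comp[OF p(3) ui(3) assms(6)] slope_comp[OF p(1,2) assms(6)] fx assms(4,5))
  also have "\<dots> = 1"
    using slope_inv[OF ui(3) assms(6), of a] slope_inv[OF vi(3) assms(6), of a] assms(4,5)
      germ_slope(2)[OF ui(3) assms(6), of a] germ_slope(2)[OF vi(3) assms(6), of a] by simp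
  finally show ?thesis .
qed

section \<open>Discreteness of the slopes and fixed points of the slope-one elements\<close>

context
  fixes H a b f
  assumes H: "plgroup H" and nc: "\<not> has_chain H"
    and fix_ab: "\<And>h. h \<in> H \<Longrightarrow> h a = a" "\<And>h. h \<in> H \<Longrightarrow> h b = b"
    and f: "f \<in> H" "orb f a b" and left: "\<And>x. a < x \<Longrightarrow> x < b \<Longrightarrow> f x < x"
begin

lemma ab: "a < b" using orbD(1)[OF f(2)] .

lemma push_left:
  assumes "a < x" "x < b" "a < y" "y < b"
  obtains n where "(f ^^ n) x < y"
proof -
  note fi = H_incr(1,2)[OF H f(1)]
  have "z < finv f z" if "a < z \<and> z < b" for z
    using left[of "finv f z"] that orbD(2,3)[OF f(2)] incr_less[OF fi] incr_inv(1)[OF fi] by metis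
  then obtain n where n: "x < (finv f ^^ n) y"
    using incr_orb_push[OF incr_strict_mono_inv[OF fi] incr_surj_inv[OF fi] incr_orb_inv[OF fi f(2)]] assms by blast
  have "(f ^^ n) ((finv f ^^ n) y) = y"
    using fn_o_inv_fn_is_id[OF incr_bij[OF fi], of n] by (metis comp_apply)
  then have "(f ^^ n) x < y" using n incr_less[OF incr_funpow[OF fi]] by metis
  then show thesis by (rule that)
qed

lemma H_maps: assumes "h \<in> H" "a < x" "x < b" shows "a < h x" "h x < b"
  using incr_less[OF H_incr(1,2)[OF H assms(1)]] fix_ab[OF assms(1)] assms(2,3) by metis+

text \<open>Powers of \<open>f\<close> carry \<open>(c, d)\<close> into every neighbourhood of
  \<open>a\<close>, in particular into one where \<open>w\<close> is linear with centre
  \<open>a\<close>. If the slope of \<open>w\<close> lies strictly between 1 and the ratio of the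
  distances of the two ends from \<open>a\<close>, then \<open>w\<close> moves the left end into the
  interval and the right end beyond it: a chain.\<close>

lemma no_small_slope_if_inner_orbital:
  assumes k: "k \<in> H" "orb k c d" "a < c" "d < b"
  obtains \<epsilon> where "\<epsilon> > 0" "\<And>w. w \<in> H \<Longrightarrow> 1 < slope 1 w a \<Longrightarrow> 1 + \<epsilon> \<le> slope 1 w a"
proof -
  note fi = H_incr[OF H f(1)]
  define \<mu> where "\<mu> = slope 1 f a"
  obtain e where e: "e > 0" "\<And>y. a \<le> y \<Longrightarrow> y \<le> a + e \<Longrightarrow> f y = a + \<mu> * (y - a)"
    using plf_affine_right[OF fi(3), of a] fix_ab(1)[OF f(1)] unfolding \<mu>_def by metis
  have mu: "0 < \<mu>" "\<mu> < 1" unfolding \<mu>_def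
    using germ_slope(2)[OF fi(3)] slope_lt_1_if_moves_left[OF fi(3) f(2)] left by auto
  have pow: "(f ^^ n) y = a + \<mu> ^ n * (y - a)" if "a \<le> y" "y \<le> a + e" for n y
  proof (induction n)
    case (Suc n)
    have "\<mu> ^ n * (y - a) \<le> 1 * (y - a)" using mu that by (intro mult_right_mono power_le_one) auto
    moreover have "0 \<le> \<mu> ^ n * (y - a)" using mu that by simp
    ultimately show ?case using Suc e(2)[of "a + \<mu> ^ n * (y - a)"] that by simp
  qed simp
  have cd: "c < d" using orbD(1)[OF k(2)] .
  define e0 where "e0 = min (a + e) ((a + b) / 2)"
  have e0: "a < e0" "e0 < b" "e0 \<le> a + e" using e(1) ab by (auto simp: e0_def min_def)
  obtain N where N: "(f ^^ N) d < e0" using push_left[of d e0] k cd e0 by auto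
  define c' where "c' = (f ^^ N) c"
  define d' where "d' = (f ^^ N) d"
  have FN: "f ^^ N \<in> H" using plgroup_funpow[OF H f(1)] .
  have cd': "a < c'" "c' < d'" "d' < e0"
    using H_maps(1)[OF FN, of c] k cd incr_less[OF H_incr(1,2)[OF H FN]] N unfolding c'_def d'_def by auto
  \<comment> \<open>Since \<open>f\<close> is linear with centre \<open>a\<close> on
    \<open>[a, e0]\<close>, this ratio is the same for all further translates, while the
    neighbourhood on which \<open>w\<close> is linear varies with \<open>w\<close>. Hence
    \<open>R - 1\<close> is a uniform bound.\<close>
  define R where "R = (d' - a) / (c' - a)"
  have R: "R > 1" "d' - a = R * (c' - a)" using cd' by (auto simp: R_def field_simps)
  have "1 + (R - 1) \<le> slope 1 w a" if w: "w \<in> H" "1 < slope 1 w a" for w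
  proof (rule ccontr)
    define \<kappa> where "\<kappa> = slope 1 w a"
    assume "\<not> 1 + (R - 1) \<le> slope 1 w a"
    then have lam: "1 < \<kappa>" "\<kappa> < R" using w(2) by (auto simp: \<kappa>_def)
    obtain e' where e': "e' > 0" "\<And>y. a \<le> y \<Longrightarrow> y \<le> a + e' \<Longrightarrow> w y = a + \<kappa> * (y - a)"
      using plf_affine_right[OF H_incr(3)[OF H w(1)], of a] fix_ab(1)[OF w(1)] unfolding \<kappa>_def by metis
    define e1 where "e1 = min (a + e') ((a + b) / 2)"
    have e1: "a < e1" "e1 < b" "e1 \<le> a + e'" using e'(1) ab by (auto simp: e1_def min_def)
    obtain j where j: "(f ^^ j) d' < e1" using push_left[of d' e1] cd' e0 e1 by auto
    define c'' where "c'' = (f ^^ j) c'"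
    define d'' where "d'' = (f ^^ j) d'"
    have c'': "c'' = a + \<mu> ^ j * (c' - a)" unfolding c''_def using pow[of c' j] cd' e0 by simp
    have "d'' = a + \<mu> ^ j * (R * (c' - a))" unfolding d''_def R(2)[symmetric] using pow[of d' j] cd' e0 by simp
    then have d'': "d'' = a + R * (c'' - a)" by (simp add: c'')
    have ord: "a < c''" "c'' < d''" "d'' < e1"
    proof -
      have "0 < \<mu> ^ j * (c' - a)" using mu cd' by simp
      then show "a < c''" by (simp add: c'')
      then have "0 < (R - 1) * (c'' - a)" using R(1) by simp
      then show "c'' < d''" unfolding d'' by (simp add: algebra_simps)
      show "d'' < e1" using j by (simp add: d''_def)
    qed
    have wc: "w c'' = a + \<kappa> * (c'' - a)" "w d'' = a + \<kappa> * (d'' - a)" using e'(2) ord e1 by auto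
    have "0 < (\<kappa> - 1) * (c'' - a)" "0 < (R - \<kappa>) * (c'' - a)" "0 < (\<kappa> - 1) * (d'' - a)"
      using lam ord by simp_all
    then have "c'' < w c''" "w c'' < a + R * (c'' - a)" "d'' < w d''" unfolding wc by (simp_all add: algebra_simps)
    then have "c'' < w c''" "w c'' < d''" "d'' < w d''" using d'' by simp_all
    moreover define G where "G = (f ^^ j) \<circ> (f ^^ N)"
    have G: "G \<in> H" unfolding G_def using plgroupD(3)[OF H] plgroup_funpow[OF H f(1)] by blast
    have "G c = c''" "G d = d''" by (simp_all add: G_def c''_def d''_def c'_def d'_def)
    then have k1: "orb (G \<circ> k \<circ> finv G) c'' d''" "G \<circ> k \<circ> finv G \<in> H" using orb_conj[OF H k(1) G k(2)] by auto
    note k2 = orb_conj[OF H k1(2) w(1) k1(1)]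
    ultimately show False using has_chainI[OF k1(1) k2(1) k1(2) k2(2)] nc by blast
  qed
  then show thesis using that[of "R - 1"] R by simp
qed

text \<open>Elements of slope one at \<open>a\<close> act trivially on \<open>(a, b)\<close>, so
  commutators do, and the action is abelian. Commuting with \<open>f\<close> spreads the germs of
  all elements at \<open>a\<close> and at \<open>b\<close> to fixed linear regions. An element
  \<open>F\<close> that carries \<open>x0\<close> from the region at \<open>b\<close> into the one
  at \<open>a\<close> then ties the two linear forms together, and for slopes near 1 the resulting
  equation has no solution.\<close>

lemma no_small_slope_if_no_inner_orbital:
  assumes none: "\<not> (\<exists>k\<in>H. \<exists>c d. orb k c d \<and> a < c \<and> d < b)"
  obtains \<epsilon> where "\<epsilon> > 0" "\<And>w. w \<in> H \<Longrightarrow> 1 < slope 1 w a \<Longrightarrow> 1 + \<epsilon> \<le> slope 1 w a"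
proof -
  note fi = H_incr[OF H f(1)]
  note gi = H_incr[OF H plgroupD(4)[OF H f(1)]]
  have whole: "orb w a b" if w: "w \<in> H" "slope 1 w a \<noteq> 1" for w
  proof -
    obtain z where "orb w a z" using orb_starting_at[OF H_incr(3)[OF H w(1)] fix_ab(1)[OF w(1)] w(2)] by blast
    moreover from this have "z = b" using orb_eq_left[OF H nc w(1) _ f] by blast
    ultimately show ?thesis by simp
  qed
  \<comment> \<open>An orbital of such a \<open>w\<close> cannot begin at \<open>a\<close>, and one
    that ends at \<open>b\<close> would be all of \<open>(a, b)\<close>; so it would lie strictly
    inside.\<close>
  have triv: "w x = x" if w: "w \<in> H" "slope 1 w a = 1" "a < x" "x < b" for w x
  proof (rule ccontr)
    note wi = H_incr[OF H w(1)]
    assume "w x \<noteq> x"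
    then obtain c d where cd: "orb w c d" "a \<le> c" "c < x" "x < d" "d \<le> b"
      using incr_orbital_at[OF wi(1,2) _ _ fix_ab(1)[OF w(1)] _ fix_ab(2)[OF w(1)], of x] w(3,4) by (metis less_imp_le)
    have "c \<noteq> a" using orb_slope_left[OF wi(3), of a d] cd(1) w(2) by auto
    moreover have "d \<noteq> b" using orb_eq_right[OF H nc w(1) _ f, of c] cd(1) \<open>c \<noteq> a\<close> by auto
    ultimately show False using none w(1) cd by force
  qed
  have comm: "u (v x) = v (u x)" if uv: "u \<in> H" "v \<in> H" and x: "a < x" "x < b" for u v x
  proof -
    have m: "finv u \<circ> finv v \<circ> u \<circ> v \<in> H"
      by (intro plgroupD(3,4)[OF H] uv)
    have "slope 1 (finv u \<circ> finv v \<circ> u \<circ> v) a = 1"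
      by (rule slope_commutator[OF H uv]) (use fix_ab uv in auto)
    then have "(finv u \<circ> finv v \<circ> u \<circ> v) x = x" using triv[OF m] x by blast
    then show ?thesis
      using incr_inv(1)[OF H_incr(1,2)[OF H uv(1)]] incr_inv(1)[OF H_incr(1,2)[OF H uv(2)]] by (metis comp_apply)
  qed
  have moves: "(slope 1 w a < 1 \<longrightarrow> w x < x) \<and> (slope 1 w a \<noteq> 1 \<longrightarrow> w x \<noteq> x)"
    if w: "w \<in> H" and x: "a < x" "x < b" for w x
  proof -
    have "w x < x" if "slope 1 w a < 1"
    proof -
      have o: "orb w a b" using whole[OF w] that by simp
      then have "\<not> (\<forall>x. a < x \<and> x < b \<longrightarrow> x < w x)"
        using slope_gt_1_if_moves_right[OF H_incr(3)[OF H w] o] that by auto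
      then show ?thesis using incr_orb_cases[OF H_incr(1,2)[OF H w] o] x by blast
    qed
    moreover have "w x \<noteq> x" if "slope 1 w a \<noteq> 1" using orbD(4)[OF whole[OF w that]] x by blast
    ultimately show ?thesis by blast
  qed
  define \<mu> where "\<mu> = slope 1 f a"
  have mu: "0 < \<mu>" "\<mu> < 1" unfolding \<mu>_def
    using germ_slope(2)[OF fi(3)] slope_lt_1_if_moves_left[OF fi(3) f(2)] left by auto
  obtain e where e: "a < e" "e < b" "\<And>y. a \<le> y \<Longrightarrow> y \<le> e \<Longrightarrow> f y = a + \<mu> * (y - a)"
  proof -
    obtain e where e: "e > 0" "\<And>y. a \<le> y \<Longrightarrow> y \<le> a + e \<Longrightarrow> f y = a + \<mu> * (y - a)"
      using plf_affine_right[OF fi(3), of a] fix_ab(1)[OF f(1)] unfolding \<mu>_def by metis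
    show thesis by (rule that[of "min (a + e) ((a + b) / 2)"]) (use e ab in \<open>auto simp: min_less_iff_disj\<close>)
  qed
  have pow: "(f ^^ n) y = a + \<mu> ^ n * (y - a)" if "a \<le> y" "y \<le> e" for n y
  proof (induction n)
    case (Suc n)
    have "\<mu> ^ n * (y - a) \<le> 1 * (y - a)" using mu that by (intro mult_right_mono power_le_one) auto
    moreover have "0 \<le> \<mu> ^ n * (y - a)" using mu that by simp
    ultimately show ?case using Suc e(3)[of "a + \<mu> ^ n * (y - a)"] that by simp
  qed simp
  define g where "g = finv f"
  have gH: "g \<in> H" unfolding g_def using plgroupD(4)[OF H f(1)] .
  define \<nu> where "\<nu> = slope (-1) g b"
  have gr: "z < g z" if "a < z" "z < b" for z
    using left[of "finv f z"] that orbD(2,3)[OF f(2)] incr_less[OF fi(1,2)] incr_inv(1)[OF fi(1,2)] unfolding g_def by metis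
  have gorb: "orb g a b" unfolding g_def by (rule incr_orb_inv[OF fi(1,2) f(2)])
  obtain e' where e': "a < e'" "e' < b" "\<And>y. e' \<le> y \<Longrightarrow> y \<le> b \<Longrightarrow> g y = b + \<nu> * (y - b)"
  proof -
    obtain e where e: "e > 0" "\<And>y. b - e \<le> y \<Longrightarrow> y \<le> b \<Longrightarrow> g y = b + \<nu> * (y - b)"
      using plf_affine_left[OF H_incr(3)[OF H gH], of b] fix_ab(2)[OF gH] unfolding \<nu>_def by metis
    show thesis by (rule that[of "max (b - e) ((a + b) / 2)"]) (use e ab in \<open>auto simp: less_max_iff_disj\<close>)
  qed
  have nu: "0 < \<nu>" "\<nu> < 1"
  proof -
    show "0 < \<nu>" unfolding \<nu>_def by (rule germ_slope(2)[OF H_incr(3)[OF H gH]]) simp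
    have "e' < b + \<nu> * (e' - b)" using gr[of e'] e' by simp
    then have "0 < (1 - \<nu>) * (b - e')" by (simp add: algebra_simps)
    then show "\<nu> < 1" using e'(2) by (simp add: zero_less_mult_iff)
  qed
  have powg: "(g ^^ n) y = b + \<nu> ^ n * (y - b)" if "e' \<le> y" "y \<le> b" for n y
  proof (induction n)
    case (Suc n)
    have "\<nu> ^ n * (b - y) \<le> 1 * (b - y)" using nu that by (intro mult_right_mono power_le_one) auto
    moreover have "0 \<le> \<nu> ^ n * (b - y)" using nu that by simp
    ultimately have "e' \<le> b + \<nu> ^ n * (y - b)" "b + \<nu> ^ n * (y - b) \<le> b" using that by (auto simp: algebra_simps)
    then show ?case using Suc e'(3)[of "b + \<nu> ^ n * (y - b)"] by simp
  qed simp
  \<comment> \<open>The neighbourhood on which \<open>v\<close> is affine is not controlled. A power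
    of \<open>f\<close> moves \<open>x\<close> into it, and as \<open>v\<close> commutes with
    \<open>f\<close>, which is linear on \<open>[a, e]\<close>, the formula travels back to
    \<open>x\<close>.\<close>
  have linA: "v x = a + slope 1 v a * (x - a)" if v: "v \<in> H" and x: "a < x" "x \<le> e" "v x \<le> e" for v x
  proof -
    obtain d where d: "d > 0" "\<And>y. a \<le> y \<Longrightarrow> y \<le> a + d \<Longrightarrow> v y = a + slope 1 v a * (y - a)"
      using plf_affine_right[OF H_incr(3)[OF H v], of a] fix_ab(1)[OF v] by metis
    obtain n where n: "(f ^^ n) x < min (a + d) ((a + b) / 2)"
      by (rule push_left[of x "min (a + d) ((a + b) / 2)"]) (use x e d(1) ab in \<open>auto simp: min_less_iff_disj\<close>)
    have vx: "a < v x" using H_maps(1)[OF v, of x] x e by simp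
    have fx: "a < (f ^^ n) x" using H_maps(1)[OF plgroup_funpow[OF H f(1)], of x] x e by simp
    have "a + slope 1 v a * (\<mu> ^ n * (x - a)) = v ((f ^^ n) x)" using d(2)[of "(f ^^ n) x"] n fx pow[of x n] x by simp
    also have "\<dots> = (f ^^ n) (v x)" using comm[OF v plgroup_funpow[OF H f(1)], of x] x e by simp
    also have "\<dots> = a + \<mu> ^ n * (v x - a)" using pow[of "v x" n] vx x by simp
    finally have "\<mu> ^ n * (v x - a) = \<mu> ^ n * (slope 1 v a * (x - a))" by (simp add: algebra_simps)
    then show ?thesis using mu by simp
  qed
  have linB: "v x = b + slope (-1) v b * (x - b)" if v: "v \<in> H" and x: "e' \<le> x" "x < b" "e' \<le> v x" for v x
  proof -
    obtain d where d: "d > 0" "\<And>y. b - d \<le> y \<Longrightarrow> y \<le> b \<Longrightarrow> v y = b + slope (-1) v b * (y - b)"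
      using plf_affine_left[OF H_incr(3)[OF H v], of b] fix_ab(2)[OF v] by metis
    obtain n where n: "max (b - d) ((a + b) / 2) < (g ^^ n) x"
      by (rule incr_orb_push[OF H_incr(1,2)[OF H gH] gorb, of x "max (b - d) ((a + b) / 2)"]) (use x e' d(1) ab gr in auto)
    have vx: "v x < b" using H_maps(2)[OF v, of x] x e' by simp
    have fx: "(g ^^ n) x < b" using H_maps(2)[OF plgroup_funpow[OF H gH], of x] x e' by simp
    have "b + slope (-1) v b * (\<nu> ^ n * (x - b)) = v ((g ^^ n) x)" using d(2)[of "(g ^^ n) x"] n fx powg[of x n] x by simp
    also have "\<dots> = (g ^^ n) (v x)" using comm[OF v plgroup_funpow[OF H gH], of x] x e' by simp
    also have "\<dots> = b + \<nu> ^ n * (v x - b)" using powg[of "v x" n] vx x by simp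
    finally have "\<nu> ^ n * (v x - b) = \<nu> ^ n * (slope (-1) v b * (x - b))" by (simp add: algebra_simps)
    then show ?thesis using nu by simp
  qed
  define x0 where "x0 = (e' + b) / 2"
  have x0: "e' < x0" "x0 < b" "a < x0" using e' by (auto simp: x0_def)
  obtain N where N: "(f ^^ N) x0 < e" using push_left[of x0 e] x0 e by auto
  define F where "F = f ^^ N"
  have FH: "F \<in> H" unfolding F_def by (rule plgroup_funpow[OF H f(1)])
  note Fi = H_incr[OF H FH]
  define u0 where "u0 = F x0"
  define \<alpha> where "\<alpha> = slope 1 F x0"
  have al: "\<alpha> > 0" unfolding \<alpha>_def by (rule germ_slope(2)[OF Fi(3)]) simp
  have u0: "a < u0" "u0 < e" using H_maps(1)[OF FH, of x0] x0 N by (auto simp: u0_def F_def)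
  obtain x1 where x1: "x0 < x1" "x1 < b" "F x1 < e" and aff: "\<And>y. x0 \<le> y \<Longrightarrow> y \<le> x1 \<Longrightarrow> F y = u0 + \<alpha> * (y - x0)"
  proof -
    obtain d where d: "d > 0" "\<And>y. x0 \<le> y \<Longrightarrow> y \<le> x0 + d \<Longrightarrow> F y = F x0 + \<alpha> * (y - x0)"
      using plf_affine_right[OF Fi(3), of x0] unfolding \<alpha>_def by metis
    have t: "x0 < finv F e" using u0(2) incr_less[OF Fi(1,2)] incr_inv(1)[OF Fi(1,2)] unfolding u0_def by metis
    define x1 where "x1 = min (x0 + d) (min ((x0 + b) / 2) ((x0 + finv F e) / 2))"
    have c: "x0 < x1" "x1 < b" "x1 < finv F e" "x1 \<le> x0 + d" using d(1) x0 t by (simp_all add: x1_def min_less_iff_disj)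
    have "F x1 < F (finv F e)" using c(3) incr_less[OF Fi(1,2)] by blast
    then have "F x1 < e" by (simp only: incr_inv(1)[OF Fi(1,2)])
    moreover have "F y = u0 + \<alpha> * (y - x0)" if "x0 \<le> y" "y \<le> x1" for y
      unfolding u0_def by (rule d(2)) (use that c in auto)
    ultimately show thesis using c by (intro that[of x1])
  qed
  define u1 where "u1 = F x1"
  have u1: "u0 < u1" "u1 < e" using x1 incr_less[OF Fi(1,2)] by (auto simp: u0_def u1_def)
  \<comment> \<open>A slope of \<open>w\<close> below \<open>1 + \<epsilon>\<close> means that the
    inverse \<open>v\<close> takes \<open>u1\<close> to the right of \<open>u0\<close>, which
    through \<open>F\<close> says that \<open>v\<close> keeps \<open>x1\<close> to the right of
    \<open>x0\<close>, where both linear forms apply.\<close>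
  define \<epsilon> where "\<epsilon> = (u1 - a) / (u0 - a) - 1"
  have "\<epsilon> > 0" using u0 u1 by (simp add: \<epsilon>_def field_simps)
  have "1 + \<epsilon> \<le> slope 1 w a" if w: "w \<in> H" "1 < slope 1 w a" for w
  proof (rule ccontr)
    assume small: "\<not> 1 + \<epsilon> \<le> slope 1 w a"
    define v where "v = finv w"
    have vH: "v \<in> H" unfolding v_def by (rule plgroupD(4)[OF H w(1)])
    note vi = H_incr[OF H vH]
    define \<kappa> where "\<kappa> = slope 1 v a"
    have kap': "\<kappa> = 1 / slope 1 w a" unfolding \<kappa>_def v_def
      using slope_inv[OF H_incr(3)[OF H w(1)], of 1 a] fix_ab(1)[OF w(1)] by simp
    have kap: "0 < \<kappa>" "\<kappa> < 1" using w(2) by (auto simp: kap')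
    have "slope 1 w a < (u1 - a) / (u0 - a)" using small by (simp add: \<epsilon>_def)
    then have kap2: "u0 - a < \<kappa> * (u1 - a)" using w(2) u0 unfolding kap' by (simp add: field_simps)
    have vl: "v x < x" if "a < x" "x < b" for x using moves[OF vH that] kap unfolding \<kappa>_def by blast
    have vlin: "v u = a + \<kappa> * (u - a)" if "a < u" "u \<le> e" for u
      using linA[OF vH that] vl[of u] that e(2) unfolding \<kappa>_def by simp
    have Fv: "F (v x) = v (F x)" if "a < x" "x < b" for x using comm[OF FH vH that] .
    have ax1: "a < x1" using x1 x0 by simp
    have "F x0 < F (v x1)" using vlin[of u1] u0 u1 kap2 Fv[OF ax1 x1(2)] by (simp add: u0_def[symmetric] u1_def[symmetric])
    then have vx1: "x0 < v x1" using incr_less[OF Fi(1,2)] by simp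
    have "x0 < finv v x0" "finv v x0 < x1"
      using vl[OF x0(3,2)] vx1 incr_less[OF vi(1,2)] incr_inv(1)[OF vi(1,2)] by metis+
    \<comment> \<open>A second point at which the affine identity below can be evaluated, so that
      its coefficients can be compared.\<close>
    then obtain x2 where x2: "x0 < x2" "x2 < x1" "finv v x0 < x2"
      by (metis dense less_trans)
    then have vx2: "x0 < v x2" using incr_less[OF vi(1,2)] incr_inv(1)[OF vi(1,2)] by metis
    define \<tau> where "\<tau> = slope (-1) v b"
    \<comment> \<open>The relation \<open>F (v x) = v (F x)\<close>, with the form of
      \<open>v\<close> near \<open>b\<close> on the left and the one near \<open>a\<close> on the
      right.\<close>
    have eqn: "u0 + \<alpha> * (b + \<tau> * (x - b) - x0) = a + \<kappa> * (u0 + \<alpha> * (x - x0) - a)"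
      if x: "x0 < x" "x \<le> x1" "x0 < v x" for x
    proof -
      have xab: "a < x" "x < b" using x x0 x1 by auto
      have vb: "v x = b + \<tau> * (x - b)" unfolding \<tau>_def by (rule linB[OF vH]) (use x x0 xab in auto)
      have "F (v x) = u0 + \<alpha> * (v x - x0)" using aff[of "v x"] vl[OF xab] x by simp
      moreover have "v (F x) = a + \<kappa> * (F x - a)"
      proof (rule vlin)
        show "a < F x" by (rule H_maps(1)[OF FH xab])
        have "F x \<le> F x1" using x incr_le[OF Fi(1,2)] by simp
        then show "F x \<le> e" using x1 by simp
      qed
      moreover have "F x = u0 + \<alpha> * (x - x0)" using aff[of x] x by simp
      ultimately show ?thesis using Fv[OF xab] vb by simp
    qed
    note e1 = eqn[of x1] and e2 = eqn[of x2]
    \<comment> \<open>Comparison of the linear coefficients gives \<open>\<tau> = \<kappa>\<close>;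
      the constant terms then make a product of two positive numbers zero.\<close>
    have "\<alpha> * (\<tau> - \<kappa>) * (x1 - x2) = 0" using e1 e2 x1 x2 vx1 vx2 by (simp add: algebra_simps)
    then have "\<tau> = \<kappa>" using al x2 by simp
    then have "(1 - \<kappa>) * ((u0 - a) + \<alpha> * (b - x0)) = 0" using e1 x1 vx1 by (simp add: algebra_simps)
    moreover have "(u0 - a) + \<alpha> * (b - x0) > 0" using u0 al x0 by (intro add_pos_pos mult_pos_pos) auto
    ultimately show False using kap by simp
  qed
  then show thesis using that \<open>\<epsilon> > 0\<close> by blast
qed

lemma no_small_slope:
  obtains \<epsilon> where "\<epsilon> > 0" "\<And>w. w \<in> H \<Longrightarrow> 1 < slope 1 w a \<Longrightarrow> 1 + \<epsilon> \<le> slope 1 w a"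
  using no_small_slope_if_inner_orbital no_small_slope_if_no_inner_orbital by metis

text \<open>The infimum \<open>L\<close> of the slopes above 1 is attained, since otherwise two
  slopes close to it would have a quotient strictly between 1 and \<open>1 + \<epsilon>\<close>. Any
  other slope is divided by the power of \<open>L\<close> just below it; the quotient is a slope in
  \<open>[1, L)\<close>, hence 1.\<close>

lemma ex_slope_generator:
  obtains t where "t \<in> H" "1 < slope 1 t a" "\<And>h. h \<in> H \<Longrightarrow> \<exists>k::int. slope 1 h a = slope 1 t a powi k"
proof -
  define S where "S = {s. s > 1 \<and> (\<exists>h\<in>H. slope 1 h a = s)}"
  have mult: "\<exists>h\<in>H. slope 1 h a = s * s'" if s: "\<exists>h\<in>H. slope 1 h a = s" "\<exists>h\<in>H. slope 1 h a = s'" for s s'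
  proof -
    obtain h h' where h: "h \<in> H" "slope 1 h a = s" "h' \<in> H" "slope 1 h' a = s'" using s by blast
    then have "slope 1 (h \<circ> h') a = s * s'" by (simp add: slope_comp H_incr(3)[OF H] fix_ab)
    then show ?thesis using plgroupD(3)[OF H h(1,3)] by blast
  qed
  have inverse: "\<exists>h\<in>H. slope 1 h a = 1 / s" if s: "\<exists>h\<in>H. slope 1 h a = s" for s
  proof -
    obtain h where h: "h \<in> H" "slope 1 h a = s" using s by blast
    then have "slope 1 (finv h) a = 1 / s" using slope_inv[OF H_incr(3)[OF H h(1)], of 1 a] fix_ab(1)[OF h(1)] by simp
    then show ?thesis using plgroupD(4)[OF H h(1)] by blast
  qed
  have pos: "0 < slope 1 h a" if "h \<in> H" for h by (rule germ_slope(2)[OF H_incr(3)[OF H that]]) simp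
  obtain \<epsilon> where eps: "\<epsilon> > 0" "\<And>w. w \<in> H \<Longrightarrow> 1 < slope 1 w a \<Longrightarrow> 1 + \<epsilon> \<le> slope 1 w a"
    using no_small_slope by blast
  have "slope 1 f a < 1" using slope_lt_1_if_moves_left[OF H_incr(3)[OF H f(1)] f(2)] left by blast
  then have "1 / slope 1 f a \<in> S" unfolding S_def using inverse f(1) pos[OF f(1)] by auto
  then have ne: "S \<noteq> {}" by blast
  have bdd: "bdd_below S" unfolding S_def by (auto intro!: bdd_belowI[of _ 1])
  define L where "L = Inf S"
  have L: "1 + \<epsilon> \<le> L" unfolding L_def by (rule cInf_greatest[OF ne]) (use eps in \<open>auto simp: S_def\<close>)
  have low: "L \<le> s" if "s \<in> S" for s unfolding L_def by (rule cInf_lower[OF that bdd])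
  have "L \<in> S"
  proof (rule ccontr)
    assume nL: "L \<notin> S"
    have L0: "L > 0" using L eps by simp
    then have "L < L * (1 + \<epsilon>)" using eps by simp
    then obtain s1 where s1: "s1 \<in> S" "s1 < L * (1 + \<epsilon>)" using cInf_lessD[OF ne] unfolding L_def by blast
    then have "L < s1" using low[of s1] nL by (metis le_less)
    then obtain s2 where s2: "s2 \<in> S" "s2 < s1" using cInf_lessD[OF ne] unfolding L_def by blast
    have "L \<le> s2" using low s2 by blast
    then have "s1 / s2 < 1 + \<epsilon>" "1 < s1 / s2"
    proof -
      have "L * (1 + \<epsilon>) \<le> s2 * (1 + \<epsilon>)" using \<open>L \<le> s2\<close> eps(1) by (intro mult_right_mono) auto
      then have "s1 < s2 * (1 + \<epsilon>)" using s1(2) by simp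
      then show "s1 / s2 < 1 + \<epsilon>" using \<open>L \<le> s2\<close> L0 by (simp add: field_simps)
      show "1 < s1 / s2" using s2 \<open>L \<le> s2\<close> L0 by (simp add: field_simps)
    qed
    moreover have "\<exists>h\<in>H. slope 1 h a = s1 * (1 / s2)" using mult inverse s1 s2 unfolding S_def by blast
    ultimately show False using eps(2) by force
  qed
  then obtain t where t: "t \<in> H" "slope 1 t a = L" "1 < L" unfolding S_def by blast
  have powers: "\<exists>h\<in>H. slope 1 h a = L powi k" for k :: int
  proof -
    have nat: "\<exists>h\<in>H. slope 1 h a = L ^ n" for n
      using slope_funpow(1)[OF H t(1) fix_ab(1)[OF t(1)], of 1 n] plgroup_funpow[OF H t(1), of n] t(2) by metis
    show ?thesis
      using nat[of "nat k"] inverse[OF nat[of "nat (- k)"]] by (auto simp: power_int_def field_simps)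
  qed
  have "\<exists>k::int. slope 1 h a = slope 1 t a powi k" if h: "h \<in> H" for h
  proof -
    define s where "s = slope 1 h a"
    have s: "s > 0" unfolding s_def by (rule pos[OF h])
    define k where "k = \<lfloor>log L s\<rfloor>"
    have "of_int k \<le> log L s" "log L s < of_int k + 1" unfolding k_def by simp_all
    then have "L powr of_int k \<le> L powr log L s" "L powr log L s < L powr (of_int k + 1)"
      using t(3) by (intro powr_mono powr_less_mono; simp)+
    then have k: "L powi k \<le> s" "s < L powi k * L"
      using t(3) s by (simp_all add: powr_real_of_int' powr_add powr_log_cancel)
    have Lk: "L powi k > 0" using t(3) by (simp add: zero_less_power_int)
    have ex: "\<exists>h\<in>H. slope 1 h a = s * (1 / (L powi k))"
      by (intro mult inverse powers) (use h s_def in blast)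
    have "s / L powi k \<notin> S"
      using low[of "s / L powi k"] k(2) Lk by (auto simp: field_simps)
    then have "\<not> 1 < s / L powi k" using ex by (auto simp: S_def)
    then have "s = L powi k" using k(1) Lk by (simp add: field_simps)
    then show ?thesis using t(2) by (auto simp: s_def)
  qed
  then show thesis using that t by auto
qed

text \<open>Without a common fixed point, a single orbital \<open>(c, d)\<close> of a slope-one
  element covers \<open>[f t, t]\<close>, and it stays strictly inside \<open>(a, b)\<close>. Then
  \<open>f c < c < f d < d\<close>, so \<open>f\<close> turns it into the other half of a
  chain.\<close>

lemma ex_kernel_fixpoint:
  obtains p where "a < p" "p < b" "\<And>k. k \<in> H \<Longrightarrow> slope 1 k a = 1 \<Longrightarrow> k p = p"
proof -
  note main = that
  define K where "K = {k\<in>H. slope 1 k a = 1}"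
  have K: "plgroup K"
    unfolding plgroup_def
  proof (intro conjI ballI)
    fix g assume "g \<in> K"
    then have g: "g \<in> H" "slope 1 g a = 1" by (auto simp: K_def)
    show "plf g" using H_incr(3)[OF H g(1)] .
    show "finv g \<in> K"
      using slope_inv[OF H_incr(3)[OF H g(1)], of 1 a] fix_ab(1)[OF g(1)] g(2) plgroupD(4)[OF H g(1)] by (simp add: K_def)
    fix h assume "h \<in> K"
    then show "g \<circ> h \<in> K" using g plgroupD(3)[OF H] by (auto simp: K_def slope_comp H_incr(3)[OF H] fix_ab)
  qed (use plgroupD(2)[OF H] slope_id in \<open>auto simp: K_def\<close>)
  have ncK: "\<not> has_chain K" using nc has_chain_mono[of K H] by (auto simp: K_def)
  show thesis
  proof (rule ccontr)
    assume no: "\<not> thesis"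
    have ex: "\<exists>k\<in>K. k x \<noteq> x" if x: "a < x" "x < b" for x
    proof (rule ccontr)
      assume "\<not> ?thesis"
      then have "\<And>k. k \<in> H \<Longrightarrow> slope 1 k a = 1 \<Longrightarrow> k x = x" by (auto simp: K_def)
      then show False using main x no by blast
    qed
    define t where "t = (a + b) / 2"
    have t: "a < t" "t < b" using ab by (auto simp: t_def)
    have "\<exists>k\<in>K. \<exists>c d. orb k c d \<and> c < x \<and> x < d" if x: "f t \<le> x" "x \<le> t" for x
    proof -
      have "a < x" "x < b" using x t H_maps(1)[OF f(1) t] by auto
      then obtain k where k: "k \<in> K" "k x \<noteq> x" using ex by blast
      then show ?thesis using orb_at[OF H_incr(3)[OF K k(1)] k(2)] by metis
    qed
    then obtain k c d where k: "k \<in> K" "orb k c d" "c < f t" "t < d"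
      using orb_cover[OF K ncK, of "f t" t] left[OF t] by (metis less_imp_le)
    have kH: "k \<in> H" using k(1) by (simp add: K_def)
    note kfix = fix_ab(1)[OF kH] fix_ab(2)[OF kH]
    have "\<not> c < a" "\<not> b < d" using orbD(4)[OF k(2), of a] orbD(4)[OF k(2), of b] kfix k(3,4) t H_maps[OF f(1) t] by auto
    moreover have "c \<noteq> a" using orb_slope_left[OF H_incr(3)[OF H kH], of a d] k by (auto simp: K_def)
    moreover have "d \<noteq> b" using orb_eq_right[OF H nc kH _ f, of c] k(2) \<open>c \<noteq> a\<close> by auto
    ultimately have cd: "a < c" "d < b" by auto
    note fk = orb_conj[OF H kH f(1) k(2)]
    have "c < b" "a < d" using cd orbD(1)[OF k(2)] by auto
    then have "f c < c" "f d < d" using left cd by auto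
    moreover have "c < f d" using k(3,4) incr_less[OF H_incr(1,2)[OF H f(1)], of t d] by simp
    ultimately show False using has_chainI[OF fk(1) k(2) fk(2) kH] nc by blast
  qed
qed

end


section \<open>Bump systems\<close>

text \<open>A label, the interval, and the function moving exactly the points of that interval. Labels
  increase with nesting.\<close>

type_synonym bump = "nat \<times> (real \<times> real) \<times> (real \<Rightarrow> real)"

abbreviation lab :: "bump \<Rightarrow> nat" where "lab i \<equiv> fst i"
abbreviation lo :: "bump \<Rightarrow> real" where "lo i \<equiv> fst (fst (snd i))"
abbreviation hi :: "bump \<Rightarrow> real" where "hi i \<equiv> snd (fst (snd i))"
abbreviation fn :: "bump \<Rightarrow> real \<Rightarrow> real" where "fn i \<equiv> snd (snd i)"

definition inside :: "bump \<Rightarrow> bump \<Rightarrow> bool" where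
  "inside i j \<longleftrightarrow> lo j < lo i \<and> hi i < hi j"

definition apart :: "bump \<Rightarrow> bump \<Rightarrow> bool" where
  "apart i j \<longleftrightarrow> hi i \<le> lo j \<or> hi j \<le> lo i"

definition is_bump :: "bump \<Rightarrow> bool" where
  "is_bump i \<longleftrightarrow> fn i \<in> PL_plus \<and> orb (fn i) (lo i) (hi i) \<and>
     (\<forall>x. \<not> (lo i < x \<and> x < hi i) \<longrightarrow> fn i x = x)"

text \<open>By the last condition, the bumps inside \<open>k\<close> are all contained in one fundamental domain of
  \<open>fn k\<close>, so their conjugates by different powers of \<open>fn k\<close> are disjoint.\<close>

definition compatible :: "bump set \<Rightarrow> bool" where
  "compatible Y \<longleftrightarrow>
     (\<forall>i\<in>Y. \<forall>j\<in>Y. apart i j \<or> i = j \<or> (inside i j \<and> lab i < lab j) \<or> (inside j i \<and> lab j < lab i)) \<and>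
     (\<forall>i\<in>Y. \<forall>j\<in>Y. \<forall>k\<in>Y. inside i k \<and> inside j k \<longrightarrow> hi i \<le> fn k (lo j))"

definition bump_system :: "bump set \<Rightarrow> bool" where
  "bump_system Y \<longleftrightarrow> (\<forall>i\<in>Y. is_bump i) \<and> compatible Y"

abbreviation gens :: "bump set \<Rightarrow> (real \<Rightarrow> real) set" where
  "gens Y \<equiv> generate PL_group (fn ` Y)"

lemma PL_mult_closed:
  assumes "subgroup K PL_group"
  shows "f \<in> K \<Longrightarrow> g \<in> K \<Longrightarrow> f \<circ> g \<in> K" "g \<in> K \<Longrightarrow> finv g \<in> K" "id \<in> K"
  using plgroupD[OF PL_subgroupD(1)[OF assms]] by blast+

lemma PL_generate_induct:
  assumes "X \<subseteq> PL_plus" "k \<in> generate PL_group X" "P id" "\<And>x. x \<in> X \<Longrightarrow> P x"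
    "\<And>f. f \<in> PL_plus \<Longrightarrow> P f \<Longrightarrow> P (finv f)"
    "\<And>f g. f \<in> PL_plus \<Longrightarrow> g \<in> PL_plus \<Longrightarrow> P f \<Longrightarrow> P g \<Longrightarrow> P (f \<circ> g)"
  shows "P k"
proof -
  have "subgroup {k \<in> PL_plus. P k} PL_group"
    unfolding subgroup_iff_plgroup plgroup_def
    using assms(3,5,6) PL_plus_id PL_plus_inv PL_plus_comp PL_plus_plf by auto
  then have "generate PL_group X \<subseteq> {k \<in> PL_plus. P k}"
    using PL_generate_least assms(1,4) by blast
  then show ?thesis using assms(2) by blast
qed

lemma PL_simps:
  assumes "f \<in> PL_plus"
  shows "f (finv f x) = x" "finv f (f x) = x" "finv (finv f) = f"
  using incr_inv[OF PL_plusD(1,2)[OF assms]] incr_inv_inv[OF PL_plusD(1,2)[OF assms]] by auto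

text \<open>The commutators of generators lie in \<open>N\<close>, hence \<open>G / N\<close> is abelian.\<close>

lemma derived_generate_sub:
  assumes X: "X \<subseteq> PL_plus" and N: "subgroup N PL_group"
    and conj: "\<And>u x. u \<in> X \<Longrightarrow> x \<in> N \<Longrightarrow> u \<circ> x \<circ> finv u \<in> N \<and> finv u \<circ> x \<circ> u \<in> N"
    and comm: "\<And>u v. u \<in> X \<Longrightarrow> v \<in> X \<Longrightarrow> finv v \<circ> finv u \<circ> v \<circ> u \<in> N"
  shows "derived PL_group (generate PL_group X) \<subseteq> N"
proof -
  let ?G = "generate PL_group X"
  have G: "subgroup ?G PL_group" by (rule PL_generate_subgroup[OF X])
  have XG: "X \<subseteq> ?G" by (auto intro: generate.incl)
  have norm: "u \<circ> x \<circ> finv u \<in> N \<and> finv u \<circ> x \<circ> u \<in> N" if u: "u \<in> ?G" and x: "x \<in> N" for u x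
  proof -
    have "\<forall>x\<in>N. u \<circ> x \<circ> finv u \<in> N \<and> finv u \<circ> x \<circ> u \<in> N"
    proof (rule PL_generate_induct[OF X u, where P = "\<lambda>u. \<forall>x\<in>N. u \<circ> x \<circ> finv u \<in> N \<and> finv u \<circ> x \<circ> u \<in> N"])
      show "\<forall>x\<in>N. id \<circ> x \<circ> finv id \<in> N \<and> finv id \<circ> x \<circ> id \<in> N" by (simp only: inv_id id_comp comp_id) simp
      show "\<forall>x\<in>N. u \<circ> x \<circ> finv u \<in> N \<and> finv u \<circ> x \<circ> u \<in> N" if "u \<in> X" for u using conj that by blast
      show "\<forall>x\<in>N. finv u \<circ> x \<circ> finv (finv u) \<in> N \<and> finv (finv u) \<circ> x \<circ> finv u \<in> N"
        if "u \<in> PL_plus" "\<forall>x\<in>N. u \<circ> x \<circ> finv u \<in> N \<and> finv u \<circ> x \<circ> u \<in> N" for u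
        using that(2) by (simp only: PL_simps(3)[OF that(1)]) blast
      show "\<forall>x\<in>N. (f \<circ> g) \<circ> x \<circ> finv (f \<circ> g) \<in> N \<and> finv (f \<circ> g) \<circ> x \<circ> (f \<circ> g) \<in> N"
        if p: "f \<in> PL_plus" "g \<in> PL_plus" and f: "\<forall>x\<in>N. f \<circ> x \<circ> finv f \<in> N \<and> finv f \<circ> x \<circ> f \<in> N"
          and g: "\<forall>x\<in>N. g \<circ> x \<circ> finv g \<in> N \<and> finv g \<circ> x \<circ> g \<in> N" for f g
      proof
        fix x assume "x \<in> N"
        have e: "finv (f \<circ> g) = finv g \<circ> finv f" using incr_inv_comp PL_plusD(1,2) p by blast
        have "f \<circ> (g \<circ> x \<circ> finv g) \<circ> finv f \<in> N" "finv g \<circ> (finv f \<circ> x \<circ> f) \<circ> g \<in> N"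
          using f g \<open>x \<in> N\<close> by blast+
        then show "(f \<circ> g) \<circ> x \<circ> finv (f \<circ> g) \<in> N \<and> finv (f \<circ> g) \<circ> x \<circ> (f \<circ> g) \<in> N"
          unfolding e by (simp only: comp_assoc)
      qed
    qed
    then show ?thesis using x by blast
  qed
  define cm where "cm = (\<lambda>f v. finv v \<circ> finv f \<circ> v \<circ> f :: real \<Rightarrow> real)"
  have sub: "subgroup {f \<in> ?G. cm f v \<in> N} PL_group" if v: "v \<in> ?G" for v
    unfolding subgroup_iff_plgroup plgroup_def
  proof (intro conjI ballI)
    have vp: "v \<in> PL_plus" using PL_subgroupD(2)[OF G v] .
    show "{f \<in> ?G. cm f v \<in> N} \<subseteq> PL_plus" using PL_subgroupD(2)[OF G] by blast
    have "cm id v = id" unfolding cm_def inv_id by (simp add: fun_eq_iff PL_simps[OF vp])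
    then show "id \<in> {f \<in> ?G. cm f v \<in> N}" using PL_mult_closed(3)[OF G] PL_mult_closed(3)[OF N] by simp
    fix f assume "f \<in> {f \<in> ?G. cm f v \<in> N}"
    then have f: "f \<in> ?G" "cm f v \<in> N" by auto
    have fp: "f \<in> PL_plus" using PL_subgroupD(2)[OF G f(1)] .
    show "plf f" by (rule PL_plus_plf[OF fp])
    have "finv (cm f v) = finv f \<circ> finv v \<circ> f \<circ> v"
      unfolding cm_def
      by (rule inv_equality) (simp_all add: PL_simps[OF fp] PL_simps[OF vp])
    then have "finv f \<circ> finv v \<circ> f \<circ> v \<in> N" using PL_mult_closed(2)[OF N f(2)] by simp
    then have "f \<circ> (finv f \<circ> finv v \<circ> f \<circ> v) \<circ> finv f \<in> N" using norm[OF f(1)] by blast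
    moreover have "f \<circ> (finv f \<circ> finv v \<circ> f \<circ> v) \<circ> finv f = cm (finv f) v"
      unfolding cm_def by (simp add: fun_eq_iff PL_simps[OF fp])
    ultimately show "finv f \<in> {f \<in> ?G. cm f v \<in> N}" using PL_mult_closed(2)[OF G f(1)] by simp
    fix g assume "g \<in> {f \<in> ?G. cm f v \<in> N}"
    then have g: "g \<in> ?G" "cm g v \<in> N" by auto
    have gp: "g \<in> PL_plus" using PL_subgroupD(2)[OF G g(1)] .
    have e: "finv (f \<circ> g) = finv g \<circ> finv f" using incr_inv_comp PL_plusD(1,2) fp gp by blast
    have "cm g v \<circ> (finv g \<circ> cm f v \<circ> g) \<in> N" using PL_mult_closed(1)[OF N g(2)] norm[OF g(1) f(2)] by blast
    moreover have "cm g v \<circ> (finv g \<circ> cm f v \<circ> g) = cm (f \<circ> g) v"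
      unfolding cm_def e by (simp add: fun_eq_iff PL_simps[OF gp] PL_simps[OF vp])
    ultimately show "f \<circ> g \<in> {f \<in> ?G. cm f v \<in> N}" using PL_mult_closed(1)[OF G f(1) g(1)] by simp
  qed
  \<comment> \<open>The two arguments are extended from generators to the group one after the other;
    inverting a commutator exchanges them in between.\<close>
  have step1: "cm f v \<in> N" if "f \<in> ?G" "v \<in> X" for f v
  proof -
    have "?G \<subseteq> {f \<in> ?G. cm f v \<in> N}"
      by (rule PL_generate_least[OF sub]) (use XG comm that(2) in \<open>auto simp: cm_def\<close>)
    then show ?thesis using that(1) by blast
  qed
  have step2: "cm v f \<in> N" if "f \<in> ?G" "v \<in> X" for f v
  proof -
    have p: "f \<in> PL_plus" "v \<in> PL_plus" using PL_subgroupD(2)[OF G] that XG by blast+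
    have "finv (cm f v) = cm v f" unfolding cm_def
      by (rule inv_equality) (simp_all add: PL_simps[OF p(1)] PL_simps[OF p(2)])
    then show ?thesis using PL_mult_closed(2)[OF N step1[OF that]] by simp
  qed
  have "cm v f \<in> N" if "f \<in> ?G" "v \<in> ?G" for f v
  proof -
    have "?G \<subseteq> {v \<in> ?G. cm v f \<in> N}"
      by (rule PL_generate_least[OF sub[OF that(1)]]) (use XG step2[OF that(1)] in auto)
    then show ?thesis using that(2) by blast
  qed
  then show ?thesis using derived_least[OF G N] unfolding cm_def by blast
qed

definition conj_bump :: "(real \<Rightarrow> real) \<Rightarrow> bump \<Rightarrow> bump" where
  "conj_bump t i = (lab i, (t (lo i), t (hi i)), t \<circ> fn i \<circ> finv t)"

lemma conj_bump_simps [simp]: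
  "lab (conj_bump t i) = lab i" "lo (conj_bump t i) = t (lo i)" "hi (conj_bump t i) = t (hi i)"
  "fn (conj_bump t i) = t \<circ> fn i \<circ> finv t"
  by (simp_all add: conj_bump_def)

lemma is_bumpD:
  assumes "is_bump i"
  shows "fn i \<in> PL_plus" "orb (fn i) (lo i) (hi i)" "\<not> (lo i < x \<and> x < hi i) \<Longrightarrow> fn i x = x" "lo i < hi i"
  using assms orbD(1) unfolding is_bump_def by blast+

lemma is_bump_maps:
  assumes "is_bump i" shows "lo i < fn i x \<and> fn i x < hi i \<longleftrightarrow> lo i < x \<and> x < hi i"
  using incr_less[OF PL_plusD(1,2)[OF is_bumpD(1)[OF assms]]] orbD(2,3)[OF is_bumpD(2)[OF assms]] by metis

lemma is_bump_conj:
  assumes "is_bump i" "t \<in> PL_plus" shows "is_bump (conj_bump t i)"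
proof -
  note ti = PL_plusD(1,2)[OF assms(2)] and yi = PL_plusD(1,2)[OF is_bumpD(1)[OF assms(1)]]
  have "(t \<circ> fn i \<circ> finv t) x = x" if "\<not> (t (lo i) < x \<and> x < t (hi i))" for x
  proof -
    have "\<not> (lo i < finv t x \<and> finv t x < hi i)" using that incr_less[OF ti] incr_inv(1)[OF ti] by metis
    then show ?thesis using is_bumpD(3)[OF assms(1)] by (simp add: incr_inv[OF ti])
  qed
  moreover have "t \<circ> fn i \<circ> finv t \<in> PL_plus" using PL_plus_comp PL_plus_inv is_bumpD(1)[OF assms(1)] assms(2) by blast
  ultimately show ?thesis
    unfolding is_bump_def using incr_orb_conj[OF yi ti is_bumpD(2)[OF assms(1)]] by simp
qed

text \<open>As \<open>fn i\<close> is trivial off its interval, only the values of the conjugating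
  map on that interval matter.\<close>

lemma conj_bump_eq:
  assumes i: "is_bump i" and t: "t \<in> PL_plus" and u: "u \<in> PL_plus" and eq: "\<And>x. lo i \<le> x \<Longrightarrow> x \<le> hi i \<Longrightarrow> t x = u x"
  shows "conj_bump t i = conj_bump u i"
proof -
  have "(t \<circ> fn i \<circ> finv t) x = (u \<circ> fn i \<circ> finv u) x" for x
  proof (cases "lo i < finv t x \<and> finv t x < hi i")
    case True
    then have "u (finv t x) = x" using eq[of "finv t x"] PL_simps(1)[OF t] by simp
    then have "finv u x = finv t x" using PL_simps(2)[OF u] by metis
    moreover have "lo i < fn i (finv t x) \<and> fn i (finv t x) < hi i" using is_bump_maps[OF i] True by blast
    ultimately show ?thesis using eq[of "fn i (finv t x)"] by simp
  next
    case False
    have "\<not> (lo i < finv u x \<and> finv u x < hi i)"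
    proof
      assume *: "lo i < finv u x \<and> finv u x < hi i"
      then have "t (finv u x) = x" using eq[of "finv u x"] PL_simps(1)[OF u] by simp
      then have "finv t x = finv u x" using PL_simps(2)[OF t] by metis
      then show False using * False by simp
    qed
    then show ?thesis using False is_bumpD(3)[OF i] PL_simps(1)[OF u] PL_simps(1)[OF t] by simp
  qed
  then show ?thesis using eq[of "lo i"] eq[of "hi i"] is_bumpD(4)[OF i] by (simp add: conj_bump_def fun_eq_iff)
qed

section \<open>Removing the top level of a bump system\<close>

context
  fixes Y n
  assumes Y: "bump_system Y" and lab_le: "\<And>i. i \<in> Y \<Longrightarrow> lab i \<le> n"
begin

definition "Top = {i \<in> Y. lab i = n}"
definition "Low = {i \<in> Y. lab i < n}"

lemma bump: "i \<in> Y \<Longrightarrow> is_bump i" and compat: "compatible Y"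
  using Y by (auto simp: bump_system_def)

lemma related:
  "i \<in> Y \<Longrightarrow> j \<in> Y \<Longrightarrow> apart i j \<or> i = j \<or> (inside i j \<and> lab i < lab j) \<or> (inside j i \<and> lab j < lab i)"
  and domain: "i \<in> Y \<Longrightarrow> j \<in> Y \<Longrightarrow> k \<in> Y \<Longrightarrow> inside i k \<Longrightarrow> inside j k \<Longrightarrow> hi i \<le> fn k (lo j)"
  using compat unfolding compatible_def by blast+

lemma Top_PL: "fn ` Top \<subseteq> PL_plus"
  using is_bumpD(1) bump unfolding Top_def by blast

lemma low_top: "i \<in> Low \<Longrightarrow> z \<in> Top \<Longrightarrow> apart i z \<or> inside i z"
  using related[of i z] unfolding Low_def Top_def by auto

lemma apart_fix:
  assumes "z \<in> Y" "apart i z" "lo i \<le> x" "x \<le> hi i" shows "fn z x = x"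
  using is_bumpD(3)[OF bump[OF assms(1)], of x] assms(2-4) unfolding apart_def by auto

text \<open>Distinct bumps with the common label \<open>n\<close> are apart, so on the interval of
  \<open>z\<close> every other generator is the identity.\<close>

lemma top_pow:
  assumes s: "s \<in> gens Top" and z: "z \<in> Top"
  shows "\<exists>k::int. \<forall>x. lo z \<le> x \<and> x \<le> hi z \<longrightarrow> s x = (fn z [^]\<^bsub>PL_group\<^esub> k) x"
proof -
  have zY: "z \<in> Y" using z by (simp add: Top_def)
  note zb = is_bumpD[OF bump[OF zY]]
  interpret PL: group PL_group by (rule group_PL)
  have zc: "fn z \<in> carrier PL_group" using zb(1) by (simp add: PL_group_simps)
  let ?p = "\<lambda>k::int. fn z [^]\<^bsub>PL_group\<^esub> k"
  have pc: "?p k \<in> PL_plus" for k using PL.int_pow_closed[OF zc, of k] by (simp add: PL_group_simps)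
  have pfix: "?p k (lo z) = lo z \<and> ?p k (hi z) = hi z" for k
  proof -
    have "subgroup {g \<in> PL_plus. g (lo z) = lo z \<and> g (hi z) = hi z} PL_group"
      unfolding subgroup_iff_plgroup plgroup_def
      using PL_plus_id PL_plus_inv PL_plus_comp PL_plus_plf incr_inv_fix PL_plusD(1,2) by auto
    then have "?p k \<in> {g \<in> PL_plus. g (lo z) = lo z \<and> g (hi z) = hi z}"
      by (rule PL.subgroup_int_pow_closed) (use zb orbD(2,3) in auto)
    then show ?thesis by blast
  qed
  have pI: "lo z \<le> ?p k x \<and> ?p k x \<le> hi z" if "lo z \<le> x" "x \<le> hi z" for k x
    using incr_le[OF PL_plusD(1,2)[OF pc[of k]]] pfix[of k] that by metis
  have padd: "?p j (?p k x) = ?p (k + j) x" for j k x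
    using PL.int_pow_mult[OF zc, of k j] by (simp add: PL_group_simps)
  have p0: "?p 0 x = x" for x by (simp add: PL_group_simps)
  show ?thesis
  proof (rule PL_generate_induct[OF Top_PL s, where P = "\<lambda>s. \<exists>k::int. \<forall>x. lo z \<le> x \<and> x \<le> hi z \<longrightarrow> s x = ?p k x"])
    show "\<exists>k::int. \<forall>x. lo z \<le> x \<and> x \<le> hi z \<longrightarrow> id x = ?p k x"
      by (rule exI[of _ 0]) (simp add: PL_group_simps)
  next
    fix f assume "f \<in> fn ` Top"
    then obtain j where j: "j \<in> Top" "f = fn j" by blast
    show "\<exists>k::int. \<forall>x. lo z \<le> x \<and> x \<le> hi z \<longrightarrow> f x = ?p k x"
    proof (cases "j = z")
      case True
      have "?p 1 = fn z" using PL.int_pow_1[OF zc] by simp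
      then show ?thesis using True j by (intro exI[of _ 1]) simp
    next
      case False
      then have "apart z j" using related[of z j] j z by (auto simp: Top_def)
      then show ?thesis using apart_fix[of j z] j by (intro exI[of _ 0]) (simp add: PL_group_simps Top_def)
    qed
  next
    fix f assume f: "f \<in> PL_plus" "\<exists>k::int. \<forall>x. lo z \<le> x \<and> x \<le> hi z \<longrightarrow> f x = ?p k x"
    then obtain k where k: "\<And>x. lo z \<le> x \<Longrightarrow> x \<le> hi z \<Longrightarrow> f x = ?p k x" by blast
    have "finv f x = ?p (- k) x" if x: "lo z \<le> x" "x \<le> hi z" for x
    proof -
      have "f (?p (- k) x) = x" using k[of "?p (- k) x"] pI[OF x] padd[of k "- k" x] p0 by simp
      then show ?thesis using PL_simps(2)[OF f(1)] by metis
    qed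
    then show "\<exists>k::int. \<forall>x. lo z \<le> x \<and> x \<le> hi z \<longrightarrow> finv f x = ?p k x" by blast
  next
    fix f g assume "\<exists>k::int. \<forall>x. lo z \<le> x \<and> x \<le> hi z \<longrightarrow> f x = ?p k x"
      "\<exists>k::int. \<forall>x. lo z \<le> x \<and> x \<le> hi z \<longrightarrow> g x = ?p k x"
    then obtain j k where jk: "\<And>x. lo z \<le> x \<Longrightarrow> x \<le> hi z \<Longrightarrow> f x = ?p j x"
      "\<And>x. lo z \<le> x \<Longrightarrow> x \<le> hi z \<Longrightarrow> g x = ?p k x" by blast
    have "(f \<circ> g) x = ?p (k + j) x" if "lo z \<le> x" "x \<le> hi z" for x
      using jk pI that padd by simp
    then show "\<exists>k::int. \<forall>x. lo z \<le> x \<and> x \<le> hi z \<longrightarrow> (f \<circ> g) x = ?p k x" by blast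
  qed
qed

lemma pow_ge:
  fixes m :: nat
  assumes z: "z \<in> Y" and right: "\<And>x. lo z \<le> x \<Longrightarrow> x \<le> hi z \<Longrightarrow> x \<le> fn z x" and x: "lo z \<le> x" "x \<le> hi z"
  shows "x \<le> (fn z [^]\<^bsub>PL_group\<^esub> m) x \<and> (fn z [^]\<^bsub>PL_group\<^esub> m) x \<le> hi z \<and>
    fn z x \<le> (fn z [^]\<^bsub>PL_group\<^esub> Suc m) x"
proof (induction m)
  case 0
  then show ?case using x by (simp add: PL_group_simps)
next
  case (Suc m)
  note zb = is_bumpD[OF bump[OF z]]
  let ?y = "(fn z [^]\<^bsub>PL_group\<^esub> Suc m) x"
  have step: "(fn z [^]\<^bsub>PL_group\<^esub> Suc k) x = fn z ((fn z [^]\<^bsub>PL_group\<^esub> k) x)" for k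
    by (simp add: PL_group_simps)
  have y: "x \<le> ?y" using Suc right[OF x] by linarith
  have "?y \<le> hi z"
    using Suc incr_le[OF PL_plusD(1,2)[OF zb(1)], of "(fn z [^]\<^bsub>PL_group\<^esub> m) x" "hi z"] orbD(3)[OF zb(2)]
    unfolding step[of m] by simp
  moreover have "fn z x \<le> fn z ?y" using y incr_le[OF PL_plusD(1,2)[OF zb(1)]] by simp
  ultimately show ?case using y unfolding step[of "Suc m"] by blast
qed

text \<open>If no top bump encloses \<open>i\<close>, nothing happens on it. Otherwise
  \<open>s\<close> acts there as a power of one \<open>fn z\<close>, and a nonzero power moves the
  fundamental domain holding all bumps inside \<open>z\<close> off itself.\<close>

lemma low_dichotomy:
  assumes s: "s \<in> gens Top" and i: "i \<in> Low" and j: "j \<in> Low"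
  shows "(\<forall>x. lo i \<le> x \<and> x \<le> hi i \<longrightarrow> s x = x) \<or> s (hi i) \<le> lo j \<or> hi j \<le> s (lo i)"
proof (cases "\<exists>z\<in>Top. inside i z")
  case False
  have "s x = x" if "lo i \<le> x" "x \<le> hi i" for x
  proof (rule generate_fixes[OF Top_PL _ s])
    fix g assume "g \<in> fn ` Top"
    then obtain z where z: "z \<in> Top" "g = fn z" by blast
    then have "apart i z" using low_top[OF i] False by blast
    then show "g x = x" using apart_fix[of z i x] that z by (simp add: Top_def)
  qed
  then show ?thesis by blast
next
  case True
  then obtain z where z: "z \<in> Top" "inside i z" by blast
  have Yz: "z \<in> Y" "i \<in> Y" "j \<in> Y" using z i j by (auto simp: Top_def Low_def)
  note zb = is_bumpD[OF bump[OF Yz(1)]] and ib = is_bumpD[OF bump[OF Yz(2)]]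
  note zi = PL_plusD(1,2)[OF zb(1)]
  have iz: "lo z < lo i" "hi i < hi z" "lo i < hi i" using z(2) ib(4) by (auto simp: inside_def)
  \<comment> \<open>The domain condition with \<open>j = i\<close> gives
    \<open>hi i \<le> fn z (lo i)\<close>; so it also forces a bump that encloses others to move
    points to the right.\<close>
  have "lo i < fn z (lo i)" using domain[OF Yz(2,2,1) z(2,2)] iz by linarith
  then have "\<forall>x. lo z < x \<and> x < hi z \<longrightarrow> x < fn z x"
    using incr_orb_cases[OF zi zb(2)] iz by (elim disjE) (force, meson less_asym less_trans)
  then have right: "x \<le> fn z x" if "lo z \<le> x" "x \<le> hi z" for x
    using that orbD(2,3)[OF zb(2)] by (metis order.order_iff_strict)
  obtain k :: int where k: "\<And>x. lo z \<le> x \<Longrightarrow> x \<le> hi z \<Longrightarrow> s x = (fn z [^]\<^bsub>PL_group\<^esub> k) x"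
    using top_pow[OF s z(1)] by blast
  interpret PL: group PL_group by (rule group_PL)
  have zc: "fn z \<in> carrier PL_group" using zb(1) by (simp add: PL_group_simps)
  have sPL: "s \<in> PL_plus" using PL_subgroupD(2)[OF PL_generate_subgroup[OF Top_PL] s] .
  note si = PL_plusD(1,2)[OF sPL]
  have sfix: "s (lo z) = lo z" "s (hi z) = hi z"
  proof -
    have "g (lo z) = lo z \<and> g (hi z) = hi z" if "g \<in> fn ` Top" for g
    proof -
      obtain j where j: "j \<in> Top" "g = fn j" using \<open>g \<in> fn ` Top\<close> by blast
      show ?thesis
      proof (cases "j = z")
        case True then show ?thesis using j orbD(2,3)[OF zb(2)] by simp
      next
        case False
        then have "apart z j" using related[of z j] j z by (auto simp: Top_def)
        then show ?thesis using apart_fix[of j z] j zb(4) by (simp add: Top_def)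
      qed
    qed
    then show "s (lo z) = lo z" "s (hi z) = hi z" using generate_fixes[OF Top_PL _ s] by blast+
  qed
  have sz: "lo z \<le> s (lo i)" "s (hi i) \<le> hi z"
    using incr_le[OF si, of "lo z" "lo i"] incr_le[OF si, of "hi i" "hi z"] sfix iz by auto
  consider "k = 0" | m where "k = int (Suc m)" | m where "k = - int (Suc m)"
    by (metis int_cases nonneg_int_cases not_le of_nat_0 neg_0_le_iff_le not0_implies_Suc)
  then show ?thesis
  proof cases
    case 1
    then have "s x = x" if "lo i \<le> x" "x \<le> hi i" for x using k[of x] that iz by (simp add: PL_group_simps)
    then show ?thesis by blast
  next
    case 2
    have "fn z (lo i) \<le> s (lo i)"
      using pow_ge[OF Yz(1) right, of "lo i" m] k[of "lo i"] iz unfolding 2 int_pow_int by simp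
    then show ?thesis
      using low_top[OF j z(1)] domain[OF Yz(3,2,1) _ z(2)] sz by (auto simp: apart_def)
  next
    case 3
    \<comment> \<open>For negative powers the comparison runs backwards: \<open>fn z w\<close> is at
      most \<open>hi i\<close>, hence at most \<open>fn z (lo j)\<close>, so \<open>w\<close> is at
      most \<open>lo j\<close>.\<close>
    define w where "w = s (hi i)"
    have w: "lo z \<le> w" "w \<le> hi z" unfolding w_def
      using sz incr_less[OF si, of "lo i" "hi i"] iz by auto
    have "(fn z [^]\<^bsub>PL_group\<^esub> int (Suc m)) w = hi i"
    proof -
      have "fn z [^]\<^bsub>PL_group\<^esub> k \<otimes>\<^bsub>PL_group\<^esub> fn z [^]\<^bsub>PL_group\<^esub> int (Suc m) = \<one>\<^bsub>PL_group\<^esub>"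
        using PL.int_pow_mult[OF zc, of k "int (Suc m)"] 3 by simp
      moreover have "w = (fn z [^]\<^bsub>PL_group\<^esub> k) (hi i)" unfolding w_def using k[of "hi i"] iz by simp
      ultimately show ?thesis by (simp add: PL_group_simps fun_eq_iff)
    qed
    then have "fn z w \<le> hi i" using pow_ge[OF Yz(1) right w, of m] unfolding int_pow_int by simp
    moreover have "hi i \<le> fn z (lo j)" if "inside j z" by (rule domain[OF Yz(2,3,1) z(2) that])
    ultimately have "w \<le> lo j" if "inside j z" using that incr_le[OF zi, of w "lo j"] by simp
    then show ?thesis using low_top[OF j z(1)] sz unfolding w_def[symmetric] by (auto simp: apart_def)
  qed
qed

text \<open>These conjugates generate a subgroup normalized by all of \<open>Y\<close>. There are
  infinitely many of them in general, which is why \<open>bump_system\<close> does not ask for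
  finiteness.\<close>

definition "Conj = (\<Union>t\<in>gens Top. conj_bump t ` Low)"

lemma Top_sub: "subgroup (gens Top) PL_group"
  by (rule PL_generate_subgroup[OF Top_PL])

text \<open>Two conjugates that are not apart can be written with the same conjugating element
  \<open>u\<close>, which reduces their mutual position to that of \<open>i\<close> and
  \<open>j\<close>.\<close>

lemma conj_overlap:
  assumes "t \<in> gens Top" "u \<in> gens Top" "i \<in> Low" "j \<in> Low"
  shows "apart (conj_bump t i) (conj_bump u j) \<or> conj_bump t i = conj_bump u i"
proof -
  have tu: "t \<in> PL_plus" "u \<in> PL_plus" using PL_subgroupD(2)[OF Top_sub] assms(1,2) by auto
  note ti = PL_plusD(1,2)[OF tu(1)] and ui = PL_plusD(1,2)[OF tu(2)]
  define s where "s = finv u \<circ> t"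
  have s: "s \<in> gens Top" unfolding s_def using PL_mult_closed[OF Top_sub] assms(1,2) by blast
  have us: "u (s x) = t x" for x by (simp add: s_def PL_simps[OF tu(2)])
  have ib: "is_bump i" using bump assms(3) by (simp add: Low_def)
  show ?thesis using low_dichotomy[OF s assms(3,4)]
  proof (elim disjE)
    assume *: "\<forall>x. lo i \<le> x \<and> x \<le> hi i \<longrightarrow> s x = x"
    have "conj_bump t i = conj_bump u i"
      by (rule conj_bump_eq[OF ib tu]) (use * us in metis)
    then show ?thesis by blast
  next
    assume "s (hi i) \<le> lo j"
    then have "t (hi i) \<le> u (lo j)" using incr_le[OF ui, of "s (hi i)" "lo j"] us by simp
    then show ?thesis by (simp add: apart_def)
  next
    assume "hi j \<le> s (lo i)"
    then have "u (hi j) \<le> t (lo i)" using incr_le[OF ui, of "hi j" "s (lo i)"] us by simp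
    then show ?thesis by (simp add: apart_def)
  qed
qed

lemma conj_related:
  assumes "u \<in> PL_plus"
  shows "apart (conj_bump u i) (conj_bump u j) \<longleftrightarrow> apart i j"
    "inside (conj_bump u i) (conj_bump u j) \<longleftrightarrow> inside i j"
  using incr_le[OF PL_plusD(1,2)[OF assms]] incr_less[OF PL_plusD(1,2)[OF assms]]
  by (simp_all add: apart_def inside_def)

lemma Conj_system: "bump_system Conj"
  unfolding bump_system_def compatible_def
proof (intro conjI ballI impI)
  fix i' assume "i' \<in> Conj"
  then obtain t i where ti: "t \<in> gens Top" "i \<in> Low" "i' = conj_bump t i" by (auto simp: Conj_def)
  have tp: "t \<in> PL_plus" and ib: "is_bump i" using PL_subgroupD(2)[OF Top_sub] ti bump by (auto simp: Low_def)
  show "is_bump i'" using is_bump_conj[OF ib tp] ti by simp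
  fix j' assume "j' \<in> Conj"
  then obtain u j where uj: "u \<in> gens Top" "j \<in> Low" "j' = conj_bump u j" by (auto simp: Conj_def)
  have up: "u \<in> PL_plus" and jb: "is_bump j" using PL_subgroupD(2)[OF Top_sub] uj bump by (auto simp: Low_def)
  have YY: "i \<in> Y" "j \<in> Y" using ti uj by (auto simp: Low_def)
  show "apart i' j' \<or> i' = j' \<or> inside i' j' \<and> lab i' < lab j' \<or> inside j' i' \<and> lab j' < lab i'"
  proof (cases "apart i' j'")
    case False
    then have "i' = conj_bump u i" using conj_overlap[OF ti(1) uj(1) ti(2) uj(2)] ti uj by blast
    then show ?thesis using related[OF YY] conj_related[OF up] uj by auto
  qed simp
  fix k' assume "k' \<in> Conj"
  then obtain v k where vk: "v \<in> gens Top" "k \<in> Low" "k' = conj_bump v k" by (auto simp: Conj_def)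
  have vp: "v \<in> PL_plus" and kY: "k \<in> Y" using PL_subgroupD(2)[OF Top_sub] vk by (auto simp: Low_def)
  assume ins: "inside i' k' \<and> inside j' k'"
  have "lo i' < hi i'" "lo j' < hi j'"
    using ti uj is_bumpD(4)[OF is_bump_conj[OF ib tp]] is_bumpD(4)[OF is_bump_conj[OF jb up]] by simp_all
  then have "\<not> apart i' k'" "\<not> apart j' k'" using ins by (auto simp: apart_def inside_def)
  \<comment> \<open>All three bumps are conjugates by \<open>v\<close>, so the domain condition is
    the image under \<open>v\<close> of the one in \<open>Y\<close>.\<close>
  then have e: "i' = conj_bump v i" "j' = conj_bump v j"
    using conj_overlap[OF ti(1) vk(1) ti(2) vk(2)] conj_overlap[OF uj(1) vk(1) uj(2) vk(2)] ti uj vk by auto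
  then have "inside i k" "inside j k" using ins conj_related[OF vp] vk by auto
  then have "hi i \<le> fn k (lo j)" using domain[OF YY(1,2) kY] by blast
  then show "hi i' \<le> fn k' (lo j')"
    unfolding e vk(3) using incr_le[OF PL_plusD(1,2)[OF vp]] by (simp add: PL_simps[OF vp])
qed

lemma Conj_lab: "i \<in> Conj \<Longrightarrow> lab i < n"
  by (auto simp: Conj_def Low_def)

lemma Conj_PL: "fn ` Conj \<subseteq> PL_plus"
  using Conj_system is_bumpD(1) by (auto simp: bump_system_def)

lemma Conj_sub: "subgroup (gens Conj) PL_group"
  by (rule PL_generate_subgroup[OF Conj_PL])

lemma low_in_Conj:
  assumes "i \<in> Low" shows "fn i \<in> gens Conj"
proof -
  have "id \<in> gens Top" by (rule PL_mult_closed(3)[OF Top_sub])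
  then have "conj_bump id i \<in> Conj" using assms unfolding Conj_def by blast
  moreover have "fn (conj_bump id i) = fn i" by (simp only: conj_bump_simps inv_id id_comp comp_id)
  ultimately show ?thesis by (metis generate.incl image_eqI)
qed

lemma top_normalizes:
  assumes t: "t \<in> gens Top" and x: "x \<in> gens Conj"
  shows "t \<circ> x \<circ> finv t \<in> gens Conj"
proof -
  have tp: "t \<in> PL_plus" using PL_subgroupD(2)[OF Top_sub t] .
  note tinv = PL_simps[OF tp]
  show ?thesis
  proof (rule PL_generate_induct[OF Conj_PL x, where P = "\<lambda>x. t \<circ> x \<circ> finv t \<in> gens Conj"])
    have "t \<circ> id \<circ> finv t = id" by (simp add: fun_eq_iff tinv)
    then show "t \<circ> id \<circ> finv t \<in> gens Conj" using PL_mult_closed(3)[OF Conj_sub] by simp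
  next
    fix x assume "x \<in> fn ` Conj"
    then obtain u i where u: "u \<in> gens Top" "i \<in> Low" "x = fn (conj_bump u i)" unfolding Conj_def by blast
    have up: "u \<in> PL_plus" using PL_subgroupD(2)[OF Top_sub u(1)] .
    have e: "finv (t \<circ> u) = finv u \<circ> finv t" using incr_inv_comp PL_plusD(1,2) tp up by blast
    have "t \<circ> u \<in> gens Top" using PL_mult_closed(1)[OF Top_sub t u(1)] .
    then have "conj_bump (t \<circ> u) i \<in> Conj" using u(2) unfolding Conj_def by blast
    moreover have "fn (conj_bump (t \<circ> u) i) = t \<circ> x \<circ> finv t" by (simp add: u(3) e comp_assoc)
    ultimately show "t \<circ> x \<circ> finv t \<in> gens Conj" by (metis generate.incl image_eqI)
  next
    fix f assume f: "f \<in> PL_plus" "t \<circ> f \<circ> finv t \<in> gens Conj"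
    have "finv (t \<circ> f \<circ> finv t) = t \<circ> finv f \<circ> finv t"
      by (rule inv_equality) (simp_all add: tinv PL_simps[OF f(1)])
    then show "t \<circ> finv f \<circ> finv t \<in> gens Conj" using PL_mult_closed(2)[OF Conj_sub f(2)] by simp
  next
    fix f g assume fg: "t \<circ> f \<circ> finv t \<in> gens Conj" "t \<circ> g \<circ> finv t \<in> gens Conj"
    have "(t \<circ> f \<circ> finv t) \<circ> (t \<circ> g \<circ> finv t) = t \<circ> (f \<circ> g) \<circ> finv t" by (simp add: fun_eq_iff tinv)
    then show "t \<circ> (f \<circ> g) \<circ> finv t \<in> gens Conj" using PL_mult_closed(1)[OF Conj_sub fg] by simp
  qed
qed

lemma Y_normalizes:
  assumes u: "u \<in> fn ` Y" and x: "x \<in> gens Conj"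
  shows "u \<circ> x \<circ> finv u \<in> gens Conj \<and> finv u \<circ> x \<circ> u \<in> gens Conj"
proof -
  obtain i where i: "i \<in> Y" "u = fn i" using u by blast
  have up: "u \<in> PL_plus" using i is_bumpD(1)[OF bump] by blast
  have "i \<in> Low \<or> i \<in> Top" using lab_le[OF i(1)] i(1) by (auto simp: Low_def Top_def)
  then show ?thesis
  proof
    assume "i \<in> Low"
    then have "u \<in> gens Conj" using low_in_Conj i by simp
    then show ?thesis using x by (intro conjI PL_mult_closed[OF Conj_sub])
  next
    assume "i \<in> Top"
    then have "u \<in> gens Top" using i by (auto intro: generate.incl)
    then show ?thesis
      using top_normalizes[OF _ x, of u] top_normalizes[OF _ x, of "finv u"] PL_mult_closed(2)[OF Top_sub] PL_simps(3)[OF up] by auto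
  qed
qed

lemma top_commute:
  assumes "i \<in> Top" "j \<in> Top" shows "fn i (fn j x) = fn j (fn i x)"
proof (cases "i = j")
  case False
  have ij: "i \<in> Y" "j \<in> Y" using assms by (auto simp: Top_def)
  have ap: "apart i j" using related[OF ij] False assms by (auto simp: Top_def)
  note ib = bump[OF ij(1)] and jb = bump[OF ij(2)]
  show ?thesis
  proof (cases "lo i < x \<and> x < hi i")
    case True
    then have "lo i < fn i x \<and> fn i x < hi i" using is_bump_maps[OF ib] by simp
    then have "\<not> (lo j < x \<and> x < hi j)" "\<not> (lo j < fn i x \<and> fn i x < hi j)" using True ap by (auto simp: apart_def)
    then show ?thesis using is_bumpD(3)[OF jb] by simp
  next
    case False
    have "\<not> (lo i < fn j x \<and> fn j x < hi i)"
    proof (cases "lo j < x \<and> x < hi j")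
      case True
      then have "lo j < fn j x \<and> fn j x < hi j" using is_bump_maps[OF jb] by simp
      then show ?thesis using ap by (auto simp: apart_def)
    next
      case False
      then show ?thesis using is_bumpD(3)[OF jb] \<open>\<not> (lo i < x \<and> x < hi i)\<close> by simp
    qed
    then show ?thesis using False is_bumpD(3)[OF ib] by simp
  qed
qed simp

text \<open>Modulo \<open>gens Conj\<close> only the top bumps survive, and these commute because
  they are pairwise apart.\<close>

lemma derived_Conj: "derived PL_group (gens Y) \<subseteq> gens Conj"
proof (rule derived_generate_sub[OF _ Conj_sub Y_normalizes])
  show Yp: "fn ` Y \<subseteq> PL_plus" using bump is_bumpD(1) by blast
  fix u v assume uv: "u \<in> fn ` Y" "v \<in> fn ` Y"
  then obtain i j where i: "i \<in> Y" "u = fn i" and j: "j \<in> Y" "v = fn j" by blast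
  have up: "u \<in> PL_plus" "v \<in> PL_plus" using uv Yp by auto
  note ui = PL_simps[OF up(1)] and vi = PL_simps[OF up(2)]
  have "i \<in> Low \<or> j \<in> Low \<or> (i \<in> Top \<and> j \<in> Top)"
    using lab_le[OF i(1)] lab_le[OF j(1)] i(1) j(1) by (auto simp: Low_def Top_def)
  then show "finv v \<circ> finv u \<circ> v \<circ> u \<in> gens Conj"
  proof (elim disjE conjE)
    assume "i \<in> Low"
    then have u: "u \<in> gens Conj" using low_in_Conj i by simp
    then have "finv v \<circ> finv u \<circ> v \<in> gens Conj" using Y_normalizes[OF uv(2)] PL_mult_closed(2)[OF Conj_sub] by blast
    then show ?thesis using PL_mult_closed(1)[OF Conj_sub _ u] by blast
  next
    assume "j \<in> Low"
    then have v: "v \<in> gens Conj" using low_in_Conj j by simp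
    then have "finv v \<circ> (finv u \<circ> v \<circ> u) \<in> gens Conj"
      using Y_normalizes[OF uv(1)] PL_mult_closed(1,2)[OF Conj_sub] by blast
    then show ?thesis by (simp only: comp_assoc)
  next
    assume "i \<in> Top" "j \<in> Top"
    then have "v (u x) = u (v x)" for x using top_commute[of i j x] i j by simp
    then have "finv v \<circ> finv u \<circ> v \<circ> u = id" by (simp add: fun_eq_iff ui vi)
    then show ?thesis using PL_mult_closed(3)[OF Conj_sub] by simp
  qed
qed

end

text \<open>Each derivation leads into the group of a system whose labels have a bound smaller by
  one.\<close>

theorem bump_system_derived:
  assumes "bump_system Y" "\<And>i. i \<in> Y \<Longrightarrow> lab i < n"
  shows "(derived PL_group ^^ n) (gens Y) = {id}"
  using assms
proof (induction n arbitrary: Y)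
  case 0
  then have "Y = {}" by auto
  then have "gens Y = {\<one>\<^bsub>PL_group\<^esub>}" using group.generate_empty[OF group_PL] by simp
  then show ?case by (simp only: PL_group_simps funpow_0)
next
  case (Suc n)
  have le: "\<And>i. i \<in> Y \<Longrightarrow> lab i \<le> n" using Suc.prems(2) by (simp add: less_Suc_eq_le)
  let ?C = "Conj Y n"
  have "is_bump i" if "i \<in> Y" for i using Suc.prems(1) that by (simp add: bump_system_def)
  then have PL: "fn ` Y \<subseteq> PL_plus" using is_bumpD(1) by blast
  have "(derived PL_group ^^ n) (derived PL_group (gens Y)) \<subseteq> (derived PL_group ^^ n) (gens ?C)"
    by (rule group.mono_exp_of_derived[OF group_PL derived_Conj[OF Suc.prems(1) le]])
  also have "\<dots> = {id}" by (rule Suc.IH[OF Conj_system[OF Suc.prems(1) le] Conj_lab[OF Suc.prems(1) le]])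
  finally have "(derived PL_group ^^ Suc n) (gens Y) \<subseteq> {id}" by (simp only: funpow_Suc_right o_apply)
  moreover have "id \<in> (derived PL_group ^^ Suc n) (gens Y)"
    using subgroup.one_closed[OF group.exp_of_derived_is_subgroup[OF group_PL PL_generate_subgroup[OF PL], of "Suc n"]]
    by (simp only: PL_group_simps)
  ultimately show ?case by blast
qed


section \<open>Existence of bump systems\<close>

lemma clip_comp:
  assumes "strict_mono g" "surj g" "g a = a" "g b = b"
  shows "clip a b (f \<circ> g) = clip a b f \<circ> clip a b g"
proof -
  have "a < g x \<and> g x < b \<longleftrightarrow> a < x \<and> x < b" for x
    using incr_less[OF assms(1,2)] assms(3,4) by metis
  then show ?thesis by (auto simp: clip_def fun_eq_iff)
qed

lemma clip_PL_inv:
  assumes "g \<in> PL_plus" "g a = a" "g b = b"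
  shows "clip a b (finv g) = finv (clip a b g)"
proof -
  note gi = PL_plusD(1,2)[OF assms(1)]
  have m: "a < g x \<longleftrightarrow> a < x" "g x < b \<longleftrightarrow> x < b" "a < finv g x \<longleftrightarrow> a < x" "finv g x < b \<longleftrightarrow> x < b" for x
    using incr_less[OF gi] assms(2,3) incr_inv(1)[OF gi] by metis+
  show ?thesis
    by (rule inv_equality[symmetric]) (auto simp: clip_def m incr_inv[OF gi])
qed

lemma clip_split:
  assumes "strict_mono y" "surj y" "y c = c" "a \<le> c" "c \<le> d" "y d = d"
  shows "clip a d y = clip a c y \<circ> clip c d y"
proof
  fix x
  have "c < y x \<longleftrightarrow> c < x" using incr_less[OF assms(1,2), of c x] assms(3) by simp
  moreover have "y x < d \<longleftrightarrow> x < d" using incr_less[OF assms(1,2), of x d] assms(6) by simp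
  ultimately show "clip a d y x = (clip a c y \<circ> clip c d y) x"
    using assms(3-5) by (cases x c rule: linorder_cases) (auto simp: clip_def)
qed

lemma clip_conj:
  assumes "strict_mono h" "surj h"
  shows "clip (h q) (h r) (h \<circ> y \<circ> finv h) = h \<circ> clip q r y \<circ> finv h"
proof
  fix x
  have "h q < x \<longleftrightarrow> q < finv h x" "x < h r \<longleftrightarrow> finv h x < r"
    using incr_less[OF assms] incr_inv(1)[OF assms] by metis+
  then show "clip (h q) (h r) (h \<circ> y \<circ> finv h) x = (h \<circ> clip q r y \<circ> finv h) x"
    by (auto simp: clip_def incr_inv[OF assms])
qed

lemma clip_triv: "(\<And>x. a < x \<Longrightarrow> x < b \<Longrightarrow> y x = x) \<Longrightarrow> clip a b y = id"
  by (auto simp: clip_def fun_eq_iff)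

text \<open>Makes labels exact: a bump with label \<open>m\<close> has bumps of all smaller labels
  nested below it, which yields the lower bound on the derived length.\<close>

definition linked :: "bump set \<Rightarrow> bool" where
  "linked Y \<longleftrightarrow> (\<forall>i\<in>Y. \<forall>m. lab i = Suc m \<longrightarrow> (\<exists>j\<in>Y. inside j i \<and> lab j = m))"

text \<open>Bumps are cut from elements of \<open>H\<close> itself. Their orbitals then form towers
  in \<open>H\<close>, and for a group of elements of \<open>C\<close> the factors lie in the split
  group, where they can be computed with.\<close>

definition bumps_of :: "(real \<Rightarrow> real) set \<Rightarrow> real \<Rightarrow> real \<Rightarrow> bump set" where
  "bumps_of H s t = {i. s \<le> lo i \<and> hi i \<le> t \<and> (\<exists>w\<in>H. orb w (lo i) (hi i) \<and> fn i = clip (lo i) (hi i) w)}"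

definition resolves :: "bump set \<Rightarrow> (real \<Rightarrow> real) set \<Rightarrow> real \<Rightarrow> real \<Rightarrow> bool" where
  "resolves Y X s t \<longleftrightarrow> finite Y \<and> bump_system Y \<and> linked Y \<and> Y \<subseteq> bumps_of (generate PL_group X) s t \<and>
     (\<forall>x\<in>X. clip s t x \<in> gens Y)"

lemma bump_system_PL: "bump_system Y \<Longrightarrow> fn ` Y \<subseteq> PL_plus"
proof -
  assume "bump_system Y"
  then have "is_bump i" if "i \<in> Y" for i using that by (simp add: bump_system_def)
  then show ?thesis using is_bumpD(1) by blast
qed

lemma is_bump_clip:
  assumes "w \<in> PL_plus" "orb w a b" shows "is_bump (l, (a, b), clip a b w)"
proof -
  have "clip a b w \<in> PL_plus" using PL_plus_clip[OF assms(1)] orbD(2,3)[OF assms(2)] PL_orb_unit[OF assms] by blast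
  moreover have "orb (clip a b w) a b" using assms(2) unfolding orb_def clip_def by auto
  ultimately show ?thesis by (auto simp: is_bump_def clip_def)
qed

text \<open>Each generator is a power of \<open>t\<close> times an element of slope one at
  \<open>a\<close>. The latter is trivial near both ends and fixes all translates of
  \<open>q\<close> under \<open>t\<close>, so it splits into pieces between consecutive translates.
  Pulling the pieces back by powers of \<open>t\<close> gives finitely many elements to be cut to
  \<open>(q, t q)\<close>. The group \<open>K\<close> stands for the one generated by the bumps,
  which are not yet known.\<close>

lemma resolve_orbital_core:
  assumes X: "finite X" "X \<subseteq> PL_plus" and nc: "\<not> has_chain (generate PL_group X)"
    and ab: "\<And>x. x \<in> X \<Longrightarrow> x a = a" "\<And>x. x \<in> X \<Longrightarrow> x b = b"
    and x0: "x0 \<in> X" "orb x0 a b"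
  shows "\<exists>t q Z. t \<in> generate PL_group X \<and> orb t a b \<and> a < q \<and> t q < b \<and> q < t q \<and>
    finite Z \<and> Z \<subseteq> generate PL_group X \<and> (\<forall>x\<in>Z. x q = q \<and> x (t q) = t q) \<and>
    (\<forall>K. subgroup K PL_group \<and> clip a b t \<in> K \<and> (\<forall>z\<in>Z. clip q (t q) z \<in> K) \<longrightarrow> (\<forall>x\<in>X. clip a b x \<in> K))"
proof -
  let ?H = "generate PL_group X"
  have H: "subgroup ?H PL_group" by (rule PL_generate_subgroup[OF X(2)])
  note Hp = PL_subgroupD(1)[OF H] and Hm = PL_mult_closed[OF H]
  have fixH: "h a = a" "h b = b" if "h \<in> ?H" for h
    by (rule generate_fixes[OF X(2) _ that], erule ab)+
  have x0H: "x0 \<in> ?H" using x0(1) by (rule generate.incl)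
  obtain g where g: "g \<in> ?H" "orb g a b" "\<forall>x. a < x \<and> x < b \<longrightarrow> x < g x" using orb_oriented[OF Hp x0H x0(2)] by blast
  note gi = H_incr(1,2)[OF Hp g(1)]
  define f where "f = finv g"
  have f: "f \<in> ?H" "orb f a b" unfolding f_def using Hm(2)[OF g(1)] incr_orb_inv[OF gi g(2)] by auto
  have left: "f x < x" if "a < x" "x < b" for x
    using g(3) that incr_less[OF gi] incr_inv(1)[OF gi] orbD(2,3)[OF g(2)] unfolding f_def by metis
  have "a < b" using orbD(1)[OF x0(2)] .
  obtain t where t: "t \<in> ?H" "1 < slope 1 t a" "\<And>h. h \<in> ?H \<Longrightarrow> \<exists>k::int. slope 1 h a = slope 1 t a powi k"
    by (rule ex_slope_generator[OF Hp nc _ _ f]) (use fixH left in blast)+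
  obtain p where p: "a < p" "p < b" "\<And>k. k \<in> ?H \<Longrightarrow> slope 1 k a = 1 \<Longrightarrow> k p = p"
    by (rule ex_kernel_fixpoint[OF Hp nc _ _ f]) (use fixH left in blast)+
  have tp: "t \<in> PL_plus" using PL_subgroupD(2)[OF H t(1)] .
  note ti = PL_plusD(1,2)[OF tp] and tinv = PL_simps[OF tp]
  have ta: "t a = a" "t b = b" using fixH t(1) by auto
  have to: "orb t a b"
  proof -
    obtain c where c: "orb t a c" using orb_starting_at[OF PL_plus_plf[OF tp] ta(1)] t(2) by auto
    then show ?thesis using orb_eq_left[OF Hp nc t(1) c f] by simp
  qed
  have tr: "x < t x" if "a < x" "x < b" for x
    using incr_orb_cases[OF ti to] slope_lt_1_if_moves_left[OF PL_plus_plf[OF tp] to] t(2) that by auto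
  have slope_pos: "slope 1 h a > 0" if "h \<in> ?H" for h by (rule germ_slope(2)[OF H_incr(3)[OF Hp that]]) simp
  have slope_mult: "slope 1 (h \<circ> k) a = slope 1 h a * slope 1 k a" if "h \<in> ?H" "k \<in> ?H" for h k
    using slope_comp[OF H_incr(3)[OF Hp that(1)] H_incr(3)[OF Hp that(2)], of 1 a] fixH(1)[OF that(2)] by simp
  have slope_finv: "slope 1 (finv h) a = 1 / slope 1 h a" if "h \<in> ?H" for h
    using slope_inv[OF H_incr(3)[OF Hp that], of 1 a] fixH(1)[OF that] by simp
  have Gt: "subgroup (generate PL_group {t}) PL_group" using tp by (intro PL_generate_subgroup) simp
  have GtH: "generate PL_group {t} \<subseteq> ?H" by (rule PL_generate_least[OF H]) (use t in simp)
  have tG: "t ^^ n \<in> generate PL_group {t}" for n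
    by (rule plgroup_funpow[OF PL_subgroupD(1)[OF Gt]]) (auto intro: generate.incl)
  have "\<exists>w\<in>generate PL_group {t}. slope 1 w a = slope 1 t a powi k" for k :: int
  proof -
    have nat: "slope 1 (t ^^ n) a = slope 1 t a ^ n" for n by (rule slope_funpow(1)[OF Hp t(1) ta(1)]) simp
    show ?thesis
    proof (cases "0 \<le> k")
      case True
      then show ?thesis using nat[of "nat k"] tG[of "nat k"] by (intro bexI[of _ "t ^^ nat k"]) (simp_all add: power_int_def)
    next
      case False
      have "t ^^ nat (- k) \<in> ?H" using tG GtH by blast
      then have "slope 1 (finv (t ^^ nat (- k))) a = slope 1 t a powi k"
        using slope_finv[of "t ^^ nat (- k)"] nat[of "nat (- k)"] False by (simp add: power_int_def field_simps)
      then show ?thesis using PL_mult_closed(2)[OF Gt tG] by blast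
    qed
  qed
  then have "\<forall>x\<in>X. \<exists>w\<in>generate PL_group {t}. slope 1 w a = slope 1 x a"
    using t(3) by (metis generate.incl)
  then obtain w where w: "\<And>x. x \<in> X \<Longrightarrow> w x \<in> generate PL_group {t}" "\<And>x. x \<in> X \<Longrightarrow> slope 1 (w x) a = slope 1 x a"
    by metis
  \<comment> \<open>The slope-one part of \<open>x\<close>; it is trivial near \<open>a\<close> by
    its slope and near \<open>b\<close> because no orbital may end there.\<close>
  define y where "y = (\<lambda>x. finv (w x) \<circ> x)"
  have XH: "x \<in> ?H" if "x \<in> X" for x using that by (rule generate.incl)
  have wH: "w x \<in> ?H" if "x \<in> X" for x using w(1)[OF that] GtH by blast
  have yH: "y x \<in> ?H" if "x \<in> X" for x unfolding y_def using Hm XH wH that by blast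
  have ys: "slope 1 (y x) a = 1" if "x \<in> X" for x
    unfolding y_def using slope_mult[OF Hm(2)[OF wH[OF that]] XH[OF that]] slope_finv[OF wH[OF that]] w(2)[OF that] slope_pos[OF XH[OF that]]
    by simp
  have near_a: "\<exists>e>0. \<forall>z. a \<le> z \<and> z \<le> a + e \<longrightarrow> y x z = z" if x: "x \<in> X" for x
  proof -
    obtain e where "e > 0" "\<And>z. a \<le> z \<Longrightarrow> z \<le> a + e \<Longrightarrow> y x z = y x a + slope 1 (y x) a * (z - a)"
      by (rule plf_affine_right[OF H_incr(3)[OF Hp yH[OF x]]]) blast
    then show ?thesis using ys[OF x] fixH(1)[OF yH[OF x]] by (intro exI[of _ e]) simp
  qed
  have near_b: "\<exists>e>0. \<forall>z. b - e \<le> z \<and> z \<le> b \<longrightarrow> y x z = z" if x: "x \<in> X" for x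
  proof -
    note yx = H_incr(3)[OF Hp yH[OF x]]
    \<comment> \<open>An orbital of \<open>y x\<close> ending at \<open>b\<close> would share this
      end with \<open>(a, b)\<close>, hence begin at \<open>a\<close>, where the slope is
      one.\<close>
    have "slope (-1) (y x) b = 1"
    proof (rule ccontr)
      assume "slope (-1) (y x) b \<noteq> 1"
      then obtain c where c: "orb (y x) c b" using orb_ending_at[OF yx fixH(2)[OF yH[OF x]]] by blast
      then have "c = a" using orb_eq_right[OF Hp nc yH[OF x] c f] by simp
      then show False using orb_slope_left[OF yx] c ys[OF x] by simp
    qed
    moreover obtain e where "e > 0" "\<And>z. b - e \<le> z \<Longrightarrow> z \<le> b \<Longrightarrow> y x z = y x b + slope (-1) (y x) b * (z - b)"
      by (rule plf_affine_left[OF yx]) blast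
    ultimately show ?thesis using fixH(2)[OF yH[OF x]] by (intro exI[of _ e]) simp
  qed
  have "\<exists>c. a < c \<and> c < b \<and> (\<forall>x\<in>X. \<forall>z. a \<le> z \<and> z \<le> c \<longrightarrow> y x z = z)"
  proof -
    obtain e where e: "\<And>x. x \<in> X \<Longrightarrow> 0 < e x" "\<And>x z. x \<in> X \<Longrightarrow> a \<le> z \<Longrightarrow> z \<le> a + e x \<Longrightarrow> y x z = z" using near_a by metis
    define d where "d = Min (insert ((b - a) / 2) (e ` X))"
    have fin: "finite (insert ((b - a) / 2) (e ` X))" using X(1) by simp
    have "0 < d" unfolding d_def using fin e(1) \<open>a < b\<close> by (subst Min_gr_iff) auto
    moreover have "d \<le> (b - a) / 2" unfolding d_def by (rule Min_le[OF fin]) simp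
    moreover have "d \<le> e x" if "x \<in> X" for x unfolding d_def by (rule Min_le[OF fin]) (use that in simp)
    ultimately show ?thesis using e(2) \<open>a < b\<close> by (intro exI[of _ "a + d"]) force
  qed
  then obtain c where c: "a < c" "c < b" "\<And>x z. x \<in> X \<Longrightarrow> a \<le> z \<Longrightarrow> z \<le> c \<Longrightarrow> y x z = z" by blast
  have "\<exists>c. a < c \<and> c < b \<and> (\<forall>x\<in>X. \<forall>z. c \<le> z \<and> z \<le> b \<longrightarrow> y x z = z)"
  proof -
    obtain e where e: "\<And>x. x \<in> X \<Longrightarrow> 0 < e x" "\<And>x z. x \<in> X \<Longrightarrow> b - e x \<le> z \<Longrightarrow> z \<le> b \<Longrightarrow> y x z = z" using near_b by metis
    define d where "d = Min (insert ((b - a) / 2) (e ` X))"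
    have fin: "finite (insert ((b - a) / 2) (e ` X))" using X(1) by simp
    have "0 < d" unfolding d_def using fin e(1) \<open>a < b\<close> by (subst Min_gr_iff) auto
    moreover have "d \<le> (b - a) / 2" unfolding d_def by (rule Min_le[OF fin]) simp
    moreover have "d \<le> e x" if "x \<in> X" for x unfolding d_def by (rule Min_le[OF fin]) (use that in simp)
    ultimately show ?thesis using e(2) \<open>a < b\<close> by (intro exI[of _ "b - d"]) force
  qed
  then obtain c' where c': "a < c'" "c' < b" "\<And>x z. x \<in> X \<Longrightarrow> c' \<le> z \<Longrightarrow> z \<le> b \<Longrightarrow> y x z = z" by blast
  have tpow: "t ^^ n \<in> ?H" for n using tG GtH by blast
  have tpowPL: "t ^^ n \<in> PL_plus" for n by (rule PL_subgroupD(2)[OF H tpow])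
  have pow_ab: "a < (t ^^ n) z" "(t ^^ n) z < b" if "a < z" "z < b" for n z
    using incr_orb_funpow_maps[OF ti to that] by auto
  have finv_ab: "a < finv (t ^^ n) z" "finv (t ^^ n) z < b" if "a < z" "z < b" for n z
    using incr_less[OF PL_plusD(1,2)[OF tpowPL]] PL_simps(1)[OF tpowPL] fixH[OF tpow] that by metis+
  \<comment> \<open>\<open>q\<close> is a translate of the fixed point \<open>p\<close> so far to
    the left that all \<open>y x\<close> are trivial up to it; below, \<open>M\<close> is chosen so
    that they are trivial from the \<open>M\<close>-th translate of \<open>q\<close> on.\<close>
  obtain N where N: "p < (t ^^ N) c"
    using incr_orb_push[OF ti to _ c(1,2) p(2)] tr by blast
  define q where "q = finv (t ^^ N) p"
  have q: "a < q" "q < b" unfolding q_def using finv_ab p by auto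
  have "q < c"
    using N incr_less[OF PL_plusD(1,2)[OF tpowPL], of N q c] PL_simps(1)[OF tpowPL, of N p] unfolding q_def by simp
  obtain M where M: "c' < (t ^^ M) q"
    using incr_orb_push[OF ti to _ q c'(2)] tr by blast
  \<comment> \<open>The elements of slope one form a normal subgroup, so every translate of their
    common fixed point \<open>p\<close> is one, too.\<close>
  have kfix: "k ((t ^^ m) q) = (t ^^ m) q" if k: "k \<in> ?H" "slope 1 k a = 1" for k m
  proof -
    define u where "u = (t ^^ m) \<circ> finv (t ^^ N)"
    have u: "u \<in> ?H" unfolding u_def using Hm tpow by blast
    have uPL: "u \<in> PL_plus" using PL_subgroupD(2)[OF H u] .
    have "slope 1 (finv u \<circ> (k \<circ> u)) a = 1"
      using slope_mult[OF Hm(2)[OF u] Hm(1)[OF k(1) u]] slope_mult[OF k(1) u] slope_finv[OF u] k(2) slope_pos[OF u] by simp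
    moreover have "finv u \<circ> (k \<circ> u) \<in> ?H" by (intro Hm u k(1))
    ultimately have "(finv u \<circ> (k \<circ> u)) p = p" using p(3) by blast
    then have "k (u p) = u p" using PL_simps(1)[OF uPL] by (metis comp_apply)
    then show ?thesis unfolding u_def q_def by simp
  qed
  define Z where "Z = (\<lambda>(x, j). finv (t ^^ j) \<circ> y x \<circ> t ^^ j) ` (X \<times> {..<M})"
  have Zker: "k \<in> ?H \<and> slope 1 k a = 1" if kZ: "k \<in> Z" for k
  proof -
    obtain x j where k: "k = finv (t ^^ j) \<circ> y x \<circ> t ^^ j" "x \<in> X" using kZ unfolding Z_def by auto
    have "slope 1 k a = 1" unfolding k(1)
      using slope_mult[OF Hm(1)[OF Hm(2)[OF tpow] yH[OF k(2)]] tpow, of j j] slope_mult[OF Hm(2)[OF tpow] yH[OF k(2)], of j]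
        slope_finv[OF tpow, of j] slope_pos[OF tpow, of j] ys[OF k(2)] by simp
    moreover have "k \<in> ?H" unfolding k(1) by (intro Hm tpow yH[OF k(2)])
    ultimately show ?thesis by blast
  qed
  have clipK: "clip a b x \<in> K"
    if K: "subgroup K PL_group" "clip a b t \<in> K" and ZK: "\<And>z. z \<in> Z \<Longrightarrow> clip q (t q) z \<in> K" and x: "x \<in> X" for K x
  proof -
    note Km = PL_mult_closed[OF K(1)]
    let ?T = "clip a b t"
    have wK: "clip a b v \<in> K \<and> v a = a \<and> v b = b" if v: "v \<in> generate PL_group {t}" for v
    proof (rule PL_generate_induct[OF _ v, where P = "\<lambda>v. clip a b v \<in> K \<and> v a = a \<and> v b = b"])
      show "{t} \<subseteq> PL_plus" using tp by simp
      have "clip a b id = id" by (rule clip_triv) simp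
      then show "clip a b id \<in> K \<and> id a = a \<and> id b = b" using Km(3) by simp
      show "clip a b v \<in> K \<and> v a = a \<and> v b = b" if "v \<in> {t}" for v using that K(2) ta by simp
      show "clip a b (finv f) \<in> K \<and> finv f a = a \<and> finv f b = b"
        if "f \<in> PL_plus" "clip a b f \<in> K \<and> f a = a \<and> f b = b" for f
        using that clip_PL_inv[of f a b] Km(2) incr_inv_fix[OF PL_plusD(1,2)[OF that(1)]] by auto
      show "clip a b (f \<circ> g) \<in> K \<and> (f \<circ> g) a = a \<and> (f \<circ> g) b = b"
        if "f \<in> PL_plus" "g \<in> PL_plus" "clip a b f \<in> K \<and> f a = a \<and> f b = b" "clip a b g \<in> K \<and> g a = a \<and> g b = b" for f g
        using that clip_comp[OF PL_plusD(1,2)[OF that(2)], of a b f] Km(1) by auto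
    qed
    note yi = PL_plusD(1,2)[OF PL_subgroupD(2)[OF H yH[OF x]]]
    have piece: "clip ((t ^^ m) q) ((t ^^ Suc m) q) (y x) \<in> K" if m: "m < M" for m
    proof -
      define h where "h = t ^^ m"
      have hPL: "h \<in> PL_plus" unfolding h_def by (rule tpowPL)
      note hi = PL_plusD(1,2)[OF hPL] and hs = PL_simps[OF hPL]
      define C where "C = clip a b h"
      have CK: "C \<in> K" unfolding C_def h_def using wK[OF tG] by blast
      define z where "z = finv h \<circ> y x \<circ> h"
      have "z \<in> Z" unfolding Z_def z_def h_def using x m by auto
      then have zK: "clip q (t q) z \<in> K" using ZK by blast
      have "h \<circ> z \<circ> finv h = y x" by (simp add: z_def fun_eq_iff hs)
      then have e: "clip (h q) (h (t q)) (y x) = h \<circ> clip q (t q) z \<circ> finv h" using clip_conj[OF hi, of q "t q" z] by simp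
      have hab: "h a = a" "h b = b" unfolding h_def using fixH[OF tpow] by auto
      have maps: "a < h u \<and> h u < b \<longleftrightarrow> a < u \<and> u < b" "a < finv h u \<and> finv h u < b \<longleftrightarrow> a < u \<and> u < b" for u
        using incr_less[OF hi] hab hs(1) by metis+
      have zm: "a < clip q (t q) z u \<and> clip q (t q) z u < b" if "a < u" "u < b" for u
      proof -
        have zH: "z \<in> ?H" using Zker[OF \<open>z \<in> Z\<close>] by blast
        have "a < z u \<and> z u < b" using that fixH[OF zH] incr_less[OF H_incr(1,2)[OF Hp zH]] by metis
        then show ?thesis using that by (simp add: clip_def)
      qed
      have qtq: "a < q" "t q < b" using q pow_ab(2)[OF q, of 1] by auto
      \<comment> \<open>Outside \<open>(a, b)\<close> the power \<open>h\<close> of \<open>t\<close>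
        may act nontrivially and need not belong to \<open>K\<close>. Its cut version
        \<open>C\<close> gives the same conjugate, since the conjugated piece lives inside
        \<open>(a, b)\<close>.\<close>
      have "h \<circ> clip q (t q) z \<circ> finv h = C \<circ> clip q (t q) z \<circ> finv C"
      proof
        fix u
        have CI: "finv C = clip a b (finv h)" unfolding C_def using clip_PL_inv[OF hPL hab] by simp
        have C_in: "C v = h v" if "a < v" "v < b" for v using that by (simp add: C_def clip_def)
        show "(h \<circ> clip q (t q) z \<circ> finv h) u = (C \<circ> clip q (t q) z \<circ> finv C) u"
        proof (cases "a < u \<and> u < b")
          case True
          then have "finv C u = finv h u" by (simp add: CI clip_def)
          moreover have "a < finv h u" "finv h u < b" using True maps(2) by auto
          ultimately show ?thesis using zm[of "finv h u"] C_in by simp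
        next
          case False
          then have "\<not> (a < finv h u \<and> finv h u < b)" using maps(2) by blast
          then have e: "clip q (t q) z (finv h u) = finv h u" "clip q (t q) z u = u" using False qtq unfolding clip_def by auto
          have "clip a b k u = u" for k using False by (auto simp: clip_def)
          then have "clip a b (finv h) u = u" "clip a b h u = u" by blast+
          then have "finv C u = u" "C u = u" by (simp only: CI, simp only: C_def)
          then show ?thesis using e by (simp add: hs)
        qed
      qed
      moreover have "C \<circ> clip q (t q) z \<circ> finv C \<in> K" using Km CK zK by blast
      moreover have "h (t q) = (t ^^ Suc m) q" unfolding h_def by (simp add: funpow_swap1)
      ultimately show ?thesis using e unfolding h_def by simp
    qed
    have "clip q ((t ^^ m) q) (y x) \<in> K" if "m \<le> M" for m
      using that
    proof (induction m)
      case 0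
      have e: "clip q ((t ^^ 0) q) (y x) = id" by (rule clip_triv) simp
      show ?case unfolding e by (rule Km(3))
    next
      case (Suc m)
      have mono: "q \<le> (t ^^ m) q" for m
      proof (induction m)
        case (Suc m) then show ?case using tr[OF pow_ab[OF q, of m]] by simp
      qed simp
      have le: "(t ^^ m) q \<le> (t ^^ Suc m) q" using tr[OF pow_ab[OF q, of m]] by simp
      have e: "clip q ((t ^^ Suc m) q) (y x) = clip q ((t ^^ m) q) (y x) \<circ> clip ((t ^^ m) q) ((t ^^ Suc m) q) (y x)"
        by (rule clip_split[OF yi kfix[OF yH[OF x] ys[OF x]] mono le kfix[OF yH[OF x] ys[OF x]]])
      show ?case unfolding e by (rule Km(1)) (use Suc piece[of m] in simp_all)
    qed
    then have "clip q ((t ^^ M) q) (y x) \<in> K" by blast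
    moreover have "clip q ((t ^^ M) q) (y x) = clip a b (y x)"
    proof
      fix u
      have "y x u = u" if "a < u" "u \<le> q" using c(3)[OF x, of u] that \<open>q < c\<close> by simp
      moreover have "y x u = u" if "(t ^^ M) q \<le> u" "u < b" using c'(3)[OF x, of u] that M by simp
      moreover have "(t ^^ M) q < b" using pow_ab[OF q] by simp
      ultimately show "clip q ((t ^^ M) q) (y x) u = clip a b (y x) u" using q unfolding clip_def by auto
    qed
    ultimately have yK: "clip a b (y x) \<in> K" by simp
    have "w x \<in> PL_plus" using PL_subgroupD(2)[OF H wH[OF x]] .
    then have "x = w x \<circ> y x" by (simp add: y_def fun_eq_iff PL_simps)
    then have "clip a b x = clip a b (w x) \<circ> clip a b (y x)"
      using clip_comp[OF yi fixH(1)[OF yH[OF x]] fixH(2)[OF yH[OF x]], of "w x"] by simp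
    then show ?thesis using Km(1) wK[OF w(1)[OF x]] yK by simp
  qed
  show ?thesis
  proof (rule exI[of _ t], rule exI[of _ q], rule exI[of _ Z], intro conjI)
    show "t q < b" using pow_ab(2)[OF q, of 1] by simp
    show "finite Z" unfolding Z_def using X(1) by simp
    show "Z \<subseteq> ?H" using Zker by blast
    show "\<forall>x\<in>Z. x q = q \<and> x (t q) = t q" using kfix[of _ 0] kfix[of _ 1] Zker by auto
    show "\<forall>K. subgroup K PL_group \<and> clip a b t \<in> K \<and> (\<forall>z\<in>Z. clip q (t q) z \<in> K) \<longrightarrow> (\<forall>x\<in>X. clip a b x \<in> K)"
      using clipK by blast
  qed (use t(1) to q(1) tr[OF q] in auto)
qed

text \<open>A tower inside \<open>(q, t q)\<close> can be topped by the orbital of \<open>t\<close>,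
  so the induction hypothesis applies there with height one less. The new bump \<open>T\<close>
  encloses the old ones, and \<open>[q, t q]\<close> is the fundamental domain asked for by
  compatibility: all of them end at most at \<open>t q\<close>, while \<open>fn T\<close> takes
  their left ends to at least \<open>t q\<close>.\<close>

lemma resolve_orbital:
  assumes X: "finite X" "X \<subseteq> PL_plus" and nc: "\<not> has_chain (generate PL_group X)"
    and ab: "\<And>x. x \<in> X \<Longrightarrow> x a = a" "\<And>x. x \<in> X \<Longrightarrow> x b = b"
    and x0: "x0 \<in> X" "orb x0 a b"
    and ht: "\<And>m c d. tower (generate PL_group X) m c d \<Longrightarrow> a \<le> c \<Longrightarrow> d \<le> b \<Longrightarrow> m \<le> Suc n"
    and IH: "\<And>X s t. finite X \<Longrightarrow> X \<subseteq> PL_plus \<Longrightarrow> \<not> has_chain (generate PL_group X) \<Longrightarrow> s < t \<Longrightarrow>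
      (\<And>x. x \<in> X \<Longrightarrow> x s = s) \<Longrightarrow> (\<And>x. x \<in> X \<Longrightarrow> x t = t) \<Longrightarrow>
      (\<And>m c d. tower (generate PL_group X) m c d \<Longrightarrow> s \<le> c \<Longrightarrow> d \<le> t \<Longrightarrow> m \<le> n) \<Longrightarrow> \<exists>Y. resolves Y X s t"
  shows "\<exists>Y. resolves Y X a b"
proof -
  let ?H = "generate PL_group X"
  have H: "subgroup ?H PL_group" by (rule PL_generate_subgroup[OF X(2)])
  have "\<exists>t q Z. t \<in> ?H \<and> orb t a b \<and> a < q \<and> t q < b \<and> q < t q \<and>
    finite Z \<and> Z \<subseteq> ?H \<and> (\<forall>x\<in>Z. x q = q \<and> x (t q) = t q) \<and>
    (\<forall>K. subgroup K PL_group \<and> clip a b t \<in> K \<and> (\<forall>z\<in>Z. clip q (t q) z \<in> K) \<longrightarrow> (\<forall>x\<in>X. clip a b x \<in> K))"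
    by (rule resolve_orbital_core[OF X nc _ _ x0]) (erule ab)+
  then obtain t q Z where t: "t \<in> ?H" "orb t a b" and q: "a < q" "t q < b" "q < t q"
    and Z: "finite Z" "Z \<subseteq> ?H" "\<And>x. x \<in> Z \<Longrightarrow> x q = q" "\<And>x. x \<in> Z \<Longrightarrow> x (t q) = t q"
    and clipK: "\<And>K x. subgroup K PL_group \<Longrightarrow> clip a b t \<in> K \<Longrightarrow> (\<And>z. z \<in> Z \<Longrightarrow> clip q (t q) z \<in> K) \<Longrightarrow> x \<in> X \<Longrightarrow> clip a b x \<in> K"
    by (elim exE conjE) metis
  have ZPL: "Z \<subseteq> PL_plus" using Z(2) PL_subgroupD(2)[OF H] by blast
  have ZH: "generate PL_group Z \<subseteq> ?H" by (rule PL_generate_least[OF H Z(2)])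
  have tp: "t \<in> PL_plus" using PL_subgroupD(2)[OF H t(1)] .
  note ti = PL_plusD(1,2)[OF tp]
  have "\<exists>Y. resolves Y Z q (t q)"
  proof (rule IH)
    show "finite Z" "Z \<subseteq> PL_plus" "q < t q" "\<And>x. x \<in> Z \<Longrightarrow> x q = q" "\<And>x. x \<in> Z \<Longrightarrow> x (t q) = t q"
      by (fact Z ZPL q)+
    show "\<not> has_chain (generate PL_group Z)" using nc has_chain_mono[OF _ ZH] by blast
    fix m c d assume m: "tower (generate PL_group Z) m c d" "q \<le> c" "d \<le> t q"
    have "tower ?H (Suc m) a b"
      unfolding tower.simps using t tower_mono[OF m(1) ZH] m(2,3) q by (intro bexI[of _ t] conjI exI[of _ c] exI[of _ d]) auto
    from ht[OF this] show "m \<le> n" by simp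
  qed
  then obtain Y where Y: "finite Y" "bump_system Y" "linked Y" "Y \<subseteq> bumps_of (generate PL_group Z) q (t q)"
    "\<And>x. x \<in> Z \<Longrightarrow> clip q (t q) x \<in> gens Y" unfolding resolves_def by blast
  \<comment> \<open>One more than the largest label below, so that the system stays linked; 0 if
    nothing is enclosed.\<close>
  define l where "l = (if Y = {} then 0 else Suc (Max (lab ` Y)))"
  define T where "T = (l, (a, b), clip a b t)"
  have T: "lab T = l" "lo T = a" "hi T = b" "fn T = clip a b t" by (simp_all add: T_def)
  have Tb: "is_bump T" unfolding T_def by (rule is_bump_clip[OF tp t(2)])
  have lab_lt: "lab i < l" if "i \<in> Y" for i
  proof -
    have "lab i \<le> Max (lab ` Y)" using Y(1) that by (intro Max_ge) auto
    then show ?thesis using that by (auto simp: l_def)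
  qed
  have Yq: "q \<le> lo i" "hi i \<le> t q" if "i \<in> Y" for i using Y(4) that unfolding bumps_of_def by blast+
  have Ybump: "is_bump i" if "i \<in> Y" for i using Y(2) that by (simp add: bump_system_def)
  have Yin: "inside i T" if "i \<in> Y" for i using Yq[OF that] q unfolding inside_def T by simp
  have not_in: "\<not> inside T j" if "j \<in> insert T Y" for j
  proof (cases "j = T")
    case True then show ?thesis by (simp add: inside_def)
  next
    case False
    then show ?thesis using Yq[of j] that q unfolding inside_def T by auto
  qed
  have "compatible (insert T Y)"
    unfolding compatible_def
  proof (intro conjI ballI impI)
    fix i j assume ij: "i \<in> insert T Y" "j \<in> insert T Y"
    consider "i = T" "j = T" | "i = T" "j \<in> Y" | "i \<in> Y" "j = T" | "i \<in> Y" "j \<in> Y" using ij by blast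
    then show "apart i j \<or> i = j \<or> inside i j \<and> lab i < lab j \<or> inside j i \<and> lab j < lab i"
      using Yin lab_lt Y(2) by cases (auto simp: T bump_system_def compatible_def)
  next
    fix i j k assume ijk: "i \<in> insert T Y" "j \<in> insert T Y" "k \<in> insert T Y" "inside i k \<and> inside j k"
    then have ij: "i \<in> Y" "j \<in> Y" using not_in[OF ijk(3)] by auto
    show "hi i \<le> fn k (lo j)"
    proof (cases "k = T")
      case True
      have "hi i \<le> t q" using Yq ij by blast
      also have "t q \<le> t (lo j)" using Yq[OF ij(2)] incr_le[OF ti] by simp
      also have "t (lo j) = fn k (lo j)" using Yin[OF ij(2)] is_bumpD(4)[OF Ybump[OF ij(2)]]
        by (simp add: True T clip_def inside_def)
      finally show ?thesis .
    next
      case False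
      then show ?thesis using ijk ij Y(2) unfolding bump_system_def compatible_def by blast
    qed
  qed
  then have sys: "bump_system (insert T Y)" using Tb Ybump by (simp add: bump_system_def)
  have "linked (insert T Y)"
    unfolding linked_def
  proof (intro ballI allI impI)
    fix i m assume i: "i \<in> insert T Y" "lab i = Suc m"
    show "\<exists>j\<in>insert T Y. inside j i \<and> lab j = m"
    proof (cases "i = T")
      case True
      then have ne: "Y \<noteq> {}" and m: "m = Max (lab ` Y)" using i(2) T(1) by (auto simp: l_def split: if_splits)
      have "Max (lab ` Y) \<in> lab ` Y" using Y(1) ne by (intro Max_in) auto
      then obtain j where "j \<in> Y" "lab j = m" using m by auto
      then show ?thesis using Yin True by blast
    next
      case False
      then show ?thesis using i Y(3) unfolding linked_def by blast
    qed
  qed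
  moreover have "insert T Y \<subseteq> bumps_of ?H a b"
  proof
    fix i assume "i \<in> insert T Y"
    then consider "i = T" | "i \<in> Y" by blast
    then show "i \<in> bumps_of ?H a b"
    proof cases
      case 1 then show ?thesis using t unfolding bumps_of_def by (auto simp: T)
    next
      case 2
      then show ?thesis using Y(4) ZH Yq[OF 2] q unfolding bumps_of_def by force
    qed
  qed
  moreover have "clip a b x \<in> gens (insert T Y)" if "x \<in> X" for x
  proof (rule clipK[OF _ _ _ that])
    show "subgroup (gens (insert T Y)) PL_group" by (rule PL_generate_subgroup[OF bump_system_PL[OF sys]])
    show "clip a b t \<in> gens (insert T Y)" using T(4) by (metis generate.incl image_eqI insertI1)
    have "gens Y \<subseteq> gens (insert T Y)" by (rule group.mono_generate[OF group_PL]) auto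
    then show "clip q (t q) y \<in> gens (insert T Y)" if "y \<in> Z" for y using Y(5)[OF that] by blast
  qed
  ultimately show ?thesis using sys Y(1) unfolding resolves_def by blast
qed

text \<open>Induction on the height of towers. The maximal ones among the generators' orbitals
  between \<open>s\<close> and \<open>t\<close> are finite in number, pairwise apart, and have ends
  fixed by all generators, so each is resolved on its own and the systems are united.\<close>

lemma resolves_exists:
  assumes "finite X" "X \<subseteq> PL_plus" "\<not> has_chain (generate PL_group X)" "s < t"
    "\<And>x. x \<in> X \<Longrightarrow> x s = s" "\<And>x. x \<in> X \<Longrightarrow> x t = t"
    "\<And>m c d. tower (generate PL_group X) m c d \<Longrightarrow> s \<le> c \<Longrightarrow> d \<le> t \<Longrightarrow> m \<le> n"
  shows "\<exists>Y. resolves Y X s t"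
  using assms
proof (induction n arbitrary: X s t)
  case 0
  \<comment> \<open>With no tower of height 1 the generators move nothing between \<open>s\<close>
    and \<open>t\<close>, and the empty system does.\<close>
  have "clip s t x = id" if x: "x \<in> X" for x
  proof (rule clip_triv, rule ccontr)
    fix z assume z: "s < z" "z < t" "x z \<noteq> z"
    have xp: "x \<in> PL_plus" using x 0 by blast
    obtain a b where "orb x a b" "s \<le> a" "b \<le> t"
      by (rule incr_orbital_at[OF PL_plusD(1,2)[OF xp] z(3) _ 0(5)[OF x] _ 0(6)[OF x]]) (use z in auto)
    then show False using 0(7)[of 1 a b] tower_1[of x] generate.incl[OF x, of PL_group] by fastforce
  qed
  moreover have "subgroup (gens {}) PL_group" by (rule PL_generate_subgroup) simp
  ultimately have "clip s t x \<in> gens {}" if "x \<in> X" for x using that PL_mult_closed(3)[of "gens {}"] by simp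
  then have "resolves {} X s t" unfolding resolves_def bump_system_def compatible_def linked_def by simp
  then show ?case by blast
next
  case (Suc n)
  let ?H = "generate PL_group X"
  have H: "subgroup ?H PL_group" by (rule PL_generate_subgroup[OF Suc.prems(2)])
  note Hp = PL_subgroupD(1)[OF H]
  have XH: "x \<in> ?H" if "x \<in> X" for x using that by (rule generate.incl)
  define Orbs where "Orbs = {(a, b). \<exists>x\<in>X. orb x a b \<and> s \<le> a \<and> b \<le> t}"
  have "Orbs \<subseteq> (\<Union>x\<in>X. {(a, b). orb x a b})" unfolding Orbs_def by auto
  moreover have "finite (\<Union>x\<in>X. {(a, b). orb x a b})" using Suc.prems(1,2) finite_orbs by blast
  ultimately have finOrbs: "finite Orbs" by (rule finite_subset)
  \<comment> \<open>Maximality is demanded only against orbitals of the generators, not of the whole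
    group; this leaves finitely many candidates.\<close>
  define A where "A = {(a, b) \<in> Orbs. \<not> (\<exists>c d. (c, d) \<in> Orbs \<and> c < a \<and> b < d)}"
  have finA: "finite A" using finOrbs unfolding A_def by (rule finite_subset[rotated]) auto
  have A_Orbs: "\<exists>x\<in>X. orb x a b \<and> s \<le> a \<and> b \<le> t" if "(a, b) \<in> A" for a b using that unfolding A_def Orbs_def by auto
  \<comment> \<open>An orbital of another generator around \<open>a\<close> or \<open>b\<close>
    would by nesting be strictly larger than \<open>(a, b)\<close>.\<close>
  have A_fix: "x a = a \<and> x b = b" if ab: "(a, b) \<in> A" and x: "x \<in> X" for a b x
  proof -
    obtain x' where x': "x' \<in> X" "orb x' a b" "s \<le> a" "b \<le> t" using A_Orbs[OF ab] by blast
    have xp: "x \<in> PL_plus" using x Suc.prems(2) by blast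
    have "x z = z" if z: "z = a \<or> z = b" for z
    proof (rule ccontr)
      assume nz: "x z \<noteq> z"
      have "s \<le> z" "z \<le> t" using z x'(3,4) orbD(1)[OF x'(2)] by auto
      then obtain u v where uv: "orb x u v" "s \<le> u" "u < z" "z < v" "v \<le> t"
        using incr_orbital_at[OF PL_plusD(1,2)[OF xp] nz _ Suc.prems(5)[OF x] _ Suc.prems(6)[OF x]] by metis
      then have "u < a \<and> b < v"
        using orb_laminar[OF Hp Suc.prems(3) XH[OF x] uv(1) XH[OF x'(1)] x'(2)] z orbD(1)[OF x'(2)] by linarith
      moreover have "(u, v) \<in> Orbs" using uv x unfolding Orbs_def by blast
      ultimately show False using ab unfolding A_def by blast
    qed
    then show ?thesis by blast
  qed
  have A_apart: "(a, b) = (c, d) \<or> b \<le> c \<or> d \<le> a" if ac: "(a, b) \<in> A" "(c, d) \<in> A" for a b c d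
  proof -
    obtain x y where "x \<in> X" "orb x a b" "y \<in> X" "orb y c d" using A_Orbs[OF ac(1)] A_Orbs[OF ac(2)] by blast
    then have "b \<le> c \<or> d \<le> a \<or> (a = c \<and> b = d) \<or> (a < c \<and> d < b) \<or> (c < a \<and> b < d)"
      using orb_laminar[OF Hp Suc.prems(3) XH _ XH] by blast
    then show ?thesis using ac unfolding A_def by blast
  qed
  have cover: "\<exists>(a, b)\<in>A. a < z \<and> z < b" if z: "s < z" "z < t" and x: "x \<in> X" "x z \<noteq> z" for z x
  proof -
    have xp: "x \<in> PL_plus" using x Suc.prems(2) by blast
    obtain u v where uv: "orb x u v" "s \<le> u" "u < z" "z < v" "v \<le> t"
      using incr_orbital_at[OF PL_plusD(1,2)[OF xp] x(2) _ Suc.prems(5)[OF x(1)] _ Suc.prems(6)[OF x(1)]] z by (metis less_imp_le)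
    \<comment> \<open>A longest orbital around \<open>z\<close> is maximal.\<close>
    define S where "S = {(a, b) \<in> Orbs. a < z \<and> z < b}"
    have "finite S" "(u, v) \<in> S" using finOrbs uv x(1) unfolding S_def Orbs_def by (auto intro: finite_subset[rotated])
    then have "Max ((\<lambda>k. snd k - fst k) ` S) \<in> (\<lambda>k. snd k - fst k) ` S" by (intro Max_in) auto
    then obtain m where "m \<in> S" "Max ((\<lambda>k. snd k - fst k) ` S) = snd m - fst m" by blast
    then have m: "m \<in> S" "\<And>k. k \<in> S \<Longrightarrow> snd k - fst k \<le> snd m - fst m"
      using Max_ge[OF finite_imageI[OF \<open>finite S\<close>], of _ "\<lambda>k. snd k - fst k"] by (blast, metis (mono_tags, lifting) imageI)
    obtain a b where ab: "m = (a, b)" by (cases m)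
    have "(a, b) \<in> A" unfolding A_def
    proof (clarify, intro conjI notI)
      show "(a, b) \<in> Orbs" using m(1) ab by (simp add: S_def)
      assume "\<exists>c d. (c, d) \<in> Orbs \<and> c < a \<and> b < d"
      then obtain c d where cd: "(c, d) \<in> Orbs" "c < a" "b < d" by blast
      then have "(c, d) \<in> S" using m(1) ab unfolding S_def by auto
      then show False using m(2)[of "(c, d)"] ab cd by auto
    qed
    then show ?thesis using m(1) ab unfolding S_def by auto
  qed
  have "\<exists>Y. resolves Y X a b" if ab: "(a, b) \<in> A" for a b
  proof -
    obtain x' where x': "x' \<in> X" "orb x' a b" "s \<le> a" "b \<le> t" using A_Orbs[OF ab] by blast
    show ?thesis
    proof (rule resolve_orbital[OF Suc.prems(1-3) _ _ x'(1,2), of n])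
      show "x a = a" "x b = b" if "x \<in> X" for x using A_fix[OF ab that] by auto
      show "m \<le> Suc n" if "tower ?H m c d" "a \<le> c" "d \<le> b" for m c d using Suc.prems(7)[OF that(1)] that x' by simp
    qed (rule Suc.IH)
  qed
  then have "\<forall>k\<in>A. \<exists>Y. resolves Y X (fst k) (snd k)" by auto
  then obtain F where F: "\<And>k. k \<in> A \<Longrightarrow> resolves (F k) X (fst k) (snd k)" by metis
  define Y where "Y = (\<Union>k\<in>A. F k)"
  have Fd: "finite (F k)" "bump_system (F k)" "linked (F k)" "F k \<subseteq> bumps_of ?H (fst k) (snd k)"
    "\<And>x. x \<in> X \<Longrightarrow> clip (fst k) (snd k) x \<in> gens (F k)" if "k \<in> A" for k
    using F[OF that] unfolding resolves_def by simp_all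
  have Fin: "fst k \<le> lo i" "hi i \<le> snd k" if "k \<in> A" "i \<in> F k" for k i
    using Fd(4)[OF that(1)] that(2) unfolding bumps_of_def by blast+
  have Yb: "is_bump i" if "i \<in> Y" for i using that Fd(2) unfolding Y_def bump_system_def by blast
  have same: "k = k'" if "k \<in> A" "k' \<in> A" "i \<in> F k" "j \<in> F k'" "\<not> apart i j" for i j k k'
    using A_apart[of "fst k" "snd k" "fst k'" "snd k'"] Fin[OF that(1,3)] Fin[OF that(2,4)] that unfolding apart_def
    by (auto simp: prod_eq_iff)
  have "compatible Y"
    unfolding compatible_def
  proof (intro conjI ballI impI)
    fix i j assume "i \<in> Y" "j \<in> Y"
    then obtain k k' where k: "k \<in> A" "k' \<in> A" "i \<in> F k" "j \<in> F k'" unfolding Y_def by blast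
    show "apart i j \<or> i = j \<or> inside i j \<and> lab i < lab j \<or> inside j i \<and> lab j < lab i"
    proof (cases "apart i j")
      case False
      then have "k = k'" using same k by blast
      then show ?thesis using Fd(2)[OF k(1)] k unfolding bump_system_def compatible_def by blast
    qed simp
  next
    fix i j r assume ijr: "i \<in> Y" "j \<in> Y" "r \<in> Y" "inside i r \<and> inside j r"
    then obtain k k' k'' where k: "k \<in> A" "k' \<in> A" "k'' \<in> A" "i \<in> F k" "j \<in> F k'" "r \<in> F k''" unfolding Y_def by blast
    have "\<not> apart i r" "\<not> apart j r"
      using ijr is_bumpD(4)[OF Yb[OF ijr(1)]] is_bumpD(4)[OF Yb[OF ijr(2)]] unfolding apart_def inside_def by auto
    then have "k = k''" "k' = k''" using same k by blast+
    then show "hi i \<le> fn r (lo j)" using Fd(2)[OF k(1)] k ijr unfolding bump_system_def compatible_def by blast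
  qed
  then have sys: "bump_system Y" using Yb by (simp add: bump_system_def)
  have "linked Y"
    unfolding linked_def
  proof (intro ballI allI impI)
    fix i m assume i: "i \<in> Y" "lab i = Suc m"
    then obtain k where k: "k \<in> A" "i \<in> F k" unfolding Y_def by blast
    then obtain j where "j \<in> F k" "inside j i" "lab j = m" using Fd(3)[OF k(1)] i(2) unfolding linked_def by blast
    then show "\<exists>j\<in>Y. inside j i \<and> lab j = m" using k(1) unfolding Y_def by blast
  qed
  moreover have "Y \<subseteq> bumps_of ?H s t"
  proof
    fix i assume "i \<in> Y"
    then obtain k where k: "k \<in> A" "i \<in> F k" unfolding Y_def by blast
    have "s \<le> fst k" "snd k \<le> t" using A_Orbs[of "fst k" "snd k"] k(1) by auto
    then show "i \<in> bumps_of ?H s t" using Fd(4)[OF k(1)] k(2) Fin[OF k] unfolding bumps_of_def by auto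
  qed
  moreover have "clip s t x \<in> gens Y" if x: "x \<in> X" for x
  proof -
    have sub: "subgroup (gens Y) PL_group" by (rule PL_generate_subgroup[OF bump_system_PL[OF sys]])
    have xi: "strict_mono x" "surj x" using x Suc.prems(2) PL_plusD(1,2) by blast+
    \<comment> \<open>The cuts to the members of \<open>A\<close> have disjoint supports, and
      composing them one by one rebuilds \<open>x\<close> between \<open>s\<close> and
      \<open>t\<close>.\<close>
    define cl where "cl = (\<lambda>S z. if \<exists>(a, b)\<in>S. a < z \<and> z < b then x z else z)"
    have in_iff: "a < x z \<and> x z < b \<longleftrightarrow> a < z \<and> z < b" if "(a, b) \<in> A" for a b z
      using incr_less[OF xi] A_fix[OF that x] by metis
    have "cl S \<in> gens Y" if "S \<subseteq> A" for S
    proof -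
      have "finite S" using finA that by (rule finite_subset[rotated])
      then show ?thesis using that
      proof (induction S)
        case empty
        have "cl {} = id" by (simp add: cl_def fun_eq_iff)
        then show ?case using PL_mult_closed(3)[OF sub] by (simp only:)
      next
        case (insert k S)
        obtain a b where ab: "k = (a, b)" by (cases k)
        then have abA: "(a, b) \<in> A" using insert by simp
        have e: "cl (insert k S) = cl S \<circ> clip a b x"
        proof
          fix z
          show "cl (insert k S) z = (cl S \<circ> clip a b x) z"
          proof (cases "a < z \<and> z < b")
            case True
            have "\<not> (\<exists>(c, d)\<in>S. c < x z \<and> x z < d)"
            proof
              assume "\<exists>(c, d)\<in>S. c < x z \<and> x z < d"
              then obtain c d where cd: "(c, d) \<in> S" "c < x z" "x z < d" by blast
              then have "(c, d) \<in> A" "(c, d) \<noteq> (a, b)" using insert.prems insert.hyps ab by auto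
              moreover have "a < x z" "x z < b" using in_iff[OF abA] True by auto
              ultimately show False using A_apart[OF abA, of c d] cd by auto
            qed
            then show ?thesis using True ab by (simp add: cl_def clip_def)
          next
            case False
            then show ?thesis using ab by (auto simp: cl_def clip_def)
          qed
        qed
        moreover have "clip a b x \<in> gens Y"
        proof -
          have "gens (F k) \<subseteq> gens Y" by (rule group.mono_generate[OF group_PL]) (use abA ab in \<open>auto simp: Y_def\<close>)
          then show ?thesis using Fd(5)[of k x] abA ab x by auto
        qed
        moreover have "cl S \<in> gens Y" using insert by simp
        ultimately show ?case unfolding e using PL_mult_closed(1)[OF sub] by blast
      qed
    qed
    moreover have "cl A = clip s t x"
    proof
      fix z
      have "(\<exists>(a, b)\<in>A. a < z \<and> z < b) \<longrightarrow> s < z \<and> z < t" using A_Orbs by force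
      moreover have "s < z \<Longrightarrow> z < t \<Longrightarrow> x z \<noteq> z \<Longrightarrow> \<exists>(a, b)\<in>A. a < z \<and> z < b" using cover[of z x] x by blast
      ultimately show "cl A z = clip s t x z" unfolding cl_def clip_def by metis
    qed
    ultimately show ?thesis by (metis order_refl)
  qed
  moreover have "finite Y" unfolding Y_def using finA Fd(1) by blast
  ultimately show ?case using sys unfolding resolves_def by blast
qed


section \<open>Certificates\<close>

text \<open>The increasing order is that of the process for orbitals. It makes the list a function
  of \<open>g\<close>, so that an index names a definite orbital.\<close>

definition orbs :: "(real \<Rightarrow> real) \<Rightarrow> (real \<times> real) list" where
  "orbs g = map (\<lambda>a. (a, THE b. orb g a b)) (sorted_list_of_set {a. \<exists>b. orb g a b})"

text \<open>Words and bumps are described by numbers. A letter is the pair of an index and an exponent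
  flag, and out of range indices give \<open>id\<close>. An entry consists of a label, a word, and the index of
  one of the orbitals of that word.\<close>

definition letter :: "(real \<Rightarrow> real) list \<Rightarrow> nat \<Rightarrow> real \<Rightarrow> real" where
  "letter gs l =
     (let g = (case drop (fst (prod_decode l)) gs of [] \<Rightarrow> id | g # _ \<Rightarrow> g)
      in if snd (prod_decode l) = 0 then g else finv g)"

definition word_val :: "(real \<Rightarrow> real) list \<Rightarrow> nat list \<Rightarrow> real \<Rightarrow> real" where
  "word_val gs w = fold (\<lambda>l acc. letter gs l \<circ> acc) w id"

definition entry_val :: "(real \<Rightarrow> real) list \<Rightarrow> nat \<Rightarrow> real \<Rightarrow> real" where
  "entry_val gs e = word_val gs (list_decode (fst (prod_decode (snd (prod_decode e)))))"

definition entry_bumps :: "(real \<Rightarrow> real) list \<Rightarrow> nat \<Rightarrow> (real \<times> real) list" where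
  "entry_bumps gs e = drop (snd (prod_decode (snd (prod_decode e)))) (orbs (entry_val gs e))"

text \<open>An entry whose index exceeds the number of orbitals is dropped. The order is immaterial
  for the checks; words are only claimed to exist for whatever order results.\<close>

definition bumps :: "(real \<Rightarrow> real) list \<Rightarrow> nat list \<Rightarrow> bump list" where
  "bumps gs es = fold (\<lambda>e acc. if entry_bumps gs e = [] then acc
     else (fst (prod_decode e), hd (entry_bumps gs e),
           clip (fst (hd (entry_bumps gs e))) (snd (hd (entry_bumps gs e))) (entry_val gs e)) # acc) es []"

definition bump_fns :: "bump list \<Rightarrow> (real \<Rightarrow> real) list" where
  "bump_fns Y = fold (\<lambda>i acc. fn i # acc) Y []"

definition chain_check :: "(real \<Rightarrow> real) list \<Rightarrow> nat list \<Rightarrow> nat list \<Rightarrow> bool" where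
  "chain_check gs u v \<longleftrightarrow>
     (\<exists>A\<in>set (orbs (word_val gs u)). \<exists>B\<in>set (orbs (word_val gs v)).
        fst A < fst B \<and> fst B < snd A \<and> snd A < snd B)"

text \<open>\<open>n\<close> is the claimed derived length: one more than the largest label, or 0
  for the empty system. The last clause is \<open>linked\<close> without successor patterns.\<close>

definition height_check :: "nat \<Rightarrow> bump list \<Rightarrow> bool" where
  "height_check n Y \<longleftrightarrow>
     (\<forall>i\<in>set Y. lab i < n) \<and> (n = 0 \<or> (\<exists>i\<in>set Y. Suc (lab i) = n)) \<and>
     (\<forall>i\<in>set Y. lab i = 0 \<or> (\<exists>j\<in>set Y. inside j i \<and> Suc (lab j) = lab i))"

definition compatible_check :: "bump list \<Rightarrow> bool" where
  "compatible_check Y \<longleftrightarrow>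
     (\<forall>i\<in>set Y. \<forall>j\<in>set Y. apart i j \<or> i = j \<or> (inside i j \<and> lab i < lab j) \<or> (inside j i \<and> lab j < lab i)) \<and>
     (\<forall>i\<in>set Y. \<forall>j\<in>set Y. \<forall>k\<in>set Y. inside i k \<and> inside j k \<longrightarrow> hi i \<le> fn k (lo j))"

definition bump_check :: "(real \<Rightarrow> real) list \<Rightarrow> nat \<Rightarrow> nat list \<Rightarrow> nat list \<Rightarrow> bool" where
  "bump_check gs n es vs \<longleftrightarrow>
     height_check n (bumps gs es) \<and> compatible_check (bumps gs es) \<and>
     (\<forall>g\<in>set gs. \<exists>v\<in>set vs. g = word_val (bump_fns (bumps gs es)) (list_decode v))"

text \<open>The first component is the claimed output.\<close>

definition certificate :: "(real \<Rightarrow> real) list \<Rightarrow> nat \<Rightarrow> bool" where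
  "certificate gs k \<longleftrightarrow>
     (let out = fst (prod_decode k); a = fst (prod_decode (snd (prod_decode k))); b = snd (prod_decode (snd (prod_decode k)))
      in (out = 0 \<and> chain_check gs (list_decode a) (list_decode b)) \<or>
         (0 < out \<and> bump_check gs (out - 1) (list_decode a) (list_decode b)))"

lemma orb_end_unique:
  assumes "orb g a b" "orb g a c" shows "b = c"
proof -
  have "\<not> b < c" "\<not> c < b" using orbD[OF assms(1)] orbD[OF assms(2)] by metis+
  then show ?thesis by simp
qed

lemma the_orb_end: "orb g a b \<Longrightarrow> (THE b. orb g a b) = b"
  using orb_end_unique by blast

lemma finite_orb_starts:
  assumes "g \<in> PL_plus" shows "finite {a. \<exists>b. orb g a b}"
proof -
  have "{a. \<exists>b. orb g a b} = fst ` {(a, b). orb g a b}" by force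
  then show ?thesis using finite_orbs[OF assms] by simp
qed

lemma set_orbs:
  assumes "g \<in> PL_plus" shows "set (orbs g) = {(a, b). orb g a b}"
  unfolding orbs_def using finite_orb_starts[OF assms] the_orb_end by (auto simp: image_iff)

lemma orbs_unique:
  assumes "g \<in> PL_plus" "sorted_wrt (<) (map fst l)" "set l = {(a, b). orb g a b}"
  shows "l = orbs g"
proof -
  have "set (map fst l) = {a. \<exists>b. orb g a b}" using assms(3) by force
  then have fst_l: "map fst l = sorted_list_of_set {a. \<exists>b. orb g a b}"
    using assms(2) by (metis sorted_list_of_set.idem_if_sorted_distinct strict_sorted_iff)
  have "l = map (\<lambda>a. (a, THE b. orb g a b)) (map fst l)"
    unfolding map_map by (rule map_idI[symmetric]) (use assms(3) the_orb_end in auto)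
  then show ?thesis unfolding orbs_def fst_l[symmetric] .
qed

lemma orbs_Nil_iff:
  assumes "g \<in> PL_plus" shows "orbs g = [] \<longleftrightarrow> g = id"
proof
  assume "orbs g = []"
  then have no: "\<not> orb g a b" for a b using set_orbs[OF assms] by auto
  have "g x = x" for x
    using orb_at[OF PL_plus_plf[OF assms], of x] no by blast
  then show "g = id" by (simp add: fun_eq_iff)
next
  assume "g = id"
  then have "\<not> orb g a b" for a b using orbD(1)[of g a b] orbD(4)[of g a b "(a + b) / 2"] by auto
  then show "orbs g = []" using set_orbs[OF assms] by auto
qed

text \<open>A connected set of moved points that meets \<open>(a, b)\<close> cannot pass the fixed
  ends.\<close>

lemma orbitals_iff_orb:
  assumes "g \<in> PL_plus"
  shows "orbitals g = (\<lambda>(a, b). {a<..<b}) ` {(a, b). orb g a b}"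
proof -
  have comp: "{a<..<b} \<in> components (supp g)" if o: "orb g a b" for a b
    unfolding in_components_maximal
  proof (intro conjI allI impI)
    show "{a<..<b} \<noteq> {}" using orbD(1)[OF o] by simp
    show "{a<..<b} \<subseteq> supp g" using orbD(4)[OF o] PL_orb_unit[OF assms o] by (auto simp: supp_def)
    show "connected {a<..<b}" by simp
    fix d assume d: "d \<noteq> {} \<and> {a<..<b} \<subseteq> d \<and> d \<subseteq> supp g \<and> connected d"
    have nd: "a \<notin> d" "b \<notin> d" using d orbD(2,3)[OF o] by (auto simp: supp_def)
    define m where "m = (a + b) / 2"
    have "a < m" "m < b" using orbD(1)[OF o] by (auto simp: m_def)
    then have m: "m \<in> d" "a < m" "m < b" using d by auto
    have conv: "z \<in> d" if "x \<in> d" "y \<in> d" "x \<le> z" "z \<le> y" for x y z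
      using d connectedD_interval that by blast
    have "x \<in> {a<..<b}" if "x \<in> d" for x
      using conv[OF that m(1), of a] conv[OF m(1) that, of b] nd m by force
    then show "d = {a<..<b}" using d by blast
  qed
  show ?thesis
  proof (intro subset_antisym subsetI)
    fix c assume c: "c \<in> orbitals g"
    then obtain x where x: "x \<in> c" unfolding orbitals_def using in_components_nonempty by blast
    then have "x \<in> supp g" using c in_components_subset unfolding orbitals_def by blast
    then obtain a b where ab: "orb g a b" "a < x" "x < b"
      using orb_at[OF PL_plus_plf[OF assms]] by (auto simp: supp_def)
    have "c = {a<..<b}"
      using components_nonoverlap[of c "supp g" "{a<..<b}"] c comp[OF ab(1)] x ab unfolding orbitals_def by auto
    then show "c \<in> (\<lambda>(a, b). {a<..<b}) ` {(a, b). orb g a b}" using ab(1) by auto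
  qed (auto simp: orbitals_def intro: comp)
qed

lemma interval_eqD:
  fixes a b c d :: real
  assumes "{a<..<b} = {c<..<d}" "c < d" shows "a = c \<and> b = d"
proof -
  have "a < b" using assms by (metis greaterThanLessThan_empty_iff not_le)
  then show ?thesis
    using assms cInf_greaterThanLessThan[of a b] cInf_greaterThanLessThan[of c d]
      cSup_greaterThanLessThan[of a b] cSup_greaterThanLessThan[of c d] by metis
qed

section \<open>Words and bumps as numbers\<close>

lemma letter_in:
  assumes "set gs \<subseteq> PL_plus" shows "letter gs l \<in> generate PL_group (set gs)"
proof -
  have sub: "subgroup (generate PL_group (set gs)) PL_group" by (rule PL_generate_subgroup[OF assms])
  define g where "g = (case drop (fst (prod_decode l)) gs of [] \<Rightarrow> id | g # _ \<Rightarrow> g)"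
  have "g \<in> generate PL_group (set gs)"
  proof (cases "drop (fst (prod_decode l)) gs")
    case Nil
    then have "g = id" by (simp add: g_def)
    then show ?thesis using PL_mult_closed(3)[OF sub] by (simp only:)
  next
    case (Cons a list)
    then have "a \<in> set gs" by (metis in_set_dropD list.set_intros(1))
    then show ?thesis using Cons by (auto simp: g_def intro: generate.incl)
  qed
  then show ?thesis using PL_mult_closed(2)[OF sub] by (simp add: letter_def Let_def g_def[symmetric])
qed

lemma fold_letter:
  fixes f :: "real \<Rightarrow> real"
  shows "fold (\<lambda>l acc. letter gs l \<circ> acc) w f = word_val gs w \<circ> f"
proof (induction w arbitrary: f)
  case (Cons l w)
  have "word_val gs (l # w) = word_val gs w \<circ> letter gs l"
  proof -
    have "word_val gs (l # w) = fold (\<lambda>l acc. letter gs l \<circ> acc) w (letter gs l \<circ> id)"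
      by (simp only: word_val_def fold.simps o_apply)
    also have "\<dots> = word_val gs w \<circ> (letter gs l \<circ> id)" by (rule Cons)
    finally show ?thesis by (simp only: comp_id)
  qed
  then show ?case using Cons[of "letter gs l \<circ> f"] by (simp add: comp_assoc)
qed (simp add: word_val_def fun_eq_iff)

lemma word_val_append: "word_val gs (u @ v) = word_val gs v \<circ> word_val gs u"
  unfolding word_val_def[of gs "u @ v"] fold_append o_apply fold_letter by (simp add: fun_eq_iff)

lemma word_val_in:
  assumes "set gs \<subseteq> PL_plus" shows "word_val gs w \<in> generate PL_group (set gs)"
proof (induction w)
  case Nil
  have "word_val gs [] = id" by (simp add: word_val_def)
  then show ?case using PL_mult_closed(3)[OF PL_generate_subgroup[OF assms]] by (simp only:)
next
  case (Cons l w)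
  have "word_val gs (l # w) = word_val gs w \<circ> word_val gs [l]" using word_val_append[of gs "[l]" w] by simp
  moreover have "word_val gs [l] = letter gs l" by (simp add: word_val_def)
  ultimately show ?case using PL_mult_closed(1)[OF PL_generate_subgroup[OF assms] Cons letter_in[OF assms]] by (simp only:)
qed

lemma letter_ex:
  assumes "g \<in> set gs" shows "\<exists>l. letter gs l = g" "\<exists>l. letter gs l = finv g"
proof -
  obtain n where n: "n < length gs" "gs ! n = g" using assms by (auto simp: in_set_conv_nth)
  then have d: "drop n gs = g # drop (Suc n) gs" by (metis Cons_nth_drop_Suc)
  have "letter gs (prod_encode (n, 0)) = g" "letter gs (prod_encode (n, 1)) = finv g"
    by (simp_all add: letter_def d)
  then show "\<exists>l. letter gs l = g" "\<exists>l. letter gs l = finv g" by blast+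
qed

lemma word_val_ex:
  assumes "set gs \<subseteq> PL_plus" "g \<in> generate PL_group (set gs)" shows "\<exists>w. word_val gs w = g"
  using assms(2)
proof induction
  case one
  have "word_val gs [] = \<one>\<^bsub>PL_group\<^esub>" by (simp only: word_val_def fold.simps id_apply PL_group_simps)
  then show ?case by blast
next
  case (incl h)
  then obtain l where "letter gs l = h" using letter_ex(1) by blast
  then have "word_val gs [l] = h" by (simp add: word_val_def)
  then show ?case by blast
next
  case (inv h)
  then obtain l where "letter gs l = finv h" using letter_ex(2) by blast
  then have "word_val gs [l] = inv\<^bsub>PL_group\<^esub> h" using PL_group_inv[of h] inv assms(1) by (auto simp: word_val_def)
  then show ?case by blast
next
  case (eng h1 h2)
  then obtain u v where "word_val gs u = h1" "word_val gs v = h2" by blast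
  then have "word_val gs (u @ v) = h1 \<otimes>\<^bsub>PL_group\<^esub> h2" by (simp only: word_val_append PL_group_simps)
  then show ?case by blast
qed

lemma set_bump_fns: "set (bump_fns Y) = fn ` set Y"
proof -
  have "set (fold (\<lambda>i acc. fn i # acc) Y zs) = fn ` set Y \<union> set zs" for zs by (induction Y arbitrary: zs) auto
  then show ?thesis by (simp add: bump_fns_def)
qed

lemma set_bumps:
  "i \<in> set (bumps gs es) \<longleftrightarrow> (\<exists>e\<in>set es. entry_bumps gs e \<noteq> [] \<and>
     i = (fst (prod_decode e), hd (entry_bumps gs e),
           clip (fst (hd (entry_bumps gs e))) (snd (hd (entry_bumps gs e))) (entry_val gs e)))"
proof -
  let ?f = "\<lambda>e. (fst (prod_decode e), hd (entry_bumps gs e),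
           clip (fst (hd (entry_bumps gs e))) (snd (hd (entry_bumps gs e))) (entry_val gs e))"
  have "i \<in> set (fold (\<lambda>e acc. if entry_bumps gs e = [] then acc else ?f e # acc) es zs) \<longleftrightarrow>
     i \<in> set zs \<or> (\<exists>e\<in>set es. entry_bumps gs e \<noteq> [] \<and> i = ?f e)" for zs
    by (induction es arbitrary: zs) (simp, simp only: fold.simps o_apply, auto)
  then show ?thesis by (simp add: bumps_def)
qed

lemma bumps_are_bumps_of:
  assumes gs: "set gs \<subseteq> PL_plus" and i: "i \<in> set (bumps gs es)"
  shows "\<exists>w\<in>generate PL_group (set gs). orb w (lo i) (hi i) \<and> fn i = clip (lo i) (hi i) w"
proof -
  obtain e where e: "entry_bumps gs e \<noteq> []" "i = (fst (prod_decode e), hd (entry_bumps gs e),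
           clip (fst (hd (entry_bumps gs e))) (snd (hd (entry_bumps gs e))) (entry_val gs e))"
    using i set_bumps by blast
  have w: "entry_val gs e \<in> generate PL_group (set gs)" unfolding entry_val_def by (rule word_val_in[OF gs])
  then have "entry_val gs e \<in> PL_plus" using PL_subgroupD(2)[OF PL_generate_subgroup[OF gs]] by blast
  moreover have "hd (entry_bumps gs e) \<in> set (orbs (entry_val gs e))"
    using e(1) unfolding entry_bumps_def by (metis in_set_dropD list.set_sel(1))
  ultimately have "orb (entry_val gs e) (lo i) (hi i)" using set_orbs e(2) by (auto simp: case_prod_beta)
  then show ?thesis using w e(2) by auto
qed

lemma bumps_ex:
  assumes gs: "set gs \<subseteq> PL_plus" and Y: "finite Y"
    "\<And>i. i \<in> Y \<Longrightarrow> \<exists>w\<in>generate PL_group (set gs). orb w (lo i) (hi i) \<and> fn i = clip (lo i) (hi i) w"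
  shows "\<exists>es. set (bumps gs es) = Y"
proof -
  have "\<exists>e. entry_bumps gs e \<noteq> [] \<and> i = (fst (prod_decode e), hd (entry_bumps gs e),
           clip (fst (hd (entry_bumps gs e))) (snd (hd (entry_bumps gs e))) (entry_val gs e))" if i: "i \<in> Y" for i
  proof -
    obtain w where w: "w \<in> generate PL_group (set gs)" "orb w (lo i) (hi i)" "fn i = clip (lo i) (hi i) w" using Y(2)[OF i] by blast
    obtain u where u: "word_val gs u = w" using word_val_ex[OF gs w(1)] by blast
    have "w \<in> PL_plus" using w(1) PL_subgroupD(2)[OF PL_generate_subgroup[OF gs]] by blast
    then have "(lo i, hi i) \<in> set (orbs w)" using set_orbs w(2) by auto
    then obtain j where j: "j < length (orbs w)" "orbs w ! j = (lo i, hi i)" by (auto simp: in_set_conv_nth)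
    define e where "e = prod_encode (lab i, prod_encode (list_encode u, j))"
    have ev: "entry_val gs e = w" by (simp add: entry_val_def e_def u)
    have "entry_bumps gs e = (lo i, hi i) # drop (Suc j) (orbs w)"
      unfolding entry_bumps_def ev using j by (simp add: e_def Cons_nth_drop_Suc[symmetric])
    then have "entry_bumps gs e \<noteq> [] \<and> i = (fst (prod_decode e), hd (entry_bumps gs e),
           clip (fst (hd (entry_bumps gs e))) (snd (hd (entry_bumps gs e))) (entry_val gs e))"
      unfolding ev using w(3) by (simp add: e_def prod_eq_iff)
    then show ?thesis by blast
  qed
  then obtain E where E: "\<And>i. i \<in> Y \<Longrightarrow> entry_bumps gs (E i) \<noteq> [] \<and> i = (fst (prod_decode (E i)), hd (entry_bumps gs (E i)),
           clip (fst (hd (entry_bumps gs (E i)))) (snd (hd (entry_bumps gs (E i)))) (entry_val gs (E i)))" by metis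
  obtain ys where ys: "set ys = Y" using finite_list[OF Y(1)] by blast
  have "set (bumps gs (map E ys)) = Y"
  proof (intro subset_antisym subsetI)
    fix i assume "i \<in> set (bumps gs (map E ys))"
    then show "i \<in> Y" unfolding set_bumps using E ys by auto
  next
    fix i assume "i \<in> Y"
    then show "i \<in> set (bumps gs (map E ys))" unfolding set_bumps using E[of i] ys by auto
  qed
  then show ?thesis by blast
qed

section \<open>The derived length read off a bump system\<close>

lemma exp_derived_consistent:
  assumes "subgroup H PL_group"
  shows "(derived (PL_group\<lparr>carrier := H\<rparr>) ^^ n) H = (derived PL_group ^^ n) H \<and> (derived PL_group ^^ n) H \<subseteq> H"
proof (induction n)
  case (Suc n)
  then have sub: "(derived PL_group ^^ n) H \<subseteq> H" by blast
  have "derived (PL_group\<lparr>carrier := H\<rparr>) ((derived PL_group ^^ n) H) = derived PL_group ((derived PL_group ^^ n) H)"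
    by (rule group.derived_consistent[OF group_PL sub assms])
  moreover have "derived PL_group ((derived PL_group ^^ n) H) \<subseteq> H"
    by (rule group.derived_incl[OF group_PL sub assms])
  ultimately show ?case using Suc by simp
qed simp

lemma solvable_generated_iff:
  assumes "X \<subseteq> PL_plus"
  shows "solvable (generated_group X) \<longleftrightarrow> (\<exists>n. (derived PL_group ^^ n) (generate PL_group X) = {id})"
    "derived_length (generated_group X) = (LEAST n. (derived PL_group ^^ n) (generate PL_group X) = {id})"
proof -
  let ?H = "generate PL_group X"
  have H: "subgroup ?H PL_group" by (rule PL_generate_subgroup[OF assms])
  interpret G: group "generated_group X"
    unfolding generated_group_def by (rule group.subgroup_imp_group[OF group_PL H])
  have "(derived (generated_group X) ^^ n) (carrier (generated_group X)) = (derived PL_group ^^ n) ?H" for n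
    using exp_derived_consistent[OF H] by (simp add: generated_group_def)
  moreover have "\<one>\<^bsub>generated_group X\<^esub> = id" by (simp add: generated_group_def PL_group_simps)
  ultimately show "solvable (generated_group X) \<longleftrightarrow> (\<exists>n. (derived PL_group ^^ n) ?H = {id})"
    "derived_length (generated_group X) = (LEAST n. (derived PL_group ^^ n) ?H = {id})"
    using G.solvable_iff_trivial_derived_seq unfolding derived_length_def by metis+
qed

lemma chain_not_solvable:
  assumes "X \<subseteq> PL_plus" "has_chain (generate PL_group X)" shows "\<not> solvable (generated_group X)"
  using soluble_no_chain[OF PL_generate_subgroup[OF assms(1)]] assms solvable_generated_iff(1) by blast

text \<open>Following the links downwards from label \<open>m\<close> meets every label down to 0,
  which makes \<open>Suc m\<close> nested orbitals.\<close>

lemma linked_tower: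
  assumes "linked Y" "\<And>i. i \<in> Y \<Longrightarrow> \<exists>w\<in>H. orb w (lo i) (hi i)" "i \<in> Y" "lab i = m"
  shows "tower H (Suc m) (lo i) (hi i)"
  using assms(3,4)
proof (induction m arbitrary: i)
  case 0
  then obtain w where "w \<in> H" "orb w (lo i) (hi i)" using assms(2) by blast
  then show ?case using tower_1 by (metis One_nat_def)
next
  case (Suc m)
  obtain w where w: "w \<in> H" "orb w (lo i) (hi i)" using assms(2) Suc.prems(1) by blast
  obtain j where j: "j \<in> Y" "inside j i" "lab j = m" using assms(1) Suc.prems unfolding linked_def by blast
  show ?case unfolding tower.simps(2)[of H "Suc m"]
    using w j(2) Suc.IH[OF j(1,3)] unfolding inside_def by blast
qed

text \<open>The upper bound is inherited from the larger group \<open>gens Y\<close>. It shows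
  solubility and thereby excludes chains, which the lower bound from a tower of height
  \<open>n\<close> in the group itself requires.\<close>

lemma derived_length_eq:
  assumes X: "X \<subseteq> PL_plus" and Y: "bump_system Y" "linked Y" "X \<subseteq> gens Y"
    and prov: "\<And>i. i \<in> Y \<Longrightarrow> \<exists>w\<in>generate PL_group X. orb w (lo i) (hi i)"
    and n: "\<And>i. i \<in> Y \<Longrightarrow> lab i < n" "n = 0 \<or> (\<exists>i\<in>Y. Suc (lab i) = n)"
  shows "solvable (generated_group X)" "derived_length (generated_group X) = n"
proof -
  let ?H = "generate PL_group X"
  have H: "subgroup ?H PL_group" by (rule PL_generate_subgroup[OF X])
  have HY: "?H \<subseteq> gens Y" by (rule PL_generate_least[OF PL_generate_subgroup[OF bump_system_PL[OF Y(1)]] Y(3)])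
  have one: "id \<in> (derived PL_group ^^ k) ?H" for k
    using subgroup.one_closed[OF group.exp_of_derived_is_subgroup[OF group_PL H, of k]] by (simp only: PL_group_simps)
  have "(derived PL_group ^^ n) ?H \<subseteq> (derived PL_group ^^ n) (gens Y)" by (rule group.mono_exp_of_derived[OF group_PL HY])
  also have "\<dots> = {id}" by (rule bump_system_derived[OF Y(1) n(1)])
  finally have upper: "(derived PL_group ^^ n) ?H = {id}" using one[of n] by blast
  then show "solvable (generated_group X)" using solvable_generated_iff(1)[OF X] by blast
  have nc: "\<not> has_chain ?H" by (rule soluble_no_chain[OF H upper])
  have lower: "n \<le> k" if k: "(derived PL_group ^^ k) ?H = {id}" for k
  proof (rule ccontr)
    assume "\<not> n \<le> k"
    then obtain m where m: "n = Suc m" "k \<le> m" by (metis Suc_le_D not_less_eq_eq)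
    then obtain i where "i \<in> Y" "lab i = m" using n(2) by auto
    then have "tower ?H (Suc m) (lo i) (hi i)" using linked_tower[OF Y(2) prov] by blast
    then have "(derived PL_group ^^ m) ?H \<noteq> {id}" by (rule tower_derived_nontrivial[OF H nc])
    \<comment> \<open>A derived series that has become trivial stays so, hence triviality at
      \<open>k\<close> passes on to \<open>m\<close>.\<close>
    moreover have "(derived PL_group ^^ j) {id} \<subseteq> {id}" for j
    proof -
      have "subgroup {id} PL_group" using group.triv_subgroup[OF group_PL] by (simp only: PL_group_simps)
      then show ?thesis using exp_derived_consistent by blast
    qed
    then have "(derived PL_group ^^ (m - k)) ((derived PL_group ^^ k) ?H) \<subseteq> {id}" unfolding k .
    then have "(derived PL_group ^^ m) ?H \<subseteq> {id}" using m(2) by (metis comp_apply funpow_add le_add_diff_inverse2)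
    ultimately show False using one[of m] by blast
  qed
  show "derived_length (generated_group X) = n"
    unfolding solvable_generated_iff(2)[OF X] by (rule Least_equality, rule upper, erule lower)
qed

definition answer :: "(real \<Rightarrow> real) set \<Rightarrow> nat" where
  "answer X = (if solvable (generated_group X) then Suc (derived_length (generated_group X)) else 0)"

text \<open>Passing the check determines the output, so it does not matter which of the many
  certificates is found.\<close>

lemma certificate_sound:
  assumes gs: "set gs \<subseteq> PL_plus" and k: "certificate gs k"
  shows "fst (prod_decode k) = answer (set gs)"
proof -
  define out where "out = fst (prod_decode k)"
  obtain a b where ab: "(out = 0 \<and> chain_check gs a b) \<or> (0 < out \<and> bump_check gs (out - 1) a b)"
    using k unfolding certificate_def Let_def out_def by blast
  show ?thesis
  proof (cases "out = 0")
    case True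
    then have "chain_check gs a b" using ab by simp
    moreover have w: "word_val gs u \<in> generate PL_group (set gs)" "word_val gs u \<in> PL_plus" for u
      using word_val_in[OF gs] PL_subgroupD(2)[OF PL_generate_subgroup[OF gs]] by blast+
    ultimately obtain p q r s where "orb (word_val gs a) p q" "orb (word_val gs b) r s" "p < r" "r < q" "q < s"
      unfolding chain_check_def set_orbs[OF w(2)] by auto
    then have "has_chain (generate PL_group (set gs))" using has_chainI w(1) by blast
    then show ?thesis using chain_not_solvable[OF gs] True by (simp add: answer_def out_def)
  next
    case False
    define Y where "Y = bumps gs a"
    have ch: "height_check (out - 1) Y" "compatible_check Y"
      "\<And>g. g \<in> set gs \<Longrightarrow> \<exists>v\<in>set b. g = word_val (bump_fns Y) (list_decode v)"
      using ab False unfolding bump_check_def Y_def by auto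
    have prov: "\<exists>w\<in>generate PL_group (set gs). orb w (lo i) (hi i) \<and> fn i = clip (lo i) (hi i) w" if "i \<in> set Y" for i
      using bumps_are_bumps_of[OF gs] that unfolding Y_def by blast
    have "is_bump i" if i: "i \<in> set Y" for i
    proof -
      obtain w where w: "w \<in> generate PL_group (set gs)" "orb w (lo i) (hi i)" "fn i = clip (lo i) (hi i) w"
        using prov[OF i] by blast
      have "is_bump (lab i, (lo i, hi i), clip (lo i) (hi i) w)"
        by (rule is_bump_clip[OF PL_subgroupD(2)[OF PL_generate_subgroup[OF gs] w(1)] w(2)])
      then show ?thesis unfolding w(3)[symmetric] by simp
    qed
    moreover have "compatible (set Y)" using ch(2) by (simp only: compatible_def compatible_check_def)
    ultimately have sys: "bump_system (set Y)" by (simp add: bump_system_def)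
    have "linked (set Y)"
      unfolding linked_def
    proof (intro ballI allI impI)
      fix i m assume "i \<in> set Y" "lab i = Suc m"
      then show "\<exists>j\<in>set Y. inside j i \<and> lab j = m"
        using ch(1) unfolding height_check_def by (metis Suc_inject Zero_not_Suc)
    qed
    moreover have "set gs \<subseteq> gens (set Y)"
    proof
      fix g assume "g \<in> set gs"
      then obtain v where "g = word_val (bump_fns Y) (list_decode v)" using ch(3) by blast
      then show "g \<in> gens (set Y)"
        using word_val_in[of "bump_fns Y"] bump_system_PL[OF sys] by (simp add: set_bump_fns)
    qed
    ultimately have "solvable (generated_group (set gs))" "derived_length (generated_group (set gs)) = out - 1"
      using derived_length_eq[OF gs sys, of "out - 1"] prov ch(1) unfolding height_check_def by blast+
    then show ?thesis using False by (simp add: answer_def out_def)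
  qed
qed

lemma clip_unit: "g \<in> PL_plus \<Longrightarrow> clip 0 1 g = g"
  using PL_plusD(3)[of g] PL_plus_0_1[of g] unfolding clip_def fun_eq_iff
  by (metis atLeastAtMost_iff order.order_iff_strict)

text \<open>In the absence of chains the resolution is applied to the whole unit interval: its ends
  are fixed by all generators, and breaks bound the height of towers.\<close>

lemma certificate_complete:
  assumes gs: "set gs \<subseteq> PL_plus" shows "\<exists>k. certificate gs k"
proof (cases "has_chain (generate PL_group (set gs))")
  case True
  then obtain g h p q r s where gh: "g \<in> generate PL_group (set gs)" "h \<in> generate PL_group (set gs)"
    and o: "orb g p q" "orb h r s" "p < r" "r < q" "q < s" unfolding has_chain_def by blast
  obtain u v where uv: "word_val gs u = g" "word_val gs v = h" using word_val_ex[OF gs] gh by metis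
  have "g \<in> PL_plus" "h \<in> PL_plus" using gh PL_subgroupD(2)[OF PL_generate_subgroup[OF gs]] by blast+
  then have "(p, q) \<in> set (orbs (word_val gs u))" "(r, s) \<in> set (orbs (word_val gs v))"
    using o uv set_orbs by auto
  then have "chain_check gs u v" unfolding chain_check_def using o by force
  then have "certificate gs (prod_encode (0, prod_encode (list_encode u, list_encode v)))"
    unfolding certificate_def by simp
  then show ?thesis by blast
next
  case False
  let ?X = "set gs"
  obtain N where N: "\<And>n a b. tower (generate PL_group ?X) n a b \<Longrightarrow> n \<le> N"
    using tower_bounded[OF _ gs False] by blast
  have "\<exists>Y. resolves Y ?X 0 1"
    by (rule resolves_exists[OF _ gs False, of 0 1 N]) (use gs PL_plus_0_1 N in auto)
  then obtain Y where res: "resolves Y ?X 0 1" by blast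
  then have "clip 0 1 x \<in> gens Y" if "x \<in> ?X" for x using that unfolding resolves_def by blast
  moreover have "clip 0 1 x = x" if "x \<in> ?X" for x using clip_unit gs that by blast
  ultimately have Y: "finite Y" "bump_system Y" "linked Y" "Y \<subseteq> bumps_of (generate PL_group ?X) 0 1"
    "\<And>x. x \<in> ?X \<Longrightarrow> x \<in> gens Y"
    using res unfolding resolves_def by simp_all
  have prov: "\<exists>w\<in>generate PL_group ?X. orb w (lo i) (hi i) \<and> fn i = clip (lo i) (hi i) w" if "i \<in> Y" for i
    using Y(4) that unfolding bumps_of_def by blast
  obtain es where es: "set (bumps gs es) = Y" using bumps_ex[OF gs Y(1) prov] by blast
  define n where "n = (if Y = {} then 0 else Suc (Max (lab ` Y)))"
  have "lab i < n" if "i \<in> Y" for i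
  proof -
    have "lab i \<le> Max (lab ` Y)" using Y(1) that by (intro Max_ge) auto
    then show ?thesis using that by (auto simp: n_def)
  qed
  moreover have "n = 0 \<or> (\<exists>i\<in>Y. Suc (lab i) = n)"
  proof (cases "Y = {}")
    case False
    have "Max (lab ` Y) \<in> lab ` Y" using Y(1) False by (intro Max_in) auto
    then obtain i where "Max (lab ` Y) = lab i" "i \<in> Y" by (rule imageE)
    then show ?thesis using False by (auto simp: n_def)
  qed (simp add: n_def)
  moreover have "lab i = 0 \<or> (\<exists>j\<in>Y. inside j i \<and> Suc (lab j) = lab i)" if "i \<in> Y" for i
    using Y(3) that unfolding linked_def by (cases "lab i") auto
  ultimately have "height_check n (bumps gs es)" unfolding height_check_def es by blast
  moreover have "compatible_check (bumps gs es)"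
    using Y(2) unfolding bump_system_def compatible_def compatible_check_def es by blast
  moreover have "\<exists>vs. \<forall>g\<in>?X. \<exists>v\<in>set vs. g = word_val (bump_fns (bumps gs es)) (list_decode v)"
  proof -
    have "set (bump_fns (bumps gs es)) \<subseteq> PL_plus" using bump_system_PL[OF Y(2)] by (simp add: set_bump_fns es)
    then have "\<exists>v. g = word_val (bump_fns (bumps gs es)) (list_decode v)" if "g \<in> ?X" for g
      using word_val_ex[of "bump_fns (bumps gs es)" g] Y(5)[OF that] by (metis set_bump_fns es list_encode_inverse)
    then obtain V where "\<And>g. g \<in> ?X \<Longrightarrow> g = word_val (bump_fns (bumps gs es)) (list_decode (V g))" by metis
    then have "\<forall>g\<in>?X. \<exists>v\<in>set (map V gs). g = word_val (bump_fns (bumps gs es)) (list_decode v)" by auto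
    then show ?thesis by blast
  qed
  ultimately obtain vs where "bump_check gs n es vs" unfolding bump_check_def by blast
  then have "certificate gs (prod_encode (Suc n, prod_encode (list_encode es, list_encode vs)))"
    unfolding certificate_def by simp
  then show ?thesis by blast
qed


section \<open>Realizing the search\<close>

lemma realizable_Bex_list:
  assumes "realizable R (rep_list A) L" "realizable (rep_prod R A) rep_bool P"
  shows "realizable R rep_bool (\<lambda>x. \<exists>a\<in>set (L x). P (x, a))"
  by (rule realizable_Bex_set[OF assms(1)]) (use assms(2) in simp)

section \<open>Realizers supplied by the data structure\<close>

context computable_subgroup
begin

text \<open>Codes of elements outside the split group may exist, and nothing can be computed from
  them; so membership in \<open>K\<close> is made part of being a code. Here \<open>K\<close> is
  \<open>C\<close> or \<open>S\<close>.\<close>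

definition rep_elem :: "(real \<Rightarrow> real) set \<Rightarrow> nat \<Rightarrow> (real \<Rightarrow> real) \<Rightarrow> bool" where
  "rep_elem K c g \<longleftrightarrow> \<nu> c = Some g \<and> g \<in> K"

definition rep_point :: "nat \<Rightarrow> real \<Rightarrow> bool" where
  "rep_point c x \<longleftrightarrow> \<delta> c = Some x"

abbreviation "S \<equiv> split_group C"

lemma C_PL: "C \<subseteq> PL_plus"
  using PL_subgroupD(2)[OF subgroup] by blast

lemma bump_in_S:
  assumes "g \<in> C" "orb g a b" shows "clip a b g \<in> S"
proof -
  have "{a<..<b} \<in> orbitals g" using orbitals_iff_orb[of g] assms C_PL by auto
  then show ?thesis
    unfolding split_group_def using assms(1) clip_one_bump[of a b g, symmetric] by (intro generate.incl) blast
qed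

lemma bumps_PL: "{one_bump_factor A g | A g. g \<in> C \<and> A \<in> orbitals g} \<subseteq> PL_plus"
proof clarify
  fix A g assume g: "g \<in> C" "A \<in> orbitals g"
  then have gp: "g \<in> PL_plus" using C_PL by blast
  then obtain a b where ab: "orb g a b" "A = {a<..<b}" using g(2) orbitals_iff_orb by auto
  then show "one_bump_factor A g \<in> PL_plus"
    using is_bumpD(1)[OF is_bump_clip[OF gp ab(1)]] by (simp add: clip_one_bump)
qed

lemma S_sub: "subgroup S PL_group"
  unfolding split_group_def by (rule PL_generate_subgroup[OF bumps_PL])

lemma S_PL: "S \<subseteq> PL_plus"
  using PL_subgroupD(2)[OF S_sub] by blast

text \<open>An element is the product of its finitely many one-bump factors.\<close>

lemma C_sub_S: "C \<subseteq> S"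
proof
  fix g assume g: "g \<in> C"
  then have gp: "g \<in> PL_plus" using C_PL by blast
  note gi = PL_plusD(1,2)[OF gp]
  define cl where "cl = (\<lambda>T z. if \<exists>(a, b)\<in>T. a < z \<and> z < b then g z else z)"
  let ?A = "{(a, b). orb g a b}"
  have "cl T \<in> S" if "T \<subseteq> ?A" for T
  proof -
    have "finite T" using finite_orbs[OF gp] that by (rule finite_subset[rotated])
    then show ?thesis using that
    proof (induction T)
      case empty
      have "cl {} = id" by (simp add: cl_def fun_eq_iff)
      then show ?case using PL_mult_closed(3)[OF S_sub] by (simp only:)
    next
      case (insert k T)
      obtain a b where ab: "k = (a, b)" "orb g a b" using insert.prems by (cases k) auto
      have e: "cl (insert k T) = cl T \<circ> clip a b g"
      proof
        fix z
        show "cl (insert k T) z = (cl T \<circ> clip a b g) z"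
        proof (cases "a < z \<and> z < b")
          case True
          have gz: "a < g z" "g z < b" using incr_orb_maps[OF gi ab(2)] True by auto
          have "\<not> (\<exists>(c, d)\<in>T. c < g z \<and> g z < d)"
          proof
            assume "\<exists>(c, d)\<in>T. c < g z \<and> g z < d"
            then obtain c d where cd: "(c, d) \<in> T" "c < g z" "g z < d" by blast
            then have o: "orb g c d" using insert.prems by auto
            have "\<not> a < c" "\<not> c < a" "\<not> b < d" "\<not> d < b"
              using orbD(2,3)[OF o] orbD(2,3)[OF ab(2)] orbD(4)[OF o] orbD(4)[OF ab(2)] gz cd by (meson less_trans)+
            then have "(c, d) = k" using ab by simp
            then show False using cd(1) insert.hyps by simp
          qed
          then show ?thesis using True ab by (simp add: cl_def clip_def)
        next
          case False
          then show ?thesis using ab by (auto simp: cl_def clip_def)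
        qed
      qed
      show ?case unfolding e
        by (rule PL_mult_closed(1)[OF S_sub]) (use insert bump_in_S[OF g ab(2)] in auto)
    qed
  qed
  moreover have "cl ?A = g"
  proof
    fix z
    show "cl ?A z = g z"
    proof (cases "g z = z")
      case False
      then show ?thesis using orb_at[OF PL_plus_plf[OF gp] False] unfolding cl_def by (smt (verit) case_prodI mem_Collect_eq)
    qed (simp add: cl_def)
  qed
  ultimately show "g \<in> S" by (metis order_refl)
qed

lemma rep_elem_mono: "K \<subseteq> K' \<Longrightarrow> rep_elem K c g \<Longrightarrow> rep_elem K' c g"
  by (auto simp: rep_elem_def)

text \<open>Taken with \<open>K = C\<close> for words in the input, whose membership in
  \<open>C\<close> allows cutting, and with \<open>K = S\<close> for words in bumps.\<close>

lemma realizable_mult: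
  assumes K: "subgroup K PL_group" "K \<subseteq> S"
    and "realizable R (rep_elem K) \<phi>" "realizable R (rep_elem K) \<psi>"
  shows "realizable R (rep_elem K) (\<lambda>x. \<psi> x \<circ> \<phi> x)"
proof (rule realizable_comp2[OF _ assms(3,4), of "rep_elem K" "\<lambda>g h. h \<circ> g"])
  obtain f where f: "partial_recursive f"
    "\<And>c d g h. g \<in> S \<Longrightarrow> h \<in> S \<Longrightarrow> \<nu> c = Some g \<Longrightarrow> \<nu> d = Some h \<Longrightarrow>
       \<exists>e. f (prod_encode (c, d)) = Some e \<and> \<nu> e = Some (g \<otimes>\<^bsub>PL_group\<^esub> h)"
    using product by blast
  show "realizable (rep_prod (rep_elem K) (rep_elem K)) (rep_elem K) (\<lambda>z. snd z \<circ> fst z)"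
  proof (rule realizableI[OF f(1)])
    fix c z assume "rep_prod (rep_elem K) (rep_elem K) c z"
    then obtain a b where ab: "c = prod_encode (a, b)" "\<nu> a = Some (fst z)" "fst z \<in> K" "\<nu> b = Some (snd z)" "snd z \<in> K"
      by (auto simp: rep_prod_def rep_elem_def)
    then obtain e where "f c = Some e" "\<nu> e = Some (snd z \<circ> fst z)"
      using f(2)[of "fst z" "snd z" a b] K(2) by (auto simp only: PL_group_simps)
    then show "\<exists>e. f c = Some e \<and> rep_elem K e (snd z \<circ> fst z)"
      using PL_mult_closed(1)[OF K(1) ab(5,3)] by (auto simp only: rep_elem_def)
  qed
qed

lemma realizable_finv:
  assumes K: "subgroup K PL_group" "K \<subseteq> S" and "realizable R (rep_elem K) \<phi>"
  shows "realizable R (rep_elem K) (\<lambda>x. finv (\<phi> x))"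
proof (rule realizable_comp[OF _ assms(3)])
  obtain f where f: "partial_recursive f"
    "\<And>c g. g \<in> S \<Longrightarrow> \<nu> c = Some g \<Longrightarrow> \<exists>e. f c = Some e \<and> \<nu> e = Some (inv\<^bsub>PL_group\<^esub> g)"
    using inverse by blast
  show "realizable (rep_elem K) (rep_elem K) finv"
  proof (rule realizableI[OF f(1)])
    fix c g assume g: "rep_elem K c g"
    then have "g \<in> PL_plus" using PL_subgroupD(2)[OF K(1)] by (simp add: rep_elem_def)
    then have "inv\<^bsub>PL_group\<^esub> g = finv g" by (rule PL_group_inv)
    then show "\<exists>e. f c = Some e \<and> rep_elem K e (finv g)"
      using g f(2)[of g c] K(2) PL_mult_closed(2)[OF K(1)] by (auto simp: rep_elem_def)
  qed
qed

lemma realizable_elem_id: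
  assumes "subgroup K PL_group" "K \<subseteq> S" shows "realizable R (rep_elem K) (\<lambda>_. id)"
proof -
  have id: "id \<in> K" by (rule PL_mult_closed(3)[OF assms(1)])
  then obtain c where "\<nu> c = Some id" using elements_represented(1) assms(2) unfolding ran_def by blast
  then have "rep_elem K c id" using id by (simp only: rep_elem_def)
  from realizable_const[of "rep_elem K", OF this] show ?thesis .
qed

text \<open>The order and the set of intervals determine the answer of the process
  completely.\<close>

lemma realizable_orbs:
  assumes "K \<subseteq> S" "realizable R (rep_elem K) \<phi>"
  shows "realizable R (rep_list (rep_prod rep_point rep_point)) (\<lambda>x. orbs (\<phi> x))"
proof (rule realizable_comp[OF _ assms(2)])
  obtain f where f: "partial_recursive f"
    and spec: "\<forall>c g. g \<in> S \<and> \<nu> c = Some g \<longrightarrow>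
        (\<exists>ps as. f c = Some (list_encode (map prod_encode ps)) \<and>
               list_all2 (\<lambda>(p, q) (a, b). \<delta> p = Some a \<and> \<delta> q = Some b) ps as \<and>
               sorted_wrt (<) (map fst as) \<and> (\<lambda>(a, b). {a<..<b}) ` set as = orbitals g)"
    using orbitals by (elim exE conjE)
  show "realizable (rep_elem K) (rep_list (rep_prod rep_point rep_point)) orbs"
  proof (rule realizableI[OF f])
    fix c g assume "rep_elem K c g"
    then have g: "g \<in> S" "\<nu> c = Some g" using assms(1) by (auto simp: rep_elem_def)
    have gp: "g \<in> PL_plus" using g(1) S_PL by blast
    obtain ps l where l: "f c = Some (list_encode (map prod_encode ps))"
      "list_all2 (\<lambda>(p, q) (a, b). \<delta> p = Some a \<and> \<delta> q = Some b) ps l"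
      "sorted_wrt (<) (map fst l)" "(\<lambda>(a, b). {a<..<b}) ` set l = orbitals g" using spec[rule_format, OF conjI[OF g]] by (elim exE conjE)
    have im: "(\<lambda>(a, b). {a<..<b}) ` set l = (\<lambda>(a, b). {a<..<b}) ` {(a, b). orb g a b}"
      using l(4) orbitals_iff_orb[OF gp] by simp
    have "set l = {(a, b). orb g a b}"
    proof (intro subset_antisym subsetI)
      fix k assume k: "k \<in> set l"
      obtain a b where ab: "k = (a, b)" by (cases k)
      have "{a<..<b} \<in> (\<lambda>(a, b). {a<..<b}) ` {(a, b). orb g a b}" unfolding im[symmetric] using k ab by force
      then obtain a' b' where "orb g a' b'" "{a<..<b} = {a'<..<b'}" by auto
      then show "k \<in> {(a, b). orb g a b}" using interval_eqD orbD(1) ab by blast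
    next
      fix k assume k: "k \<in> {(a, b). orb g a b}"
      obtain a b where ab: "k = (a, b)" by (cases k)
      have "{a<..<b} \<in> (\<lambda>(a, b). {a<..<b}) ` set l" unfolding im using k ab by force
      then obtain a' b' where "(a', b') \<in> set l" "{a'<..<b'} = {a<..<b}" by auto
      moreover have "a < b" using k ab orbD(1) by auto
      ultimately show "k \<in> set l" using interval_eqD ab by blast
    qed
    then have "l = orbs g" by (rule orbs_unique[OF gp l(3)])
    moreover have "list_all2 (rep_prod rep_point rep_point) (map prod_encode ps) l"
      unfolding list_all2_map1
      by (rule list_all2_mono[OF l(2)]) (auto simp: rep_prod_def rep_point_def)
    ultimately show "\<exists>e. f c = Some e \<and> rep_list (rep_prod rep_point rep_point) e (orbs g)"
      using l(1) unfolding rep_list_def by blast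
  qed
qed

text \<open>Restricted to elements of \<open>C\<close>: their factors lie in \<open>S\<close> by the
  definition of the split group, so the code obtained is one that can be used further.\<close>

lemma realizable_clip:
  "realizable (rep_sub (rep_prod (rep_prod rep_point rep_point) (rep_elem C)) (\<lambda>z. orb (snd z) (fst (fst z)) (snd (fst z))))
     (rep_elem S) (\<lambda>z. clip (fst (fst z)) (snd (fst z)) (snd z))"
proof -
  obtain f where f: "partial_recursive f"
    "\<And>p q c a b g. g \<in> S \<and> \<nu> c = Some g \<and> \<delta> p = Some a \<and> \<delta> q = Some b \<and> {a<..<b} \<in> orbitals g \<Longrightarrow>
            (\<exists>e. f (prod_encode (prod_encode (p, q), c)) = Some e \<and> \<nu> e = Some (one_bump_factor {a<..<b} g))"
    using factor by blast
  show ?thesis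
  proof (rule realizableI[OF f(1)])
    fix c z
    assume "rep_sub (rep_prod (rep_prod rep_point rep_point) (rep_elem C)) (\<lambda>z. orb (snd z) (fst (fst z)) (snd (fst z))) c z"
    then obtain p q d where c: "c = prod_encode (prod_encode (p, q), d)" "\<delta> p = Some (fst (fst z))" "\<delta> q = Some (snd (fst z))"
      "\<nu> d = Some (snd z)" "snd z \<in> C" "orb (snd z) (fst (fst z)) (snd (fst z))"
      unfolding rep_sub_def rep_prod_def rep_point_def rep_elem_def by auto
    have "{fst (fst z)<..<snd (fst z)} \<in> orbitals (snd z)"
      using c(5,6) C_PL orbitals_iff_orb[of "snd z"] by auto
    then obtain e where e: "f c = Some e" "\<nu> e = Some (clip (fst (fst z)) (snd (fst z)) (snd z))"
      using f(2)[of "snd z" d p "fst (fst z)" q "snd (fst z)"] c C_sub_S by (auto simp: clip_one_bump)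
    then show "\<exists>e. f c = Some e \<and> rep_elem S e (clip (fst (fst z)) (snd (fst z)) (snd z))"
      using bump_in_S[OF c(5,6)] by (simp add: rep_elem_def)
  qed
qed

lemma realizable_action:
  assumes "realizable R (rep_elem S) \<phi>" "realizable R rep_point p"
  shows "realizable R rep_point (\<lambda>x. \<phi> x (p x))"
proof (rule realizable_comp2[OF _ assms, of rep_point "\<lambda>g x. g x"])
  obtain f where f: "partial_recursive f"
    "\<And>c p g x. g \<in> S \<and> \<nu> c = Some g \<and> \<delta> p = Some x \<Longrightarrow> \<exists>q. f (prod_encode (c, p)) = Some q \<and> \<delta> q = Some (g x)"
    using action by blast
  show "realizable (rep_prod (rep_elem S) rep_point) rep_point (\<lambda>z. fst z (snd z))"
    by (rule realizableI[OF f(1)]) (auto simp: rep_prod_def rep_elem_def rep_point_def f(2))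
qed

lemma realizable_point_less:
  assumes "realizable R rep_point p" "realizable R rep_point q"
  shows "realizable R rep_bool (\<lambda>x. p x < q x)"
proof -
  obtain f where f: "partial_recursive f"
    "\<And>p q a b. \<delta> p = Some a \<and> \<delta> q = Some b \<Longrightarrow> f (prod_encode (p, q)) = Some (ordering_code a b)"
    using compare_points by blast
  have "realizable (rep_prod rep_point rep_point) rep_nat (\<lambda>z. ordering_code (fst z) (snd z))"
    by (rule realizableI[OF f(1)]) (auto simp: rep_prod_def rep_point_def rep_nat_def f(2))
  from realizable_comp2[OF this assms]
  have "realizable R rep_bool (\<lambda>x. ordering_code (p x) (q x) = 0)"
    by (rule realizable_eq) (rule realizable_nat)
  moreover have "ordering_code a b = 0 \<longleftrightarrow> a < b" for a b by (simp add: ordering_code_def)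
  ultimately show ?thesis by simp
qed

lemma realizable_point_le:
  assumes "realizable R rep_point p" "realizable R rep_point q"
  shows "realizable R rep_bool (\<lambda>x. p x \<le> q x)"
  using realizable_not[OF realizable_point_less[OF assms(2,1)]] by (simp add: not_less)

text \<open>Codes are not unique, and none of the processes compares elements directly. Two elements
  agree exactly if their quotient has no orbitals.\<close>

lemma realizable_elem_eq:
  assumes "realizable R (rep_elem S) \<phi>" "realizable R (rep_elem S) \<psi>"
  shows "realizable R rep_bool (\<lambda>x. \<phi> x = \<psi> x)"
proof (rule realizable_comp2[OF _ assms, of rep_bool "(=)"])
  have "realizable (rep_prod (rep_elem S) (rep_elem S)) rep_bool (\<lambda>z. orbs (snd z \<circ> finv (fst z)) = [])"
    by (rule realizable_null, rule realizable_orbs[OF order_refl], rule realizable_mult[OF S_sub order_refl],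
        rule realizable_finv[OF S_sub order_refl]) (rule realizable_proj)+
  then show "realizable (rep_prod (rep_elem S) (rep_elem S)) rep_bool (\<lambda>z. fst z = snd z)"
  proof (rule realizable_cong)
    fix c and z :: "(real \<Rightarrow> real) \<times> (real \<Rightarrow> real)"
    assume "rep_prod (rep_elem S) (rep_elem S) c z"
    then have z: "fst z \<in> S" "snd z \<in> S" by (auto simp: rep_prod_def rep_elem_def)
    then have p: "fst z \<in> PL_plus" "snd z \<circ> finv (fst z) \<in> PL_plus"
      using S_PL PL_plus_comp PL_plus_inv by blast+
    have "snd z \<circ> finv (fst z) = id \<longleftrightarrow> fst z = snd z"
    proof
      assume "snd z \<circ> finv (fst z) = id"
      then have "snd z (finv (fst z) (fst z x)) = fst z x" for x by (simp add: fun_eq_iff)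
      then show "fst z = snd z" by (simp add: PL_simps(2)[OF p(1)] fun_eq_iff)
    next
      assume "fst z = snd z"
      then show "snd z \<circ> finv (fst z) = id" using PL_simps(1)[OF p(1)] by (simp add: fun_eq_iff)
    qed
    then show "(orbs (snd z \<circ> finv (fst z)) = []) = (fst z = snd z)" using orbs_Nil_iff[OF p(2)] by simp
  qed
qed

lemma realizable_word_val:
  assumes K: "subgroup K PL_group" "K \<subseteq> S"
    and "realizable R (rep_list (rep_elem K)) gs" "realizable R (rep_list rep_nat) w"
  shows "realizable R (rep_elem K) (\<lambda>x. word_val (gs x) (w x))"
proof -
  let ?R = "rep_prod (rep_list (rep_elem K)) rep_nat"
  have "realizable ?R (rep_elem K) (\<lambda>z. letter (fst z) (snd z))"
  proof -
    let ?g = "\<lambda>z. case drop (fst (prod_decode (snd z))) (fst z) of [] \<Rightarrow> id | g # _ \<Rightarrow> g"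
    have g: "realizable ?R (rep_elem K) ?g"
      by (rule realizable_nth_default realizable_elem_id[OF K] realizable_prod_decode | rule realizable_proj)+
    have "realizable ?R (rep_elem K) (\<lambda>z. if snd (prod_decode (snd z)) = 0 then ?g z else finv (?g z))"
      by (rule realizable_if, rule realizable_eq, (rule realizable_prod_decode realizable_nat | rule realizable_proj)+,
          (rule realizable_from_sub, rule g), rule realizable_from_sub, rule realizable_finv[OF K g])
    then show ?thesis by (simp add: letter_def Let_def)
  qed
  note letter = realizable_comp2[OF this]
  have "realizable R (rep_elem K) (\<lambda>x. fold (\<lambda>l acc. letter (gs x) l \<circ> acc) (w x) id)"
  proof (rule realizable_fold[OF assms(4) realizable_elem_id[OF K]])
    show "realizable (rep_prod R (rep_prod rep_nat (rep_elem K))) (rep_elem K)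
       (\<lambda>z. letter (gs (fst z)) (fst (snd z)) \<circ> snd (snd z))"
      by (rule realizable_mult[OF K] letter realizable_comp[OF assms(3)] | rule realizable_proj)+
  qed
  then show ?thesis by (simp add: word_val_def)
qed

abbreviation "rep_bump \<equiv> rep_prod rep_nat (rep_prod (rep_prod rep_point rep_point) (rep_elem S))"

lemma realizable_bumps:
  assumes "realizable R (rep_list (rep_elem C)) gs" "realizable R (rep_list rep_nat) es"
  shows "realizable R (rep_list rep_bump) (\<lambda>x. bumps (gs x) (es x))"
proof -
  let ?R = "rep_prod (rep_list (rep_elem C)) rep_nat"
  have ev: "realizable ?R (rep_elem C) (\<lambda>z. entry_val (fst z) (snd z))"
    unfolding entry_val_def
    by (rule realizable_word_val[OF subgroup C_sub_S] realizable_list_decode realizable_prod_decode | rule realizable_proj)+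
  have drop: "realizable Q (rep_list A) (\<lambda>x. drop (n x) (L x))"
    if "realizable Q (rep_list A) L" "realizable Q rep_nat n" for Q A L n
    using that by (rule realizable_drop)
  have eb: "realizable ?R (rep_list (rep_prod rep_point rep_point)) (\<lambda>z. entry_bumps (fst z) (snd z))"
    unfolding entry_bumps_def
    by (rule drop realizable_orbs[OF C_sub_S ev] realizable_prod_decode | rule realizable_proj)+
  let ?Q = "rep_sub ?R (\<lambda>z. entry_bumps (fst z) (snd z) \<noteq> [])"
  have hd: "realizable ?Q (rep_prod rep_point rep_point) (\<lambda>z. hd (entry_bumps (fst z) (snd z)))"
  proof -
    have "realizable ?Q (rep_sub (rep_list (rep_prod rep_point rep_point)) (\<lambda>l. l \<noteq> [])) (\<lambda>z. entry_bumps (fst z) (snd z))"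
      by (rule realizable_sub[OF realizable_from_sub[OF eb]]) (auto simp: rep_sub_def)
    from realizable_fst[OF realizable_comp[OF realizable_uncons this]] show ?thesis by simp
  qed
  have "realizable ?Q (rep_sub (rep_prod (rep_prod rep_point rep_point) (rep_elem C)) (\<lambda>z. orb (snd z) (fst (fst z)) (snd (fst z))))
     (\<lambda>z. (hd (entry_bumps (fst z) (snd z)), entry_val (fst z) (snd z)))"
  proof (rule realizable_sub[OF realizable_Pair[OF hd realizable_from_sub[OF ev]]])
    fix c z assume z: "?Q c z"
    \<comment> \<open>Membership in \<open>C\<close> is read off the realizer: its output represents
      the value under \<open>rep_elem C\<close>.\<close>
    obtain e where "rep_elem C e (entry_val (fst z) (snd z))"
      using ev z unfolding realizable_def rep_sub_def by blast
    then have "entry_val (fst z) (snd z) \<in> PL_plus" using C_PL by (auto simp: rep_elem_def)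
    moreover have "hd (entry_bumps (fst z) (snd z)) \<in> set (orbs (entry_val (fst z) (snd z)))"
      using z unfolding rep_sub_def entry_bumps_def by (metis in_set_dropD list.set_sel(1))
    ultimately show "orb (snd (hd (entry_bumps (fst z) (snd z)), entry_val (fst z) (snd z)))
        (fst (fst (hd (entry_bumps (fst z) (snd z)), entry_val (fst z) (snd z))))
        (snd (fst (hd (entry_bumps (fst z) (snd z)), entry_val (fst z) (snd z))))"
      using set_orbs by (auto simp: case_prod_beta)
  qed
  from realizable_comp[OF realizable_clip this]
  have cl: "realizable ?Q (rep_elem S) (\<lambda>z. clip (fst (hd (entry_bumps (fst z) (snd z)))) (snd (hd (entry_bumps (fst z) (snd z))))
       (entry_val (fst z) (snd z)))" by simp
  let ?item = "\<lambda>gs e. (fst (prod_decode e), hd (entry_bumps gs e),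
           clip (fst (hd (entry_bumps gs e))) (snd (hd (entry_bumps gs e))) (entry_val gs e))"
  have item: "realizable ?Q rep_bump (\<lambda>z. ?item (fst z) (snd z))"
    by (rule realizable_Pair[OF _ realizable_Pair[OF hd cl]])
       (rule realizable_fst realizable_prod_decode realizable_from_sub[OF realizable_snd[OF realizable_id]])+
  let ?E = "rep_prod R (rep_prod rep_nat (rep_list rep_bump))"
  have env: "realizable ?E ?R (\<lambda>z. (gs (fst z), fst (snd z)))"
    by (rule realizable_Pair realizable_comp[OF assms(1)] | rule realizable_proj)+
  have acc: "realizable ?E (rep_list rep_bump) (\<lambda>z. snd (snd z))" by (rule realizable_proj)+
  have "realizable ?E (rep_list rep_bump) (\<lambda>z. if entry_bumps (gs (fst z)) (fst (snd z)) = [] then snd (snd z)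
     else ?item (gs (fst z)) (fst (snd z)) # snd (snd z))"
  proof (rule realizable_if)
    show "realizable ?E rep_bool (\<lambda>z. entry_bumps (gs (fst z)) (fst (snd z)) = [])"
      using realizable_comp[OF realizable_null[OF eb] env] by simp
    show "realizable (rep_sub ?E (\<lambda>z. entry_bumps (gs (fst z)) (fst (snd z)) = [])) (rep_list rep_bump) (\<lambda>z. snd (snd z))"
      by (rule realizable_from_sub[OF acc])
    let ?F = "rep_sub ?E (\<lambda>z. entry_bumps (gs (fst z)) (fst (snd z)) \<noteq> [])"
    have "realizable ?F ?Q (\<lambda>z. (gs (fst z), fst (snd z)))"
      by (rule realizable_sub[OF realizable_from_sub[OF env]]) (auto simp: rep_sub_def)
    from realizable_comp[OF item this]
    have "realizable ?F rep_bump (\<lambda>z. ?item (gs (fst z)) (fst (snd z)))" by simp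
    then show "realizable ?F (rep_list rep_bump) (\<lambda>z. ?item (gs (fst z)) (fst (snd z)) # snd (snd z))"
      by (rule realizable_Cons[OF _ realizable_from_sub[OF acc]])
  qed
  then have "realizable R (rep_list rep_bump) (\<lambda>x. fold (\<lambda>e acc. if entry_bumps (gs x) e = [] then acc
     else ?item (gs x) e # acc) (es x) [])"
    by (rule realizable_fold[OF assms(2) realizable_Nil])
  then show ?thesis by (simp add: bumps_def)
qed

lemma realizable_bump_fns:
  assumes "realizable R (rep_list rep_bump) Y"
  shows "realizable R (rep_list (rep_elem S)) (\<lambda>x. bump_fns (Y x))"
  unfolding bump_fns_def
  by (rule realizable_fold[OF assms realizable_Nil] realizable_Cons | rule realizable_proj)+

lemma realizable_inside:
  assumes "realizable R rep_bump i" "realizable R rep_bump j"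
  shows "realizable R rep_bool (\<lambda>x. inside (i x) (j x))"
  unfolding inside_def
  by (rule realizable_and realizable_point_less assms | rule realizable_fst realizable_snd)+

lemma realizable_apart:
  assumes "realizable R rep_bump i" "realizable R rep_bump j"
  shows "realizable R rep_bool (\<lambda>x. apart (i x) (j x))"
  unfolding apart_def
  by (rule realizable_or realizable_point_le assms | rule realizable_fst realizable_snd)+

lemma realizable_bump_eq:
  assumes "realizable R rep_bump i" "realizable R rep_bump j"
  shows "realizable R rep_bool (\<lambda>x. i x = j x)"
proof -
  have "realizable R rep_bool (\<lambda>x. lab (i x) = lab (j x) \<and> (\<not> lo (i x) < lo (j x) \<and> \<not> lo (j x) < lo (i x)) \<and>
     (\<not> hi (i x) < hi (j x) \<and> \<not> hi (j x) < hi (i x)) \<and> fn (i x) = fn (j x))"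
    by (rule realizable_and realizable_not realizable_point_less realizable_eq realizable_elem_eq assms
        | rule realizable_fst realizable_snd)+
  moreover have "(lab a = lab b \<and> (\<not> lo a < lo b \<and> \<not> lo b < lo a) \<and> (\<not> hi a < hi b \<and> \<not> hi b < hi a) \<and> fn a = fn b)
     \<longleftrightarrow> a = b" for a b :: bump
    by (auto simp: prod_eq_iff)
  ultimately show ?thesis by simp
qed

section \<open>Decidability of the checks\<close>

lemma realizable_height_check:
  assumes "realizable R rep_nat n" "realizable R (rep_list rep_bump) Y"
  shows "realizable R rep_bool (\<lambda>x. height_check (n x) (Y x))"
proof -
  let ?R1 = "rep_prod R rep_bump" and ?R2 = "rep_prod (rep_prod R rep_bump) rep_bump"
  have a1: "realizable ?R1 rep_bool (\<lambda>z. lab (snd z) < n (fst z))"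
    by (rule realizable_less realizable_comp[OF assms(1)] | rule realizable_proj)+
  have a2: "realizable ?R1 rep_bool (\<lambda>z. Suc (lab (snd z)) = n (fst z))"
    by (rule realizable_eq realizable_Suc realizable_comp[OF assms(1)] | rule realizable_proj)+
  have "realizable ?R2 rep_bool (\<lambda>z. inside (snd z) (snd (fst z)) \<and> Suc (lab (snd z)) = lab (snd (fst z)))"
    by (rule realizable_and realizable_inside realizable_eq realizable_Suc | rule realizable_proj)+
  then have "realizable ?R1 rep_bool (\<lambda>z. \<exists>j\<in>set (Y (fst z)). inside j (snd z) \<and> Suc (lab j) = lab (snd z))"
    using realizable_Bex_list[OF realizable_comp[OF assms(2) realizable_fst[OF realizable_id]]] by fastforce
  then have a3: "realizable ?R1 rep_bool (\<lambda>z. lab (snd z) = 0 \<or> (\<exists>j\<in>set (Y (fst z)). inside j (snd z) \<and> Suc (lab j) = lab (snd z)))"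
    by (rule realizable_or[rotated]) (rule realizable_eq realizable_nat | rule realizable_proj)+
  show ?thesis
    unfolding height_check_def
    by (rule realizable_and[OF realizable_Ball_set[OF assms(2) a1] realizable_and[OF
          realizable_or[OF realizable_eq[OF assms(1) realizable_nat] realizable_Bex_set[OF assms(2) a2]]
          realizable_Ball_set[OF assms(2) a3]]])
qed

lemma realizable_compatible_check:
  assumes "realizable R (rep_list rep_bump) Y"
  shows "realizable R rep_bool (\<lambda>x. compatible_check (Y x))"
proof -
  let ?R2 = "rep_prod (rep_prod R rep_bump) rep_bump"
  have Y1: "realizable (rep_prod R rep_bump) (rep_list rep_bump) (\<lambda>z. Y (fst z))"
    by (rule realizable_comp[OF assms]) (rule realizable_proj)+
  have Y2: "realizable ?R2 (rep_list rep_bump) (\<lambda>z. Y (fst (fst z)))"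
    by (rule realizable_comp[OF assms]) (rule realizable_proj)+
  let ?P = "\<lambda>i j. apart i j \<or> i = j \<or> (inside i j \<and> lab i < lab j) \<or> (inside j i \<and> lab j < lab i)"
  let ?Q = "\<lambda>i j k. inside i k \<and> inside j k \<longrightarrow> hi i \<le> fn k (lo j)"
  have "realizable ?R2 rep_bool (\<lambda>z. ?P (snd (fst z)) (snd z))"
    by (rule realizable_and realizable_or realizable_inside realizable_apart realizable_bump_eq realizable_less
        | rule realizable_proj)+
  then have "realizable (rep_prod R rep_bump) rep_bool (\<lambda>z. \<forall>j\<in>set (Y (fst z)). ?P (snd z) j)"
    by (rule realizable_Ball_set[OF Y1])
  then have 1: "realizable R rep_bool (\<lambda>x. \<forall>i\<in>set (Y x). \<forall>j\<in>set (Y x). ?P i j)"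
    by (rule realizable_Ball_set[OF assms])
  have act: "realizable (rep_prod ?R2 rep_bump) rep_point (\<lambda>z. fn (snd z) (lo (snd (fst z))))"
    by (rule realizable_action[where \<phi> = "\<lambda>z. fn (snd z)" and p = "\<lambda>z. lo (snd (fst z))"]) (rule realizable_proj)+
  have "realizable (rep_prod ?R2 rep_bump) rep_bool (\<lambda>z. ?Q (snd (fst (fst z))) (snd (fst z)) (snd z))"
    by (rule realizable_and realizable_imp realizable_inside realizable_point_le act | rule realizable_proj)+
  then have "realizable ?R2 rep_bool (\<lambda>z. \<forall>k\<in>set (Y (fst (fst z))). ?Q (snd (fst z)) (snd z) k)"
    by (rule realizable_Ball_set[OF Y2])
  then have "realizable (rep_prod R rep_bump) rep_bool (\<lambda>z. \<forall>j\<in>set (Y (fst z)). \<forall>k\<in>set (Y (fst z)). ?Q (snd z) j k)"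
    by (rule realizable_Ball_set[OF Y1])
  then have 2: "realizable R rep_bool (\<lambda>x. \<forall>i\<in>set (Y x). \<forall>j\<in>set (Y x). \<forall>k\<in>set (Y x). ?Q i j k)"
    by (rule realizable_Ball_set[OF assms])
  show ?thesis unfolding compatible_check_def by (rule realizable_and[OF 1 2])
qed

lemma realizable_chain_check:
  assumes gs: "realizable R (rep_list (rep_elem C)) gs" and "realizable R (rep_list rep_nat) u" "realizable R (rep_list rep_nat) v"
  shows "realizable R rep_bool (\<lambda>x. chain_check (gs x) (u x) (v x))"
proof -
  have o: "realizable R (rep_list (rep_prod rep_point rep_point)) (\<lambda>x. orbs (word_val (gs x) (w x)))"
    if "realizable R (rep_list rep_nat) w" for w
    by (rule realizable_orbs[OF C_sub_S realizable_word_val[OF subgroup C_sub_S gs that]])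
  let ?R1 = "rep_prod R (rep_prod rep_point rep_point)"
  have o2: "realizable ?R1 (rep_list (rep_prod rep_point rep_point)) (\<lambda>z. orbs (word_val (gs (fst z)) (v (fst z))))"
    by (rule realizable_comp[OF o[OF assms(3)]]) (rule realizable_proj)+
  have "realizable (rep_prod ?R1 (rep_prod rep_point rep_point)) rep_bool
     (\<lambda>z. fst (snd (fst z)) < fst (snd z) \<and> fst (snd z) < snd (snd (fst z)) \<and> snd (snd (fst z)) < snd (snd z))"
    by (rule realizable_and realizable_point_less | rule realizable_proj)+
  then have "realizable ?R1 rep_bool (\<lambda>z. \<exists>B\<in>set (orbs (word_val (gs (fst z)) (v (fst z)))).
     fst (snd z) < fst B \<and> fst B < snd (snd z) \<and> snd (snd z) < snd B)"
    by (rule realizable_Bex_set[OF o2])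
  then show ?thesis unfolding chain_check_def by (rule realizable_Bex_set[OF o[OF assms(2)]])
qed

lemma realizable_bump_check:
  assumes gs: "realizable R (rep_list (rep_elem C)) gs" and n: "realizable R rep_nat n"
    and es: "realizable R (rep_list rep_nat) es" and vs: "realizable R (rep_list rep_nat) vs"
  shows "realizable R rep_bool (\<lambda>x. bump_check (gs x) (n x) (es x) (vs x))"
proof -
  note Y = realizable_bumps[OF gs es]
  let ?R1 = "rep_prod R (rep_elem C)"
  have F: "realizable (rep_prod ?R1 rep_nat) (rep_list (rep_elem S)) (\<lambda>z. bump_fns (bumps (gs (fst (fst z))) (es (fst (fst z)))))"
    by (rule realizable_comp[OF realizable_bump_fns[OF Y]]) (rule realizable_proj)+
  have inS: "realizable (rep_prod ?R1 rep_nat) (rep_elem S) (\<lambda>z. snd (fst z))"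
    by (rule realizable_mono[where R = "rep_prod ?R1 rep_nat" and S = "rep_elem C"])
       ((rule realizable_proj)+, simp, rule rep_elem_mono[OF C_sub_S])
  have "realizable (rep_prod ?R1 rep_nat) rep_bool
     (\<lambda>z. snd (fst z) = word_val (bump_fns (bumps (gs (fst (fst z))) (es (fst (fst z))))) (list_decode (snd z)))"
    by (rule realizable_elem_eq[OF inS] realizable_word_val[OF S_sub order_refl F] realizable_list_decode | rule realizable_proj)+
  then have "realizable ?R1 rep_bool (\<lambda>z. \<exists>v\<in>set (vs (fst z)). snd z = word_val (bump_fns (bumps (gs (fst z)) (es (fst z)))) (list_decode v))"
    by (rule realizable_Bex_set[rotated]) (rule realizable_comp[OF vs] | rule realizable_proj)+
  then have "realizable R rep_bool (\<lambda>x. \<forall>g\<in>set (gs x). \<exists>v\<in>set (vs x). g = word_val (bump_fns (bumps (gs x) (es x))) (list_decode v))"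
    by (rule realizable_Ball_set[OF gs])
  then show ?thesis unfolding bump_check_def
    by (intro realizable_and realizable_height_check[OF n Y] realizable_compatible_check[OF Y])
qed

lemma realizable_certificate:
  "realizable (rep_prod (rep_list (rep_elem C)) rep_nat) rep_bool (\<lambda>z. certificate (fst z) (snd z))"
proof -
  let ?R = "rep_prod (rep_list (rep_elem C)) rep_nat"
  have gs: "realizable ?R (rep_list (rep_elem C)) fst" and k: "realizable ?R rep_nat snd"
    by (rule realizable_fst[OF realizable_id] realizable_snd[OF realizable_id])+
  note d = realizable_prod_decode[OF k]
  note out = realizable_fst[OF d] and r = realizable_prod_decode[OF realizable_snd[OF d]]
  note a = realizable_list_decode[OF realizable_fst[OF r]] and b = realizable_list_decode[OF realizable_snd[OF r]]
  show ?thesis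
    unfolding certificate_def Let_def
    by (intro realizable_or realizable_and realizable_eq realizable_less realizable_chain_check realizable_bump_check
        realizable_diff gs out a b realizable_nat)
qed

text \<open>Completeness of certificates makes the search terminate, and soundness identifies the
  first component of what it finds.\<close>

lemma realizable_answer:
  "realizable (rep_list (rep_elem C)) rep_nat (\<lambda>gs. answer (set gs))"
proof -
  have CP: "set gs \<subseteq> PL_plus" if "rep_list (rep_elem C) c gs" for c gs
  proof -
    obtain cs where "list_all2 (rep_elem C) cs gs" using \<open>rep_list (rep_elem C) c gs\<close> unfolding rep_list_def by blast
    then have "\<forall>g\<in>set gs. g \<in> C" by (induction rule: list_all2_induct) (auto simp: rep_elem_def)
    then show ?thesis using C_PL by blast
  qed
  have "realizable (rep_list (rep_elem C)) rep_nat (\<lambda>gs. LEAST k. certificate gs k)"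
    by (rule realizable_search[OF realizable_certificate]) (use certificate_complete CP in blast)
  from realizable_fst[OF realizable_prod_decode[OF this]]
  show ?thesis
  proof (rule realizable_cong)
    fix c gs assume "rep_list (rep_elem C) c gs"
    then have gs: "set gs \<subseteq> PL_plus" by (rule CP)
    then obtain k where "certificate gs k" using certificate_complete by blast
    then have "certificate gs (LEAST k. certificate gs k)" by (rule LeastI)
    then show "fst (prod_decode (LEAST k. certificate gs k)) = answer (set gs)" by (rule certificate_sound[OF gs])
  qed
qed

end

theorem theorem4p4:
  fixes C :: "(real \<Rightarrow> real) set"
    and \<nu> :: "nat \<rightharpoonup> (real \<Rightarrow> real)"
    and \<delta> \<mu> :: "nat \<rightharpoonup> real"
  assumes "computable_subgroup C \<nu> \<delta> \<mu>"
  shows "\<exists>f. partial_recursive f \<and>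
           (\<forall>cs xs. list_all2 (\<lambda>c g. \<nu> c = Some g) cs xs \<and> set xs \<subseteq> C \<longrightarrow>
              f (list_encode cs) =
                Some (if solvable (generated_group (set xs))
                      then Suc (derived_length (generated_group (set xs)))
                      else 0))"
proof -
  interpret computable_subgroup C \<nu> \<delta> \<mu> by (rule assms)
  obtain f where f: "partial_recursive f"
    "\<And>c gs. rep_list (rep_elem C) c gs \<Longrightarrow> f c = Some (answer (set gs))"
    using realizable_answer unfolding realizable_def rep_nat_def by metis
  have "f (list_encode cs) = Some (answer (set xs))"
    if "list_all2 (\<lambda>c g. \<nu> c = Some g) cs xs" "set xs \<subseteq> C" for cs xs
  proof (rule f(2))
    have "list_all2 (rep_elem C) cs xs"
      using that by (induction rule: list_all2_induct) (auto simp: rep_elem_def)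
    then show "rep_list (rep_elem C) (list_encode cs) xs" unfolding rep_list_def by blast
  qed
  then show ?thesis using f(1) unfolding answer_def by blast
qed

end
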